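(* Let $d=d_{\mathrm h}+d_{\mathrm p}$ with integers $1\le d_{\mathrm h}<d$ and $1\le d_{\mathrm p}<d$, let $m\in\{1,\dots,d\}$, let $D\in\mathcal M_{d_{\mathrm p}}(\mathbb R)$ satisfy $\mathrm{Re}(\mathrm{Sp}(D))\subset(0,+\infty)$, let $B=\begin{pmatrix}0&0\\0&D\end{pmatrix}\in\mathcal M_d(\mathbb R)$, let $A=\begin{pmatrix}A'&A_{12}\\ A_{21}&A_{22}\end{pmatrix}\in\mathcal M_d(\mathbb R)$ where $A'\in\mathcal M_{d_{\mathrm h}}(\mathbb R)$ is diagonalizable with $\mathrm{Sp}(A')\subset\mathbb R$, let $K\in\mathcal M_d(\mathbb R)$ and $M\in\mathcal M_{d,m}(\mathbb R)$. Let $\omega$ be a nonempty open subset of $\mathbb T$. Let $T>0$ and assume that there exist $N\in\mathbb N$, $N\ge1$, and $k\in\mathbb N$ such that every initial condition $f_0\in H^k(\mathbb T)^d$ of the form $f_0=\sum_{|n|>N}X_n\mathrm e^{\mathrm inx}$ (i.e. whose Fourier coefficients of index $|n|\le N$ vanish) can be steered to $0$ in time $T$, i.e. there exists $u\in L^2((0,T)\times\omega)^m$ such that the solution $f$ of $$\partial_t f-B\partial_x^2f+A\partial_xf+Kf=Mu\mathbf 1_\omega\ \text{ in }(0,T)\times\mathbb T,\qquad f(0,\cdot)=f_0,$$ satisfies $f(T,\cdot)=0$. Then $T\ge T_*$.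
   Context: $\mathbb T=\mathbb R/(2\pi\mathbb Z)$. The state is $f:[0,T]\times\mathbb T\to\mathbb R^d$ and the control is $u:[0,T]\times\mathbb T\to\mathbb R^m$. Solutions are mild solutions in $C([0,T];L^2(\mathbb T)^d)$: the operator $-\mathcal L$, where $\mathcal Lf=-B\partial_x^2f+A\partial_xf+Kf$ with domain $H^1(\mathbb T)^{d_{\mathrm h}}\times H^2(\mathbb T)^{d_{\mathrm p}}$, generates a strongly continuous semigroup on $L^2(\mathbb T)^d$. $\ell(\omega):=\sup\{|I| : I\text{ connected component of }\mathbb T\setminus\omega\}$, where $|I|$ is the length of $I$; $\mu_*:=\min\{|\mu| : \mu\in\mathrm{Sp}(A')\}$; $T_*=T^*(\omega):=\ell(\omega)/\mu_*$ if $\mu_*>0$, and $T_*:=+\infty$ if $\mu_*=0$ (in which case the conclusion $T\ge T_*$ means that no such $T$ exists).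
   Formalization: When μ_*=0 it is additionally assumed that ℓ(ω)>0; otherwise the claim fails, e.g. for ω=𝕋, d_h=d_p=1, m=2, A=K=0, D=1, M=I, where every f_0 can be steered to 0 in any time T>0 although T_*=+∞. *)

theory Defs
  imports "HOL-Analysis.Analysis"
begin

section \<open>The space of square-integrable functions on the circle\<close>

text \<open>
  The circle $\mathbf{R}/2\pi\mathbf{Z}$ is used in two models: as a topological space it is the
  unit circle \<open>sphere 0 1\<close> of the complex plane, as a measure space it is the fundamental domain
  $[0,2\pi)$ with Lebesgue measure (total mass $2\pi$). They are identified through \<open>x \<mapsto> cis x\<close>.
\<close>

definition torus :: "real measure" where
  "torus = restrict_space lborel {0..<2*pi}"

definition square_integrable :: "(real \<Rightarrow> 'b::euclidean_space) \<Rightarrow> bool" where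
  "square_integrable f \<longleftrightarrow>
     f \<in> borel_measurable torus \<and> integrable torus (\<lambda>x. (norm (f x))\<^sup>2)"

definition l2_eq :: "(real \<Rightarrow> 'b::euclidean_space) \<Rightarrow> (real \<Rightarrow> 'b) \<Rightarrow> bool" where
  "l2_eq f g \<longleftrightarrow> square_integrable f \<and> square_integrable g \<and> (AE x in torus. f x = g x)"

lemma square_integrable_zero [simp]: "square_integrable (\<lambda>x. 0)"
  by (simp add: square_integrable_def)

lemma square_integrable_scaleR:
  "square_integrable f \<Longrightarrow> square_integrable (\<lambda>x. c *\<^sub>R f x)"
  by (auto simp: square_integrable_def power_mult_distrib)

lemma square_integrable_add:
  assumes "square_integrable f" "square_integrable g"
  shows "square_integrable (\<lambda>x. f x + g x)"
proof -
  have m: "f \<in> borel_measurable torus" "g \<in> borel_measurable torus"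
    using assms by (auto simp: square_integrable_def)
  have "integrable torus (\<lambda>x. (norm (f x + g x))\<^sup>2)"
  proof (rule Bochner_Integration.integrable_bound)
    show "integrable torus (\<lambda>x. 2 * (norm (f x))\<^sup>2 + 2 * (norm (g x))\<^sup>2)"
      using assms by (auto simp: square_integrable_def)
    have "(norm (f x + g x))\<^sup>2 \<le> 2 * (norm (f x))\<^sup>2 + 2 * (norm (g x))\<^sup>2" for x
    proof -
      have "(norm (f x + g x))\<^sup>2 \<le> (norm (f x) + norm (g x))\<^sup>2"
        by (intro power_mono norm_triangle_ineq) simp
      also have "\<dots> \<le> 2 * (norm (f x))\<^sup>2 + 2 * (norm (g x))\<^sup>2"
        using sum_squares_bound[of "norm (f x)" "norm (g x)"] by (simp add: power2_sum)
      finally show ?thesis .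
    qed
    then show "AE x in torus. norm ((norm (f x + g x))\<^sup>2)
        \<le> norm (2 * (norm (f x))\<^sup>2 + 2 * (norm (g x))\<^sup>2)"
      by simp
  qed (use m in measurable)
  then show ?thesis using m by (simp add: square_integrable_def)
qed

lemma square_integrable_minus: "square_integrable f \<Longrightarrow> square_integrable (\<lambda>x. - f x)"
  using square_integrable_scaleR[of f "-1"] by simp

lemma square_integrable_inner:
  assumes "square_integrable f" "square_integrable g"
  shows "integrable torus (\<lambda>x. f x \<bullet> g x)"
proof (rule Bochner_Integration.integrable_bound)
  show "integrable torus (\<lambda>x. (norm (f x))\<^sup>2 + (norm (g x))\<^sup>2)"
    using assms by (auto simp: square_integrable_def)
  show "(\<lambda>x. f x \<bullet> g x) \<in> borel_measurable torus"
    using assms by (auto simp: square_integrable_def)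
  have "\<bar>f x \<bullet> g x\<bar> \<le> (norm (f x))\<^sup>2 + (norm (g x))\<^sup>2" for x
  proof -
    have "\<bar>f x \<bullet> g x\<bar> \<le> norm (f x) * norm (g x)" by (rule Cauchy_Schwarz_ineq2)
    moreover have "2 * (norm (f x) * norm (g x)) \<le> (norm (f x))\<^sup>2 + (norm (g x))\<^sup>2"
      using sum_squares_bound[of "norm (f x)" "norm (g x)"] by simp
    moreover have "0 \<le> norm (f x) * norm (g x)" by simp
    ultimately show ?thesis by linarith
  qed
  then show "AE x in torus. norm (f x \<bullet> g x) \<le> norm ((norm (f x))\<^sup>2 + (norm (g x))\<^sup>2)"
    by simp
qed

lemma part_equivp_l2_eq: "part_equivp l2_eq"
proof (rule part_equivpI)
  show "\<exists>f. l2_eq f f" by (rule exI[of _ "\<lambda>x. 0"]) (simp add: l2_eq_def)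
  show "symp l2_eq" by (rule sympI) (auto simp: l2_eq_def)
  show "transp l2_eq" by (rule transpI) (auto simp: l2_eq_def elim: AE_mp)
qed

quotient_type (overloaded) 'b L2 = "real \<Rightarrow> 'b::euclidean_space" / partial: l2_eq
  morphisms rep_L2 abs_L2
  by (rule part_equivp_l2_eq)

instantiation L2 :: (euclidean_space) real_vector
begin

lift_definition zero_L2 :: "'a L2" is "\<lambda>x. 0"
  by (simp add: l2_eq_def)

lift_definition plus_L2 :: "'a L2 \<Rightarrow> 'a L2 \<Rightarrow> 'a L2" is "\<lambda>f g x. f x + g x"
  by (auto simp: l2_eq_def square_integrable_add)

lift_definition uminus_L2 :: "'a L2 \<Rightarrow> 'a L2" is "\<lambda>f x. - f x"
  by (auto simp: l2_eq_def square_integrable_minus)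

lift_definition scaleR_L2 :: "real \<Rightarrow> 'a L2 \<Rightarrow> 'a L2" is "\<lambda>c f x. c *\<^sub>R f x"
  by (auto simp: l2_eq_def square_integrable_scaleR)

definition minus_L2 :: "'a L2 \<Rightarrow> 'a L2 \<Rightarrow> 'a L2" where "minus_L2 f g = f + - g"

instance
proof
  fix f g h :: "'a L2" and a b :: real
  show "f + g + h = f + (g + h)"
    by transfer (auto simp: l2_eq_def square_integrable_add algebra_simps)
  show "f + g = g + f"
    by transfer (auto simp: l2_eq_def square_integrable_add algebra_simps)
  show "0 + f = f" by transfer (auto simp: l2_eq_def)
  show "- f + f = 0" by transfer (auto simp: l2_eq_def)
  show "f - g = f + - g" by (rule minus_L2_def)
  show "a *\<^sub>R (f + g) = a *\<^sub>R f + a *\<^sub>R g"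
    by transfer (auto simp: l2_eq_def algebra_simps
        intro!: square_integrable_add square_integrable_scaleR)
  show "(a + b) *\<^sub>R f = a *\<^sub>R f + b *\<^sub>R f"
    by transfer (auto simp: l2_eq_def scaleR_left_distrib
        intro!: square_integrable_add square_integrable_scaleR)
  show "a *\<^sub>R b *\<^sub>R f = (a * b) *\<^sub>R f"
    by transfer (auto simp: l2_eq_def square_integrable_scaleR)
  show "1 *\<^sub>R f = f" by transfer (auto simp: l2_eq_def)
qed

end

instantiation L2 :: (euclidean_space) real_inner
begin

lift_definition inner_L2 :: "'a L2 \<Rightarrow> 'a L2 \<Rightarrow> real" is "\<lambda>f g. LINT x|torus. f x \<bullet> g x"
  by (rule integral_cong_AE) (auto simp: l2_eq_def square_integrable_def)

definition norm_L2 :: "'a L2 \<Rightarrow> real" where "norm_L2 f = sqrt (inner f f)"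
definition sgn_L2 :: "'a L2 \<Rightarrow> 'a L2" where "sgn_L2 f = f /\<^sub>R norm f"
definition dist_L2 :: "'a L2 \<Rightarrow> 'a L2 \<Rightarrow> real" where "dist_L2 f g = norm (f - g)"
definition uniformity_L2 :: "('a L2 \<times> 'a L2) filter" where
  "uniformity_L2 = (INF e\<in>{0 <..}. principal {(x, y). dist x y < e})"
definition open_L2 :: "'a L2 set \<Rightarrow> bool" where
  "open_L2 U = (\<forall>x\<in>U. eventually (\<lambda>(x', y). x' = x \<longrightarrow> y \<in> U) uniformity)"

instance
proof
  fix f g h :: "'a L2" and a :: real
  show "sgn f = f /\<^sub>R norm f" by (rule sgn_L2_def)
  show "dist f g = norm (f - g)" by (rule dist_L2_def)
  show "(uniformity :: ('a L2 \<times> 'a L2) filter)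
      = (INF e\<in>{0 <..}. principal {(x, y). dist x y < e})"
    by (rule uniformity_L2_def)
  show "open U = (\<forall>x\<in>U. eventually (\<lambda>(x', y). x' = x \<longrightarrow> y \<in> U) uniformity)" for U :: "'a L2 set"
    by (rule open_L2_def)
  show "inner f g = inner g f" by transfer (simp add: inner_commute)
  show "inner (f + g) h = inner f h + inner g h"
    by transfer (auto simp: l2_eq_def inner_add_left square_integrable_inner
        intro!: Bochner_Integration.integral_add)
  show "inner (a *\<^sub>R f) g = a * inner f g" by transfer simp
  show "0 \<le> inner f f" by transfer simp
  show "inner f f = 0 \<longleftrightarrow> f = 0"
  proof transfer
    fix f :: "real \<Rightarrow> 'a"
    assume "l2_eq f f"
    then have f: "square_integrable f" by (simp add: l2_eq_def)
    then have "(LINT x|torus. f x \<bullet> f x) = 0 \<longleftrightarrow> (AE x in torus. f x \<bullet> f x = 0)"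
      by (intro integral_nonneg_eq_0_iff_AE square_integrable_inner) auto
    with f show "(LINT x|torus. f x \<bullet> f x) = 0 \<longleftrightarrow> l2_eq f (\<lambda>x. 0)"
      by (simp add: l2_eq_def)
  qed
  show "norm f = sqrt (inner f f)" by (rule norm_L2_def)
qed

end

text \<open>The class of a square-integrable function.\<close>

definition l2_of :: "(real \<Rightarrow> 'b::euclidean_space) \<Rightarrow> 'b L2" where
  "l2_of f = (if square_integrable f then abs_L2 f else 0)"

text \<open>Pointwise application of \<open>h\<close>; meant for bounded linear \<open>h\<close>.\<close>

definition l2_map :: "('b \<Rightarrow> 'c) \<Rightarrow> 'b::euclidean_space L2 \<Rightarrow> 'c::euclidean_space L2" where
  "l2_map h f = l2_of (\<lambda>x. h (rep_L2 f x))"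

definition fourier_coeff :: "(real ^ 'd) L2 \<Rightarrow> int \<Rightarrow> complex ^ 'd" where
  "fourier_coeff f n =
     (\<chi> i. (LINT x|torus. complex_of_real (rep_L2 f x $ i) * cis (- (of_int n * x))) / (2 * pi))"


section \<open>Weak derivatives and Sobolev spaces on the circle\<close>

definition test_function :: "(real \<Rightarrow> real) \<Rightarrow> bool" where
  "test_function \<psi> \<longleftrightarrow>
     (\<forall>k x. (deriv ^^ k) \<psi> differentiable at x) \<and> (\<forall>x. \<psi> (x + 2 * pi) = \<psi> x)"

definition has_weak_deriv :: "'b::euclidean_space L2 \<Rightarrow> 'b L2 \<Rightarrow> bool" where
  "has_weak_deriv f g \<longleftrightarrow>
     (\<forall>\<psi>. test_function \<psi> \<longrightarrow>
        (LINT x|torus. deriv \<psi> x *\<^sub>R rep_L2 f x) = - (LINT x|torus. \<psi> x *\<^sub>R rep_L2 g x))"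

text \<open>Meaningful only if \<open>f\<close> is in \<open>sobolev 1\<close>; the weak derivative is then unique.\<close>

definition weak_deriv :: "'b::euclidean_space L2 \<Rightarrow> 'b L2" where
  "weak_deriv f = (THE g. has_weak_deriv f g)"

fun sobolev :: "nat \<Rightarrow> 'b::euclidean_space L2 set" where
  "sobolev 0 = UNIV"
| "sobolev (Suc k) = {f. \<exists>g\<in>sobolev k. has_weak_deriv f g}"


section \<open>Matrices\<close>

definition block_matrix ::
  "'a ^ 'h ^ 'h \<Rightarrow> 'a ^ 'p ^ 'h \<Rightarrow> 'a ^ 'h ^ 'p \<Rightarrow> 'a ^ 'p ^ 'p \<Rightarrow> 'a ^ ('h + 'p) ^ ('h + 'p)" where
  "block_matrix P Q R S = (\<chi> i j. case i of
       Inl a \<Rightarrow> (case j of Inl b \<Rightarrow> P $ a $ b | Inr b \<Rightarrow> Q $ a $ b)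
     | Inr a \<Rightarrow> (case j of Inl b \<Rightarrow> R $ a $ b | Inr b \<Rightarrow> S $ a $ b))"

definition Sp :: "real ^ 'n ^ 'n \<Rightarrow> complex set" where
  "Sp M = {l. \<exists>v :: complex ^ 'n. v \<noteq> 0 \<and> map_matrix complex_of_real M *v v = l *s v}"

definition diagonalizable :: "real ^ 'n ^ 'n \<Rightarrow> bool" where
  "diagonalizable M \<longleftrightarrow>
     (\<exists>P \<Delta> :: real ^ 'n ^ 'n. invertible P \<and> (\<forall>i j. i \<noteq> j \<longrightarrow> \<Delta> $ i $ j = 0) \<and> M = P ** \<Delta> ** matrix_inv P)"


section \<open>The parabolic-transport operator and its semigroup\<close>

definition hyp_part :: "(real ^ ('h::finite + 'p::finite)) L2 \<Rightarrow> (real ^ 'h) L2" where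
  "hyp_part = l2_map (\<lambda>v. \<chi> i. v $ Inl i)"

definition par_part :: "(real ^ ('h::finite + 'p::finite)) L2 \<Rightarrow> (real ^ 'p) L2" where
  "par_part = l2_map (\<lambda>v. \<chi> i. v $ Inr i)"

definition op_domain :: "(real ^ ('h::finite + 'p::finite)) L2 set" where
  "op_domain = {f. hyp_part f \<in> sobolev 1 \<and> par_part f \<in> sobolev 2}"

text \<open>
  For \<open>f\<close> in \<open>op_domain\<close> only the parabolic part has a second derivative in $L^2$. As the matrix
  \<open>B\<close> is constant and its only nonzero block is the parabolic one, $B\partial_x^2f$ is the second
  derivative of $Bf$, and $Bf$ is in $H^2$.
\<close>

definition parabolic_transport_op ::
  "real ^ ('h + 'p) ^ ('h + 'p) \<Rightarrow> real ^ ('h + 'p) ^ ('h + 'p) \<Rightarrow> real ^ ('h + 'p) ^ ('h + 'p) \<Rightarrow>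
   (real ^ ('h::finite + 'p::finite)) L2 \<Rightarrow> (real ^ ('h + 'p)) L2" where
  "parabolic_transport_op B A K f =
     - weak_deriv (weak_deriv (l2_map (\<lambda>v. B *v v) f))
     + l2_map (\<lambda>v. A *v v) (weak_deriv f) + l2_map (\<lambda>v. K *v v) f"

definition C0_semigroup :: "(real \<Rightarrow> 'x::real_normed_vector \<Rightarrow> 'x) \<Rightarrow> bool" where
  "C0_semigroup S \<longleftrightarrow>
     (\<forall>t\<ge>0. bounded_linear (S t)) \<and> S 0 = id \<and>
     (\<forall>s\<ge>0. \<forall>t\<ge>0. S (s + t) = S s \<circ> S t) \<and>
     (\<forall>f. ((\<lambda>t. S t f) \<longlongrightarrow> f) (at_right 0))"

definition generator_graph :: "(real \<Rightarrow> 'x::real_normed_vector \<Rightarrow> 'x) \<Rightarrow> ('x \<times> 'x) set" where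
  "generator_graph S = {(f, g). ((\<lambda>t. (S t f - f) /\<^sub>R t) \<longlongrightarrow> g) (at_right 0)}"

text \<open>
  The operator $-\mathcal{L}$ is closed on \<open>op_domain\<close> exactly if the transport block $A'$ is
  invertible. In general its closure generates the semigroup, so the graph is closed here; this
  changes nothing if $A'$ is invertible.
\<close>

definition semigroup_generated ::
  "real ^ ('h + 'p) ^ ('h + 'p) \<Rightarrow> real ^ ('h + 'p) ^ ('h + 'p) \<Rightarrow> real ^ ('h + 'p) ^ ('h + 'p) \<Rightarrow>
   (real \<Rightarrow> (real ^ ('h::finite + 'p::finite)) L2 \<Rightarrow> (real ^ ('h + 'p)) L2) \<Rightarrow> bool" where
  "semigroup_generated B A K S \<longleftrightarrow>
     C0_semigroup S \<and>
     generator_graph S = closure ((\<lambda>f. (f, - parabolic_transport_op B A K f)) ` op_domain)"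


section \<open>Null-controllability\<close>

definition admissible_control ::
  "real \<Rightarrow> complex set \<Rightarrow> (real \<times> real \<Rightarrow> 'b::euclidean_space) \<Rightarrow> bool" where
  "admissible_control T \<omega> u \<longleftrightarrow>
     (let Q = {(t, x). 0 < t \<and> t < T \<and> 0 \<le> x \<and> x < 2 * pi \<and> cis x \<in> \<omega>} in
      set_borel_measurable lborel Q u \<and> set_integrable lborel Q (\<lambda>p. (norm (u p))\<^sup>2))"

definition forcing ::
  "real ^ 'm ^ 'd \<Rightarrow> complex set \<Rightarrow> (real \<times> real \<Rightarrow> real ^ 'm) \<Rightarrow> real \<Rightarrow> (real ^ 'd) L2" where
  "forcing M \<omega> u s = l2_of (\<lambda>x. indicator \<omega> (cis x) *\<^sub>R (M *v u (s, x)))"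

text \<open>
  Duhamel's formula in $C([0,T];L^2)$. The semigroup is determined by its generator. The
  Henstock-Kurzweil integral of vector-valued functions agrees with the Bochner integral on the
  Bochner-integrable integrands that arise from admissible controls.
\<close>

definition mild_solution ::
  "real ^ ('h + 'p) ^ ('h + 'p) \<Rightarrow> real ^ ('h + 'p) ^ ('h + 'p) \<Rightarrow> real ^ ('h + 'p) ^ ('h + 'p) \<Rightarrow>
   real ^ 'm ^ ('h + 'p) \<Rightarrow> complex set \<Rightarrow> real \<Rightarrow> (real ^ ('h::finite + 'p::finite)) L2 \<Rightarrow>
   (real \<times> real \<Rightarrow> real ^ 'm) \<Rightarrow> (real \<Rightarrow> (real ^ ('h + 'p)) L2) \<Rightarrow> bool" where
  "mild_solution B A K M \<omega> T f0 u f \<longleftrightarrow>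
     continuous_on {0..T} f \<and>
     (\<exists>S. semigroup_generated B A K S \<and>
        (\<forall>t\<in>{0..T}. ((\<lambda>s. S (t - s) (forcing M \<omega> u s)) has_integral (f t - S t f0)) {0..t}))"

definition steerable_to_zero ::
  "real ^ ('h + 'p) ^ ('h + 'p) \<Rightarrow> real ^ ('h + 'p) ^ ('h + 'p) \<Rightarrow> real ^ ('h + 'p) ^ ('h + 'p) \<Rightarrow>
   real ^ 'm ^ ('h + 'p) \<Rightarrow> complex set \<Rightarrow> real \<Rightarrow> (real ^ ('h::finite + 'p::finite)) L2 \<Rightarrow> bool" where
  "steerable_to_zero B A K M \<omega> T f0 \<longleftrightarrow>
     (\<exists>u f. admissible_control T \<omega> u \<and> mild_solution B A K M \<omega> T f0 u f \<and> f T = 0)"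


section \<open>The minimal time\<close>

definition arc_length :: "complex set \<Rightarrow> real" where
  "arc_length I = measure lborel {x \<in> {0..<2*pi}. cis x \<in> I}"

text \<open>The element 0 only matters if \<open>\<omega>\<close> is the whole circle: it fixes the supremum of no lengths.\<close>

definition gap_length :: "complex set \<Rightarrow> real" where
  "gap_length \<omega> = Sup (insert 0 (arc_length ` components (sphere 0 1 - \<omega>)))"

definition min_speed :: "real ^ 'n ^ 'n \<Rightarrow> real" where
  "min_speed A' = Min (cmod ` Sp A')"

definition minimal_time :: "real ^ 'n ^ 'n \<Rightarrow> complex set \<Rightarrow> ereal" where
  "minimal_time A' \<omega> =
     (if min_speed A' > 0 then ereal (gap_length \<omega> / min_speed A') else \<infinity>)"

end

theory Submission
  imports Defs "HOL-Complex_Analysis.Cauchy_Integral_Formula"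
begin

text \<open>
  The transport part of the system moves information along the circle with the eigenvalues of
  \<open>A'\<close> as speeds, and the control cannot act on what stays inside the complement of \<open>\<omega>\<close> during the
  whole time interval. If \<open>T\<close> is smaller than the minimal time, an eigenvalue \<open>\<mu>\<close> of least modulus
  satisfies \<open>\<bar>\<mu>\<bar> * T < gap_length \<omega>\<close>, so some arc \<open>[a, b]\<close> outside \<open>\<omega>\<close> is long enough to contain the
  trajectory \<open>x0 + \<mu> * s\<close>, \<open>0 \<le> s \<le> T\<close>, with a margin on both sides
  (\<open>long_gap_contains_long_interval\<close>). High-frequency solutions of the adjoint equation that are
  concentrated along this trajectory are invisible on \<open>\<omega>\<close>, and this contradicts the duality between
  steering and observation.

  The adjoint equation is solved approximately and explicitly. For a scalar profile \<open>\<psi>\<close>, the wave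
  \<open>\<Sum>p\<le>P. \<psi>\<^bsup>(P-p)\<^esup>(x - \<mu> * s) c\<^sub>p(s)\<close> satisfies it up to terms that contain only \<open>\<psi>\<close> and \<open>\<psi>'\<close>, as soon
  as the vectors \<open>c\<^sub>p\<close> satisfy
  \<open>B\<^sup>T c\<^sub>p\<^sub>+\<^sub>2 + (A\<^sup>T - \<mu>) c\<^sub>p\<^sub>+\<^sub>1 + c\<^sub>p' - K\<^sup>T c\<^sub>p = 0\<close> (with \<open>c\<^sub>p = 0\<close> for negative \<open>p\<close>). This is a formal
  high-frequency expansion in which a derivative of the profile counts as one power of the frequency;
  it is the same for all profiles and all frequencies, and its coefficients are real. The recursion is
  solvable because the parabolic block of \<open>B\<close> is invertible and \<open>A'\<close> is diagonalizable: the parabolic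
  components and the components in the range of \<open>A'\<^sup>T - \<mu>\<close> are determined algebraically, and the
  components in the kernel by a linear differential equation
  (\<open>formal_solution\<close>, \<open>adjoint_profiles\<close>, \<open>residual_telescopes\<close>).

  The profile is \<open>\<psi>(y) = cos (n * y) * ((1 + cos (y - x0)) / 2) ^ R\<close> with \<open>n = 4 * R\<close>. It is a
  trigonometric polynomial with frequencies in \<open>[n - R, n + R]\<close>, and it and its derivatives are
  exponentially small away from \<open>x0\<close> (\<open>packet_small_off_support\<close>). The initial datum is one lacunary
  series, \<open>\<Sum>j. n\<^sub>j\<^bsup>-k-1\<^esup> cos (n\<^sub>j * x) e\<close> with \<open>n\<^sub>j = 4 * 2\<^bsup>j+N\<^esup>\<close>: it is in \<open>H\<^sup>k\<close>, has no low
  frequencies, and the packet of frequency \<open>n\<^sub>i\<close> meets only its \<open>i\<close>-th term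
  (\<open>lacunary_packet_pairing\<close>).

  The comparison of the two sides is \<open>steering_inequality\<close>: if \<open>f0\<close> is steered to zero, its scalar
  product with the wave at time 0 is at most a constant times the sum of the residual and of the size of
  the wave on \<open>\<omega>\<close>. Its proof uses that the semigroup is bounded on \<open>[0, T]\<close>, hence completeness of
  the space of square-integrable functions and the uniform boundedness principle, and that the domain
  of the generator is dense (\<open>approximate_adjoint_solution\<close>). Along the packets
  of width parameter \<open>R = 2\<^bsup>i+N\<^esup>\<close> the left-hand side grows at least like \<open>R\<^sup>2\<close> and the right-hand side at
  most like \<open>R\<close>, a contradiction for large \<open>i\<close>.
\<close>

section \<open>Completeness of the space of square-integrable functions\<close>

lemma space_torus [simp]: "space torus = {0..<2*pi}"
  by (simp add: torus_def space_restrict_space)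

lemma emeasure_torus: "emeasure torus (space torus) = ennreal (2*pi)"
  by (simp add: torus_def emeasure_restrict_space space_restrict_space)

lemma finite_measure_torus: "finite_measure torus"
  by (rule finite_measureI) (simp only: emeasure_torus, simp)

lemma measure_torus: "measure torus {0..<2*pi} = 2*pi"
  using emeasure_torus by (simp add: measure_def)

lemma measurable_torusI: "f \<in> borel_measurable borel \<Longrightarrow> f \<in> borel_measurable torus"
  unfolding torus_def by (intro measurable_restrict_space1) simp

lemma continuous_measurable_torus:
  "continuous_on UNIV f \<Longrightarrow> f \<in> borel_measurable torus"
  by (intro measurable_torusI borel_measurable_continuous_onI)

lemma integrable_torus_const [simp]: "integrable torus (\<lambda>x. c :: real)"
  using finite_measure.integrable_const[OF finite_measure_torus] .

lemma square_integrable_bounded: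
  assumes "f \<in> borel_measurable torus" "\<And>x. norm (f x) \<le> C"
  shows "square_integrable f"
  unfolding square_integrable_def
proof (intro conjI assms(1))
  have "(norm (f x))\<^sup>2 \<le> C\<^sup>2" for x
    using assms(2)[of x] by (intro power_mono) auto
  then show "integrable torus (\<lambda>x. (norm (f x))\<^sup>2)"
    using assms(1)
    by (intro finite_measure.integrable_const_bound[OF finite_measure_torus, where B = "C\<^sup>2"]) auto
qed

lemma square_integrable_rep [simp]: "square_integrable (rep_L2 f)"
proof -
  have "l2_eq (rep_L2 f) (rep_L2 f)"
    using Quotient_rel_rep[OF Quotient_L2, of f f] by simp
  then show ?thesis by (simp add: l2_eq_def)
qed

lemma l2_of_rep [simp]: "l2_of (rep_L2 f) = f"
  by (simp add: l2_of_def Quotient_abs_rep[OF Quotient_L2])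

lemma rep_l2_of:
  assumes "square_integrable f"
  shows "AE x in torus. rep_L2 (l2_of f) x = f x"
proof -
  have "l2_eq (rep_L2 (abs_L2 f)) f"
    using Quotient_rep_abs[OF Quotient_L2, of f] assms by (simp add: l2_eq_def)
  then show ?thesis using assms by (simp add: l2_of_def l2_eq_def)
qed

lemma l2_of_eq_iff:
  assumes "square_integrable f" "square_integrable g"
  shows "l2_of f = l2_of g \<longleftrightarrow> (AE x in torus. f x = g x)"
  using Quotient_rel[OF Quotient_L2, of f g] assms by (auto simp: l2_of_def l2_eq_def)

lemma l2_eqI_AE: "(AE x in torus. rep_L2 f x = rep_L2 g x) \<Longrightarrow> f = g"
  by (metis l2_of_eq_iff l2_of_rep square_integrable_rep)

lemma l2_of_add:
  assumes "square_integrable f" "square_integrable g"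
  shows "l2_of (\<lambda>x. f x + g x) = l2_of f + l2_of g"
  using assms by (simp add: l2_of_def square_integrable_add plus_L2.abs_eq l2_eq_def)

lemma l2_of_scaleR:
  assumes "square_integrable f"
  shows "l2_of (\<lambda>x. c *\<^sub>R f x) = c *\<^sub>R l2_of f"
  using assms by (simp add: l2_of_def square_integrable_scaleR scaleR_L2.abs_eq l2_eq_def)

lemma rep_add: "AE x in torus. rep_L2 (f + g) x = rep_L2 f x + rep_L2 g x"
  using rep_l2_of[OF square_integrable_add[OF square_integrable_rep square_integrable_rep], of f g]
  by (simp add: l2_of_add)

lemma rep_scaleR: "AE x in torus. rep_L2 (c *\<^sub>R f) x = c *\<^sub>R rep_L2 f x"
  using rep_l2_of[OF square_integrable_scaleR[OF square_integrable_rep], of c f]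
  by (simp add: l2_of_scaleR)

lemma rep_diff: "AE x in torus. rep_L2 (f - g) x = rep_L2 f x - rep_L2 g x"
  using rep_add[of f "-1 *\<^sub>R g"] rep_scaleR[of "-1" g] by auto

lemma inner_l2_of:
  assumes "square_integrable f" "square_integrable g"
  shows "inner (l2_of f) (l2_of g) = (LINT x|torus. f x \<bullet> g x)"
  using assms by (simp add: l2_of_def inner_L2.abs_eq l2_eq_def)

lemma inner_rep: "inner f g = (LINT x|torus. rep_L2 f x \<bullet> rep_L2 g x)"
  using inner_l2_of[of "rep_L2 f" "rep_L2 g"] by simp

lemma norm_l2_of_squared:
  assumes "square_integrable f"
  shows "(norm (l2_of f))\<^sup>2 = (LINT x|torus. (norm (f x))\<^sup>2)"
  using inner_l2_of[OF assms assms] by (simp add: power2_norm_eq_inner)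

lemma norm_rep_squared: "(norm f)\<^sup>2 = (LINT x|torus. (norm (rep_L2 f x))\<^sup>2)"
  using norm_l2_of_squared[of "rep_L2 f"] by simp

lemma norm_l2_of_le:
  assumes "f \<in> borel_measurable torus" "\<And>x. norm (f x) \<le> C"
  shows "norm (l2_of f) \<le> sqrt (2*pi) * C"
proof -
  have C: "0 \<le> C" using assms(2)[of 0] norm_ge_zero order_trans by blast
  have sq: "square_integrable f" by (rule square_integrable_bounded[OF assms])
  have "(norm (l2_of f))\<^sup>2 \<le> (LINT x|torus. C\<^sup>2)"
    unfolding norm_l2_of_squared[OF sq]
    using sq assms(2) by (intro integral_mono power_mono) (auto simp: square_integrable_def)
  also have "\<dots> = (sqrt (2*pi) * C)\<^sup>2" by (simp add: measure_torus power_mult_distrib)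
  finally show ?thesis using C by (auto intro: power2_le_imp_le)
qed

lemma nn_norm_rep: "(\<integral>\<^sup>+x. ennreal ((norm (rep_L2 f x))\<^sup>2) \<partial>torus) = ennreal ((norm f)\<^sup>2)"
  unfolding norm_rep_squared
  by (rule nn_integral_eq_integral)
    (use square_integrable_rep[of f] in \<open>auto simp: square_integrable_def\<close>)

lemma measurable_rep [measurable]: "rep_L2 f \<in> borel_measurable torus"
  using square_integrable_rep[of f] by (simp add: square_integrable_def)

lemma nn_norm_rep_L1:
  "(\<integral>\<^sup>+x. ennreal (norm (rep_L2 f x)) \<partial>torus) \<le> ennreal (sqrt (2*pi) * norm f)"
proof -
  let ?g = "l2_of (\<lambda>x. norm (rep_L2 f x))"
  let ?o = "l2_of (\<lambda>x. 1::real)"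
  have sg: "square_integrable (\<lambda>x. norm (rep_L2 f x))"
    using square_integrable_rep[of f] unfolding square_integrable_def by auto
  have so: "square_integrable (\<lambda>x. 1::real)"
    by (rule square_integrable_bounded[where C=1]) auto
  have i: "integrable torus (\<lambda>x. norm (rep_L2 f x))"
    using square_integrable_inner[OF sg so] by simp
  have "(norm ?g)\<^sup>2 = (norm f)\<^sup>2"
    by (simp add: norm_l2_of_squared[OF sg] norm_rep_squared[of f])
  then have 1: "norm ?g = norm f" by simp
  have 2: "norm ?o \<le> sqrt (2*pi)" using norm_l2_of_le[of "\<lambda>x. 1::real" 1] by simp
  have "(LINT x|torus. norm (rep_L2 f x)) = inner ?g ?o"
    by (subst inner_l2_of[OF sg so]) simp
  also have "\<dots> \<le> norm ?g * norm ?o" by (rule norm_cauchy_schwarz)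
  also have "\<dots> \<le> sqrt (2*pi) * norm f"
    unfolding 1 using mult_left_mono[OF 2, of "norm f"] by (simp add: mult.commute)
  finally show ?thesis
    using i by (subst nn_integral_eq_integral) (auto intro!: ennreal_leI)
qed

text \<open>
  Riesz--Fischer: a rapidly convergent subsequence of representatives converges almost everywhere,
  and Fatou's lemma identifies its limit. Completeness is what makes the uniform boundedness principle
  and vector-valued integrals of orbits available below.
\<close>

instance L2 :: (euclidean_space) banach
proof
  fix X :: "nat \<Rightarrow> 'a L2"
  assume X: "Cauchy X"
  have "\<exists>r. strict_mono (r::nat\<Rightarrow>nat) \<and> (\<forall>n. \<forall>m\<ge>r n. \<forall>k\<ge>r n. norm (X m - X k) < (1/2)^n)"
  proof -
    have "\<exists>r. \<forall>n. (\<forall>m\<ge>r n. \<forall>k\<ge>r n. norm (X m - X k) < (1/2)^n) \<and> r n < (r (Suc n) :: nat)"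
    proof (rule dependent_nat_choice)
      show "\<exists>N. \<forall>m\<ge>N. \<forall>k\<ge>N. norm (X m - X k) < (1/2)^0"
        using CauchyD[OF X, of 1] by auto
      fix N n :: nat
      obtain M where M: "\<forall>m\<ge>M. \<forall>k\<ge>M. norm (X m - X k) < (1/2)^Suc n"
        using CauchyD[OF X, of "(1/2)^Suc n"] by auto
      show "\<exists>M. (\<forall>m\<ge>M. \<forall>k\<ge>M. norm (X m - X k) < (1/2)^Suc n) \<and> N < M"
        using M by (intro exI[of _ "max M (Suc N)"]) auto
    qed
    then show ?thesis by (auto simp: strict_mono_Suc_iff)
  qed
  then obtain r :: "nat \<Rightarrow> nat" where r: "strict_mono r"
    and rX: "\<And>n m k. m \<ge> r n \<Longrightarrow> k \<ge> r n \<Longrightarrow> norm (X m - X k) < (1/2)^n" by blast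
  define y where "y k = rep_L2 (X (r k))" for k
  have my [measurable]: "y k \<in> borel_measurable torus" for k by (simp add: y_def)
  have rmono: "r n \<le> r m" if "n \<le> m" for n m using r that by (simp add: strict_mono_less_eq)
  have dAE: "AE x in torus. rep_L2 (X (r m) - X (r k)) x = y m x - y k x" for m k
    unfolding y_def by (rule rep_diff)
  have d2: "(\<integral>\<^sup>+x. ennreal ((norm (y m x - y k x))\<^sup>2) \<partial>torus) \<le> ennreal (((1/2)^n)\<^sup>2)"
    if "n \<le> m" "n \<le> k" for m k n
  proof -
    have "(\<integral>\<^sup>+x. ennreal ((norm (y m x - y k x))\<^sup>2) \<partial>torus)
        = (\<integral>\<^sup>+x. ennreal ((norm (rep_L2 (X (r m) - X (r k)) x))\<^sup>2) \<partial>torus)"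
      using dAE[of m k] by (intro nn_integral_cong_AE) auto
    also have "\<dots> \<le> ennreal (((1/2)^n)\<^sup>2)"
      unfolding nn_norm_rep using rX[of n "r m" "r k"] rmono that
      by (intro ennreal_leI power_mono) (auto intro: less_imp_le)
    finally show ?thesis .
  qed
  \<comment> \<open>The circle has finite measure, so the increments are also summable in the mean, hence almost everywhere.\<close>
  have d1: "(\<integral>\<^sup>+x. ennreal (norm (y (Suc n) x - y n x)) \<partial>torus) \<le> ennreal (sqrt (2*pi) * (1/2)^n)"
    for n
  proof -
    have "(\<integral>\<^sup>+x. ennreal (norm (y (Suc n) x - y n x)) \<partial>torus)
        = (\<integral>\<^sup>+x. ennreal (norm (rep_L2 (X (r (Suc n)) - X (r n)) x)) \<partial>torus)"
      using dAE[of "Suc n" n] by (intro nn_integral_cong_AE) auto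
    also have "\<dots> \<le> ennreal (sqrt (2*pi) * norm (X (r (Suc n)) - X (r n)))"
      by (rule nn_norm_rep_L1)
    also have "\<dots> \<le> ennreal (sqrt (2*pi) * (1/2)^n)"
      using rX[of n "r (Suc n)" "r n"] rmono[of n "Suc n"]
      by (intro ennreal_leI mult_left_mono) auto
    finally show ?thesis .
  qed
  have "(\<integral>\<^sup>+x. (\<Sum>n. ennreal (norm (y (Suc n) x - y n x))) \<partial>torus)
      = (\<Sum>n. \<integral>\<^sup>+x. ennreal (norm (y (Suc n) x - y n x)) \<partial>torus)"
    by (rule nn_integral_suminf) auto
  also have "\<dots> \<le> (\<Sum>n. ennreal (sqrt (2*pi) * (1/2)^n))"
    by (intro suminf_le d1) auto
  also have "\<dots> = ennreal (\<Sum>n. sqrt (2*pi) * (1/2)^n)"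
    by (rule suminf_ennreal2) (auto intro!: summable_mult summable_geometric)
  also have "\<dots> < \<infinity>" by simp
  finally have "AE x in torus. (\<Sum>n. ennreal (norm (y (Suc n) x - y n x))) \<noteq> \<infinity>"
    by (intro nn_integral_PInf_AE) auto
  then have conv: "AE x in torus. (\<lambda>n. y n x) \<longlonglongrightarrow> lim (\<lambda>n. y n x)"
  proof eventually_elim
    case (elim x)
    have "summable (\<lambda>n. norm (y (Suc n) x - y n x))"
      by (rule summable_suminf_not_top) (use elim in auto)
    then have "summable (\<lambda>n. y (Suc n) x - y n x)" by (rule summable_norm_cancel)
    then have "convergent (\<lambda>n. y n x - y 0 x)"
      unfolding summable_iff_convergent by (subst (asm) sum_lessThan_telescope)
    from convergent_add[OF this convergent_const[of "y 0 x"]] have "convergent (\<lambda>n. y n x)" by simp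
    then show ?case by (simp add: convergent_LIMSEQ_iff)
  qed
  define g where "g x = lim (\<lambda>n. y n x)" for x
  have mg [measurable]: "g \<in> borel_measurable torus"
    unfolding g_def by (rule borel_measurable_lim_metric) auto
  \<comment> \<open>Fatou's lemma turns the Cauchy estimate into an estimate for the pointwise limit.\<close>
  have gd: "(\<integral>\<^sup>+x. ennreal ((norm (g x - y k x))\<^sup>2) \<partial>torus) \<le> ennreal (((1/2)^k)\<^sup>2)" for k
  proof -
    have "(\<integral>\<^sup>+x. ennreal ((norm (g x - y k x))\<^sup>2) \<partial>torus)
       = (\<integral>\<^sup>+x. liminf (\<lambda>m. ennreal ((norm (y m x - y k x))\<^sup>2)) \<partial>torus)"
      using conv
    proof (intro nn_integral_cong_AE, eventually_elim)
      case (elim x)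
      then have "(\<lambda>m. ennreal ((norm (y m x - y k x))\<^sup>2)) \<longlonglongrightarrow> ennreal ((norm (g x - y k x))\<^sup>2)"
        unfolding g_def by (intro tendsto_intros)
      then show ?case by (metis lim_imp_Liminf trivial_limit_sequentially)
    qed
    also have "\<dots> \<le> liminf (\<lambda>m. \<integral>\<^sup>+x. ennreal ((norm (y m x - y k x))\<^sup>2) \<partial>torus)"
      by (rule nn_integral_liminf) auto
    also have "\<dots> \<le> liminf (\<lambda>m::nat. ennreal (((1/2)^k)\<^sup>2))"
      by (rule Liminf_mono) (use d2 in \<open>auto intro!: eventually_sequentiallyI[of k]\<close>)
    also have "\<dots> = ennreal (((1/2)^k)\<^sup>2)" by (simp add: Liminf_const)
    finally show ?thesis .
  qed
  have sgd: "square_integrable (\<lambda>x. g x - y k x)" for k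
    unfolding square_integrable_def
  proof (intro conjI integrableI_bounded)
    have "(\<integral>\<^sup>+x. ennreal (norm ((norm (g x - y k x))\<^sup>2)) \<partial>torus) \<le> ennreal (((1/2)^k)\<^sup>2)"
      using gd[of k] by simp
    also have "\<dots> < \<infinity>" by simp
    finally show "(\<integral>\<^sup>+x. ennreal (norm ((norm (g x - y k x))\<^sup>2)) \<partial>torus) < \<infinity>" .
  qed auto
  have sg: "square_integrable g"
    using square_integrable_add[OF sgd[of 0] square_integrable_rep[of "X (r 0)"]] by (simp add: y_def)
  have near: "norm (l2_of g - X (r k)) \<le> (1/2)^k" for k
  proof -
    have "l2_of g = l2_of (\<lambda>x. g x - y k x) + X (r k)"
      using l2_of_add[OF sgd[of k] square_integrable_rep[of "X (r k)"]] by (simp add: y_def)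
    then have "ennreal ((norm (l2_of g - X (r k)))\<^sup>2) = (\<integral>\<^sup>+x. ennreal ((norm (g x - y k x))\<^sup>2) \<partial>torus)"
      using sgd[of k] by (subst nn_integral_eq_integral) (auto simp: norm_l2_of_squared square_integrable_def)
    also have "\<dots> \<le> ennreal (((1/2)^k)\<^sup>2)" by (rule gd)
    finally show ?thesis by (auto intro: power2_le_imp_le)
  qed
  have "X \<longlonglongrightarrow> l2_of g"
  proof (rule metric_LIMSEQ_I)
    fix e :: real assume "0 < e"
    then obtain k where k: "(1/2)^k < e/2" using real_arch_pow_inv[of "e/2" "1/2"] by auto
    show "\<exists>N. \<forall>n\<ge>N. dist (X n) (l2_of g) < e"
    proof (intro exI allI impI)
      fix n assume "n \<ge> r k"
      then have "norm (X n - X (r k)) < (1/2)^k" using rX by auto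
      moreover have "norm (X (r k) - l2_of g) \<le> (1/2)^k" using near[of k] by (simp add: norm_minus_commute)
      moreover have "norm (X n - l2_of g) \<le> norm (X n - X (r k)) + norm (X (r k) - l2_of g)"
        using norm_triangle_ineq[of "X n - X (r k)" "X (r k) - l2_of g"] by simp
      ultimately show "dist (X n) (l2_of g) < e" unfolding dist_norm using k by linarith
    qed
  qed
  then show "convergent X" by (rule convergentI)
qed

section \<open>Strongly continuous semigroups\<close>

text \<open>
  The Banach--Steinhaus theorem for a sequence of operators, deduced from Baire's theorem: one of the
  closed sets on which the sequence is bounded by a given number contains a ball.
\<close>

lemma uniform_boundedness:
  fixes F :: "nat \<Rightarrow> 'a::banach \<Rightarrow> 'b::real_normed_vector"
  assumes lin: "\<And>n. bounded_linear (F n)"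
    and ptw: "\<And>x. \<exists>M. \<forall>n. norm (F n x) \<le> M"
  shows "\<exists>M. \<forall>n x. norm (F n x) \<le> M * norm x"
proof -
  define E where "E M = {x. \<forall>n. norm (F n x) \<le> real M}" for M :: nat
  have clE: "closed (E M)" for M
  proof -
    have "E M = (\<Inter>n. {x. norm (F n x) \<le> real M})" by (auto simp: E_def)
    moreover have "closed {x. norm (F n x) \<le> real M}" for n
      by (rule closed_Collect_le[OF continuous_on_norm continuous_on_const])
        (rule bounded_linear.continuous_on[OF lin continuous_on_id])
    ultimately show ?thesis by auto
  qed
  have cov: "\<Union>(range E) = UNIV"
  proof -
    have "\<exists>M. x \<in> E M" for x
    proof -
      obtain C where "\<forall>n. norm (F n x) \<le> C" using ptw by blast
      moreover obtain M :: nat where "C \<le> real M" using real_arch_simple[of C] by blast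
      ultimately have "x \<in> E M" unfolding E_def by (auto intro: order_trans)
      then show ?thesis by blast
    qed
    then show ?thesis by auto
  qed
  \<comment> \<open>Baire: countably many closed sets with empty interior cannot cover a complete space.\<close>
  have "\<exists>M. interior (E M) \<noteq> {}"
  proof (rule ccontr)
    assume "\<not> (\<exists>M. interior (E M) \<noteq> {})"
    then have "Met_TC.mtopology interior_of \<Union>(range E) = {}"
      using clE
      by (intro Met_TC.metric_Baire_category_alt) (auto simp: complete_UNIV)
    then show False using cov by simp
  qed
  then obtain M x0 where "x0 \<in> interior (E M)" by blast
  then obtain e where e: "e > 0" "cball x0 e \<subseteq> E M"
    by (auto simp: mem_interior_cball)
  have "norm (F n x) \<le> (2 * real M / e) * norm x" for n x
  proof (cases "x = 0")
    case True
    then show ?thesis using bounded_linear.linear[OF lin[of n]] by (simp add: linear_0)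
  next
    case False
    interpret F: bounded_linear "F n" by (rule lin)
    define y where "y = (e / norm x) *\<^sub>R x"
    have ny: "norm y = e" using False e by (simp add: y_def)
    have "x0 + y \<in> E M" "x0 \<in> E M" using e ny by (auto simp: dist_norm subset_iff)
    then have "norm (F n (x0 + y)) \<le> M" "norm (F n x0) \<le> M" by (auto simp: E_def)
    moreover have "F n y = F n (x0 + y) - F n x0" by (simp add: F.add)
    ultimately have "norm (F n y) \<le> 2 * real M"
      using norm_triangle_ineq4[of "F n (x0 + y)" "F n x0"] by simp
    moreover have "norm (F n y) = e / norm x * norm (F n x)"
      using e by (simp add: y_def F.scaleR)
    ultimately show ?thesis using False e by (simp add: field_simps)
  qed
  then show ?thesis by blast
qed

lemma C0_semigroupD:
  assumes "C0_semigroup S"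
  shows "t \<ge> 0 \<Longrightarrow> bounded_linear (S t)" "S 0 = id"
    "s \<ge> 0 \<Longrightarrow> t \<ge> 0 \<Longrightarrow> S (s + t) f = S s (S t f)"
    "((\<lambda>t. S t f) \<longlongrightarrow> f) (at_right 0)"
  using assms by (auto simp: C0_semigroup_def)

text \<open>
  If the norms were unbounded near time 0, there would be a sequence of times tending to 0 along which
  every orbit converges while the operator norms tend to infinity, against uniform boundedness. The
  semigroup law propagates the bound.
\<close>

lemma C0_semigroup_locally_bounded:
  fixes S :: "real \<Rightarrow> 'x::banach \<Rightarrow> 'x"
  assumes S: "C0_semigroup S"
  shows "\<exists>C\<ge>1. \<forall>t\<in>{0..T}. \<forall>x. norm (S t x) \<le> C * norm x"
proof -
  note SD = C0_semigroupD[OF S]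
  have "\<exists>\<delta>>0. \<exists>C. \<forall>t\<in>{0..\<delta>}. \<forall>x. norm (S t x) \<le> C * norm x"
  proof (rule ccontr)
    assume neg: "\<not> ?thesis"
    have "\<exists>t x. t \<in> {0..1 / real (Suc n)} \<and> norm (S t x) > real n * norm x" for n
    proof -
      have "1 / real (Suc n) > 0" by simp
      then have "\<not> (\<forall>t\<in>{0..1 / real (Suc n)}. \<forall>x. norm (S t x) \<le> real n * norm x)"
        using neg by blast
      then show ?thesis by (auto simp: not_le)
    qed
    then obtain t x where tx: "\<And>n. t n \<in> {0..1 / real (Suc n)}"
      "\<And>n. norm (S (t n) (x n)) > real n * norm (x n)" by metis
    have t0: "t \<longlonglongrightarrow> 0"
      by (rule tendsto_sandwich[of "\<lambda>_. 0" _ _ "\<lambda>n. 1 / real (Suc n)"])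
        (use tx(1) LIMSEQ_inverse_real_of_nat in \<open>auto simp: inverse_eq_divide\<close>)
    have "\<exists>M. \<forall>n. norm (S (t n) y) \<le> M" for y
    proof -
      have "((\<lambda>t. S t y) \<longlongrightarrow> y) (at 0 within {0..})"
      proof -
        have eq: "at 0 within {0..} = at_right (0::real)"
          by (rule at_within_Ici_at_right)
        show ?thesis unfolding eq by (rule SD(4))
      qed
      then have "((\<lambda>t. S t y) \<longlongrightarrow> S 0 y) (at 0 within {0..})" by (simp add: SD(2))
      then have c: "continuous (at 0 within {0..}) (\<lambda>t. S t y)" by (simp add: continuous_within)
      have "(\<lambda>n. S (t n) y) \<longlonglongrightarrow> S 0 y"
        using c[unfolded continuous_within_sequentially] tx(1) t0 by (auto simp: o_def)
      then have "Bseq (\<lambda>n. S (t n) y)" by (intro convergent_imp_Bseq convergentI)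
      then show ?thesis by (auto simp: Bseq_def)
    qed
    then have "\<exists>M. \<forall>n x. norm (S (t n) x) \<le> M * norm x"
      using SD(1) tx(1) by (intro uniform_boundedness) auto
    then obtain M where M: "\<And>n x. norm (S (t n) x) \<le> M * norm x" by blast
    obtain n where "real n \<ge> M" using real_arch_simple by blast
    then have "M * norm (x n) \<le> real n * norm (x n)" by (intro mult_right_mono) auto
    then show False using tx(2)[of n] M[of n "x n"] by linarith
  qed
  then obtain \<delta> C0 where \<delta>: "\<delta> > 0" and C0: "\<And>t x. t \<in> {0..\<delta>} \<Longrightarrow> norm (S t x) \<le> C0 * norm x"
    by blast
  define C where "C = max 1 C0"
  have C: "C \<ge> 1" "\<And>t x. t \<in> {0..\<delta>} \<Longrightarrow> norm (S t x) \<le> C * norm x"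
    using C0 by (auto simp: C_def intro: order_trans[OF C0 mult_right_mono])
  have pw: "norm (S t x) \<le> C ^ Suc n * norm x" if "t \<in> {0..real (Suc n) * \<delta>}" for n t x
    using that
  proof (induction n arbitrary: t x)
    case 0
    then show ?case using C(2) by auto
  next
    case (Suc n)
    show ?case
    proof (cases "t \<le> \<delta>")
      case True
      have "norm (S t x) \<le> C ^ 1 * norm x" using C(2)[of t x] True Suc.prems by auto
      also have "\<dots> \<le> C ^ Suc (Suc n) * norm x"
        using C(1) by (intro mult_right_mono power_increasing) auto
      finally show ?thesis .
    next
      case False
      then have t: "t - \<delta> \<in> {0..real (Suc n) * \<delta>}"
        using Suc.prems by (auto simp: algebra_simps)
      have "S t x = S \<delta> (S (t - \<delta>) x)" using SD(3)[of \<delta> "t - \<delta>" x] \<delta> t by auto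
      then have "norm (S t x) \<le> C * norm (S (t - \<delta>) x)" using C(2)[of \<delta>] \<delta> by simp
      also have "\<dots> \<le> C * (C ^ Suc n * norm x)" using Suc.IH[OF t] C(1) by (intro mult_left_mono) auto
      finally show ?thesis by (simp add: mult_ac)
    qed
  qed
  obtain n where n: "T / \<delta> \<le> real n" using real_arch_simple by blast
  have "T \<le> real (Suc n) * \<delta>" using n \<delta> by (simp add: field_simps)
  then show ?thesis using pw[of _ n] C(1) by (intro exI[of _ "C ^ Suc n"]) (auto intro!: one_le_power simp del: power_Suc)
qed

lemma C0_semigroup_diff:
  assumes S: "C0_semigroup S" and "0 \<le> s" "s \<le> t"
  shows "S t h - S s h = S s (S (t - s) h - h)"
proof -
  have "S t h = S s (S (t - s) h)" using C0_semigroupD(3)[OF S, of s "t - s"] assms by simp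
  then show ?thesis
    using C0_semigroupD(1)[OF S \<open>0 \<le> s\<close>] by (simp add: bounded_linear.linear linear_diff)
qed

text \<open>
  Strong continuity is only assumed from the right at time 0; continuity from the left needs the
  local bound, as the increment over a short time is transported by an earlier operator.
\<close>

lemma C0_semigroup_continuous:
  fixes S :: "real \<Rightarrow> 'x::banach \<Rightarrow> 'x"
  assumes S: "C0_semigroup S"
  shows "continuous_on {0..T} (\<lambda>t. S t h)"
proof -
  obtain C where C: "C \<ge> 1" "\<And>t x. t \<in> {0..T} \<Longrightarrow> norm (S t x) \<le> C * norm x"
    using C0_semigroup_locally_bounded[OF S] by blast
  have "uniformly_continuous_on {0..T} (\<lambda>t. S t h)"
    unfolding uniformly_continuous_on_def
  proof (intro allI impI)
    fix e :: real assume "e > 0"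
    then have "e / C > 0" using C by simp
    then have "eventually (\<lambda>t. dist (S t h) h < e / C) (at_right 0)"
      using C0_semigroupD(4)[OF S, of h] by (auto simp: tendsto_iff)
    then obtain d where d: "d > 0" "\<And>t. 0 < t \<Longrightarrow> t < d \<Longrightarrow> norm (S t h - h) < e / C"
      by (auto simp: eventually_at_right_field dist_norm)
    have main: "norm (S t h - S s h) < e" if "s \<in> {0..T}" "t \<in> {0..T}" "s \<le> t" "t - s < d" for s t
    proof (cases "s = t")
      case True then show ?thesis using \<open>e > 0\<close> by simp
    next
      case False
      have "norm (S t h - S s h) \<le> C * norm (S (t - s) h - h)"
        using C0_semigroup_diff[OF S, of s t h] C(2) that by auto
      also have "\<dots> < C * (e / C)" using d(2)[of "t - s"] that False C by (intro mult_strict_left_mono) auto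
      also have "\<dots> = e" using C by simp
      finally show ?thesis .
    qed
    show "\<exists>d>0. \<forall>x\<in>{0..T}. \<forall>x'\<in>{0..T}. dist x' x < d \<longrightarrow> dist (S x' h) (S x h) < e"
    proof (intro exI[of _ d] conjI ballI impI d(1))
      fix x x' assume xx: "x \<in> {0..T}" "x' \<in> {0..T}" "dist x' x < d"
      show "dist (S x' h) (S x h) < e"
        using main[of x x'] main[of x' x] xx
        by (cases "x \<le> x'") (auto simp: dist_norm norm_minus_commute)
    qed
  qed
  then show ?thesis by (rule uniformly_continuous_imp_continuous)
qed

text \<open>
  The generator is defined by a one-sided limit at time 0. The semigroup law and the local bound make
  the limit uniform along the orbit, which gives two-sided derivatives.
\<close>

lemma C0_semigroup_orbit_derivative:
  fixes S :: "real \<Rightarrow> 'x::banach \<Rightarrow> 'x"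
  assumes S: "C0_semigroup S" and hk: "(h, k) \<in> generator_graph S" and t: "t \<in> {0..T}"
  shows "((\<lambda>t. S t h) has_vector_derivative S t k) (at t within {0..T})"
proof -
  obtain C where C: "C \<ge> 1" "\<And>t x. t \<in> {0..T} \<Longrightarrow> norm (S t x) \<le> C * norm x"
    using C0_semigroup_locally_bounded[OF S] by blast
  have lin: "linear (S s)" if "s \<in> {0..T}" for s
    using C0_semigroupD(1)[OF S, of s] that by (auto intro: bounded_linear.linear)
  show ?thesis
    unfolding has_vector_derivative_def has_derivative_within_alt
  proof (intro conjI allI impI bounded_linear_scaleR_left)
    have nt: "norm (- x - y) \<le> a + b" if "norm x \<le> a" "norm y \<le> b" for x y :: 'x and a b
      using norm_triangle_ineq4[of "- x" y] that by simp
    fix e :: real assume e: "e > 0"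
    have "eventually (\<lambda>r. dist ((S r h - h) /\<^sub>R r) k < e / (2 * C)) (at_right 0)"
      using hk e C(1) by (auto simp: generator_graph_def tendsto_iff)
    then obtain d where d: "d > 0"
      "\<And>r. 0 < r \<Longrightarrow> r < d \<Longrightarrow> norm ((S r h - h) /\<^sub>R r - k) < e / (2 * C)"
      by (auto simp: eventually_at_right_field dist_norm)
    have d': "norm (S r h - h - r *\<^sub>R k) \<le> e / (2 * C) * r" if "0 \<le> r" "r < d" for r
    proof (cases "r = 0")
      case True then show ?thesis by (simp add: C0_semigroupD(2)[OF S])
    next
      case False
      have "S r h - h - r *\<^sub>R k = r *\<^sub>R ((S r h - h) /\<^sub>R r - k)"
        using False by (simp add: scaleR_diff_right)
      then have "norm (S r h - h - r *\<^sub>R k) = r * norm ((S r h - h) /\<^sub>R r - k)"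
        using that by simp
      also have "\<dots> \<le> r * (e / (2 * C))" using d(2)[of r] that False by (intro mult_left_mono) auto
      finally show ?thesis by (simp add: mult.commute)
    qed
    have up: "norm (S b h - S a h - (b - a) *\<^sub>R S a k) \<le> e / 2 * (b - a)"
      if "a \<in> {0..T}" "b \<in> {0..T}" "a \<le> b" "b - a < d" for a b
    proof -
      have "S b h - S a h - (b - a) *\<^sub>R S a k = S a (S (b - a) h - h - (b - a) *\<^sub>R k)"
        using C0_semigroup_diff[OF S, of a b h] lin[OF that(1)] that by (simp add: linear_diff linear_scale)
      then have "norm (S b h - S a h - (b - a) *\<^sub>R S a k) \<le> C * norm (S (b - a) h - h - (b - a) *\<^sub>R k)"
        using C(2) that by simp
      also have "\<dots> \<le> C * (e / (2 * C) * (b - a))" using d'[of "b - a"] that C by (intro mult_left_mono) auto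
      also have "\<dots> = e / 2 * (b - a)" using C by simp
      finally show ?thesis .
    qed
    obtain d2 where d2: "d2 > 0" "\<And>s. s \<in> {0..T} \<Longrightarrow> dist s t < d2 \<Longrightarrow> dist (S s k) (S t k) < e / 2"
      using C0_semigroup_continuous[OF S, of T k] t e unfolding continuous_on_iff
      by (metis half_gt_zero)
    show "\<exists>d>0. \<forall>y\<in>{0..T}. norm (y - t) < d \<longrightarrow>
        norm (S y h - S t h - (y - t) *\<^sub>R S t k) \<le> e * norm (y - t)"
    proof (intro exI[of _ "min d d2"] conjI ballI impI)
      fix y assume y: "y \<in> {0..T}" "norm (y - t) < min d d2"
      show "norm (S y h - S t h - (y - t) *\<^sub>R S t k) \<le> e * norm (y - t)"
      proof (cases "t \<le> y")
        case True
        have "norm (S y h - S t h - (y - t) *\<^sub>R S t k) \<le> e / 2 * (y - t)"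
          using up[of t y] t y True by auto
        also have "\<dots> \<le> e * norm (y - t)" using True e by simp
        finally show ?thesis .
      next
        case False
        have 1: "norm (S t h - S y h - (t - y) *\<^sub>R S y k) \<le> e / 2 * (t - y)"
          using up[of y t] t y False by auto
        have "norm (S y k - S t k) < e / 2" using d2(2)[of y] y by (auto simp: dist_norm)
        then have 2: "norm ((t - y) *\<^sub>R (S y k - S t k)) \<le> e / 2 * (t - y)"
          using False by (simp add: mult.commute mult_left_mono)
        \<comment> \<open>Seen from the left, the increment starts at the moving time \<open>y\<close>; continuity of the orbit of \<open>k\<close> repairs this.\<close>
        have "S y h - S t h - (y - t) *\<^sub>R S t k
            = - (S t h - S y h - (t - y) *\<^sub>R S y k) - (t - y) *\<^sub>R (S y k - S t k)"
          by (simp add: algebra_simps)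
        also have "norm \<dots> \<le> e / 2 * (t - y) + e / 2 * (t - y)"
          using nt[OF 1 2] .
        also have "\<dots> = e * norm (y - t)" using False by simp
        finally show ?thesis .
      qed
    qed (use d d2 in auto)
  qed
qed

text \<open>
  Averages of an orbit over short time intervals belong to the domain of the generator and
  approximate the starting point.
\<close>

lemma C0_semigroup_domain_dense:
  fixes S :: "real \<Rightarrow> 'x::banach \<Rightarrow> 'x"
  assumes S: "C0_semigroup S" and e: "e > 0"
  obtains h' k where "(h', k) \<in> generator_graph S" "norm (h' - h) < e"
proof -
  define J where "J u = integral {0..u} (\<lambda>s. S s h)" for u
  have cont: "continuous_on {a..b} (\<lambda>s. S s h)" if "0 \<le> a" for a b
    by (rule continuous_on_subset[OF C0_semigroup_continuous[OF S, of b]]) (use that in auto)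
  have int: "(\<lambda>s. S s h) integrable_on {a..b}" if "0 \<le> a" for a b
    by (rule integrable_continuous_real[OF cont[OF that]])
  have dJ: "(J has_vector_derivative S u h) (at u within {0..T})" if "u \<in> {0..T}" for u T
    unfolding J_def by (rule integral_has_vector_derivative[OF cont that]) simp
  have lim: "((\<lambda>r. (J (u + r) - J u) /\<^sub>R r) \<longlongrightarrow> S u h) (at_right 0)" if u: "u \<ge> 0" for u
  proof (rule tendstoI)
    fix e :: real assume e: "e > 0"
    have "(J has_vector_derivative S u h) (at u within {0..u+1})" using dJ u by auto
    then obtain d where d: "d > 0" "\<And>y. y \<in> {0..u+1} \<Longrightarrow> norm (y - u) < d \<Longrightarrow>
        norm (J y - J u - (y - u) *\<^sub>R S u h) \<le> e / 2 * norm (y - u)"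
      unfolding has_vector_derivative_def has_derivative_within_alt using e by (meson half_gt_zero)
    show "eventually (\<lambda>r. dist ((J (u + r) - J u) /\<^sub>R r) (S u h) < e) (at_right 0)"
      unfolding eventually_at_right_field
    proof (intro exI[of _ "min d 1"] conjI allI impI)
      fix r :: real assume r: "r > 0" "r < min d 1"
      have "norm (J (u + r) - J u - r *\<^sub>R S u h) \<le> e / 2 * r" using d(2)[of "u + r"] r u by auto
      moreover have "(J (u + r) - J u) /\<^sub>R r - S u h = (J (u + r) - J u - r *\<^sub>R S u h) /\<^sub>R r"
        using r by (simp add: scaleR_diff_right)
      ultimately have "norm ((J (u + r) - J u) /\<^sub>R r - S u h) \<le> inverse r * (e / 2 * r)"
        using r by (simp only: norm_scaleR) (intro mult_mono, auto)
      also have "\<dots> = e / 2" using r by simp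
      finally have "norm ((J (u + r) - J u) /\<^sub>R r - S u h) \<le> e / 2" .
      then show "dist ((J (u + r) - J u) /\<^sub>R r) (S u h) < e" using e by (simp add: dist_norm)
    qed (use d in auto)
  qed
  have J0: "J 0 = 0" by (simp add: J_def)
  have "((\<lambda>r. J r /\<^sub>R r) \<longlongrightarrow> h) (at_right 0)"
    using lim[of 0] by (simp add: J0 C0_semigroupD(2)[OF S])
  then have "eventually (\<lambda>r. dist (J r /\<^sub>R r) h < e) (at_right 0)" using e by (auto simp: tendsto_iff)
  then obtain b where b: "b > 0" "\<And>r. 0 < r \<Longrightarrow> r < b \<Longrightarrow> norm (J r /\<^sub>R r - h) < e"
    by (auto simp: eventually_at_right_field dist_norm)
  define \<tau> where "\<tau> = b / 2"
  have "0 < \<tau>" "\<tau> < b" using b(1) by (auto simp: \<tau>_def)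
  then have \<tau>: "\<tau> > 0" "norm (J \<tau> /\<^sub>R \<tau> - h) < e" using b(2) by auto
  have SJ: "S r (J \<tau>) = J (\<tau> + r) - J r" if "r \<ge> 0" for r
  proof -
    have "S r (J \<tau>) = integral {0..\<tau>} (S r \<circ> (\<lambda>s. S s h))"
      unfolding J_def by (rule integral_linear[symmetric, OF int C0_semigroupD(1)[OF S that]]) simp
    also have "\<dots> = integral {0..\<tau>} ((\<lambda>s. S s h) \<circ> (+) r)"
      by (intro integral_cong) (use that in \<open>auto simp: C0_semigroupD(3)[OF S]\<close>)
    also have "\<dots> = integral {r..\<tau> + r} (\<lambda>s. S s h)"
      using integral_shift_Icc_real[of 0 \<tau> "\<lambda>s. S s h" r] by simp
    finally have "J r + S r (J \<tau>) = J (\<tau> + r)"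
      unfolding J_def
      using Henstock_Kurzweil_Integration.integral_combine[of 0 r "\<tau> + r" "\<lambda>s. S s h"] that \<tau> int[of 0 "\<tau> + r"] by simp
    then show ?thesis by (simp add: algebra_simps)
  qed
  have "((\<lambda>r. (J (\<tau> + r) - J \<tau>) /\<^sub>R r - (J (0 + r) - J 0) /\<^sub>R r) \<longlongrightarrow> S \<tau> h - S 0 h) (at_right 0)"
    using \<tau> by (intro tendsto_diff lim) auto
  then have "((\<lambda>r. (S r (J \<tau>) - J \<tau>) /\<^sub>R r) \<longlongrightarrow> S \<tau> h - S 0 h) (at_right 0)"
  proof (rule Lim_transform_eventually)
    show "eventually (\<lambda>r. (J (\<tau> + r) - J \<tau>) /\<^sub>R r - (J (0 + r) - J 0) /\<^sub>R r
        = (S r (J \<tau>) - J \<tau>) /\<^sub>R r) (at_right 0)"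
      unfolding eventually_at_right_field
      by (rule exI[of _ 1]) (auto simp: SJ J0 scaleR_diff_right algebra_simps)
  qed
  then have lim2: "((\<lambda>r. ((S r (J \<tau>) - J \<tau>) /\<^sub>R r) /\<^sub>R \<tau>) \<longlongrightarrow> (S \<tau> h - S 0 h) /\<^sub>R \<tau>) (at_right 0)"
    by (intro tendsto_intros)
  have "(J \<tau> /\<^sub>R \<tau>, (S \<tau> h - S 0 h) /\<^sub>R \<tau>) \<in> generator_graph S"
    unfolding generator_graph_def mem_Collect_eq case_prod_conv
  proof (rule Lim_transform_eventually[OF lim2])
    show "eventually (\<lambda>r. ((S r (J \<tau>) - J \<tau>) /\<^sub>R r) /\<^sub>R \<tau>
        = (S r (J \<tau> /\<^sub>R \<tau>) - J \<tau> /\<^sub>R \<tau>) /\<^sub>R r) (at_right 0)"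
      unfolding eventually_at_right_field
    proof (intro exI[of _ 1] conjI allI impI)
      fix r :: real assume r: "r > 0" "r < 1"
      have "S r (J \<tau> /\<^sub>R \<tau>) = S r (J \<tau>) /\<^sub>R \<tau>"
        using C0_semigroupD(1)[OF S, of r] r by (simp add: bounded_linear.linear linear_scale)
      then show "((S r (J \<tau>) - J \<tau>) /\<^sub>R r) /\<^sub>R \<tau> = (S r (J \<tau> /\<^sub>R \<tau>) - J \<tau> /\<^sub>R \<tau>) /\<^sub>R r"
        by (simp add: scaleR_diff_right mult.commute)
    qed auto
  qed
  then show ?thesis using \<tau>(2) that by blast
qed

text \<open>
  Along \<open>\<phi>\<close>, which solves \<open>\<phi>' = - \<Lambda>\<close> up to an error \<open>\<epsilon>\<close>, where \<open>\<Lambda>\<close> is the adjoint of the generator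
  applied to \<open>\<phi>\<close>, the scalar product with any orbit is almost conserved: its derivative is the scalar
  product of the orbit with the residual. This estimate replaces a comparison of \<open>\<phi>\<close> with an exact solution
  of the adjoint equation.
\<close>

lemma approximate_adjoint_solution:
  fixes S :: "real \<Rightarrow> 'x::{banach,real_inner} \<Rightarrow> 'x"
  assumes S: "C0_semigroup S"
    and C: "\<And>t x. t \<in> {0..T} \<Longrightarrow> norm (S t x) \<le> C * norm x"
    and \<phi>: "\<And>s. s \<in> {0..T} \<Longrightarrow> (\<phi> has_vector_derivative \<phi>' s) (at s within {0..T})"
    and adj: "\<And>h k s. (h, k) \<in> generator_graph S \<Longrightarrow> s \<in> {0..T} \<Longrightarrow> inner k (\<phi> s) = inner h (\<Lambda> s)"
    and res: "\<And>s. s \<in> {0..T} \<Longrightarrow> norm (\<phi>' s + \<Lambda> s) \<le> \<epsilon>"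
    and r: "r \<in> {0..T}"
  shows "\<bar>inner (S (T - r) h) (\<phi> T) - inner h (\<phi> r)\<bar> \<le> T * C * \<epsilon> * norm h"
proof -
  have T: "0 \<le> T" using r by auto
  have C0: "C * norm x \<ge> 0" for x :: 'x using C[of 0 x] T by (auto intro: order_trans[OF norm_ge_zero])
  have eps: "\<epsilon> \<ge> 0" using res[of 0] T by (auto intro: order_trans[OF norm_ge_zero])
  have dom: "\<bar>inner (S (T - r) h) (\<phi> T) - inner h (\<phi> r)\<bar> \<le> T * C * \<epsilon> * norm h"
    if hk: "(h, k) \<in> generator_graph S" for h k
  proof -
    define w where "w s = inner (S (s - r) h) (\<phi> s)" for s
    have memb: "(S s h, S s k) \<in> generator_graph S" if "s \<ge> 0" for s
    proof -
      have bl: "bounded_linear (S s)" by (rule C0_semigroupD(1)[OF S that])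
      have "((\<lambda>t. S s ((S t h - h) /\<^sub>R t)) \<longlongrightarrow> S s k) (at_right 0)"
        using hk by (intro bounded_linear.tendsto[OF bl]) (simp add: generator_graph_def)
      then show ?thesis
        unfolding generator_graph_def mem_Collect_eq case_prod_conv
      proof (rule Lim_transform_eventually)
        show "eventually (\<lambda>t. S s ((S t h - h) /\<^sub>R t) = (S t (S s h) - S s h) /\<^sub>R t) (at_right 0)"
          unfolding eventually_at_right_field
        proof (intro exI[of _ 1] conjI allI impI)
          fix t :: real assume t: "t > 0" "t < 1"
          have "S t (S s h) = S s (S t h)"
            using C0_semigroupD(3)[OF S, of s t h] C0_semigroupD(3)[OF S, of t s h] that t
            by (simp add: add.commute)
          then show "S s ((S t h - h) /\<^sub>R t) = (S t (S s h) - S s h) /\<^sub>R t"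
            using bl by (simp add: bounded_linear.linear linear_scale linear_diff)
        qed auto
      qed
    qed
    have dw: "(w has_vector_derivative inner (S (s - r) h) (\<phi>' s + \<Lambda> s)) (at s within {r..T})"
      if s: "s \<in> {r..T}" for s
    proof -
      have 1: "((\<lambda>s. S (s - r) h) has_vector_derivative S (s - r) k) (at s within {r..T})"
      proof -
        have "((\<lambda>s. S s h) has_vector_derivative S (s - r) k) (at (s - r) within {0..T})"
          using C0_semigroup_orbit_derivative[OF S hk, of "s - r" T] s r by auto
        then have "((\<lambda>s. S s h) has_vector_derivative S (s - r) k) (at (s - r) within (\<lambda>s. s - r) ` {r..T})"
          by (rule has_vector_derivative_within_subset) (use r in auto)
        moreover have "((\<lambda>s. s - r) has_vector_derivative 1) (at s within {r..T})"
          by (auto intro!: derivative_eq_intros)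
        ultimately show ?thesis
          using vector_diff_chain_within[of "\<lambda>s. s - r" 1 s "{r..T}" "\<lambda>s. S s h" "S (s - r) k"]
          by (simp add: o_def)
      qed
      have 2: "(\<phi> has_vector_derivative \<phi>' s) (at s within {r..T})"
        by (rule has_vector_derivative_within_subset[OF \<phi>]) (use s r in auto)
      have "(w has_vector_derivative (inner (S (s - r) h) (\<phi>' s) + inner (S (s - r) k) (\<phi> s))) (at s within {r..T})"
        unfolding w_def
        by (rule bounded_bilinear.has_vector_derivative[OF bounded_bilinear_inner 1 2])
      moreover have "inner (S (s - r) k) (\<phi> s) = inner (S (s - r) h) (\<Lambda> s)"
        using adj[OF memb[of "s - r"], of s] s r by auto
      ultimately show ?thesis by (simp add: inner_add_right)
    qed
    have "norm (w T - w r) \<le> C * norm h * \<epsilon> * norm (T - r)"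
    proof (rule differentiable_bound)
      show "convex {r..T}" by simp
      show "(w has_derivative (\<lambda>x. x *\<^sub>R inner (S (s - r) h) (\<phi>' s + \<Lambda> s))) (at s within {r..T})"
        if "s \<in> {r..T}" for s using dw[OF that] by (simp add: has_vector_derivative_def)
      show "onorm (\<lambda>x. x *\<^sub>R inner (S (s - r) h) (\<phi>' s + \<Lambda> s)) \<le> C * norm h * \<epsilon>"
        if s: "s \<in> {r..T}" for s
      proof (rule onorm_le)
        fix x :: real
        have "\<bar>inner (S (s - r) h) (\<phi>' s + \<Lambda> s)\<bar> \<le> norm (S (s - r) h) * norm (\<phi>' s + \<Lambda> s)"
          by (rule Cauchy_Schwarz_ineq2)
        also have "\<dots> \<le> (C * norm h) * \<epsilon>"
          using C[of "s - r" h] res[of s] s r C0 by (intro mult_mono) auto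
        finally have "\<bar>inner (S (s - r) h) (\<phi>' s + \<Lambda> s)\<bar> \<le> C * norm h * \<epsilon>" .
        from mult_left_mono[OF this, of "\<bar>x\<bar>"]
        show "norm (x *\<^sub>R inner (S (s - r) h) (\<phi>' s + \<Lambda> s)) \<le> C * norm h * \<epsilon> * norm x"
          by (simp add: abs_mult mult_ac)
      qed
    qed (use r in auto)
    also have "\<dots> \<le> C * norm h * \<epsilon> * T"
      using r C0[of h] eps by (intro mult_left_mono) auto
    finally show ?thesis by (simp add: w_def C0_semigroupD(2)[OF S] mult_ac)
  qed
  \<comment> \<open>Both sides are continuous in \<open>h\<close>, so it suffices to approximate \<open>h\<close> by elements of the domain.\<close>
  have "\<exists>hn kn. (hn, kn) \<in> generator_graph S \<and> norm (hn - h) < 1 / real (Suc n)" for n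
    by (rule C0_semigroup_domain_dense[OF S, of "1 / real (Suc n)" h]) auto
  then obtain hn kn where hn: "\<And>n. (hn n, kn n) \<in> generator_graph S" "\<And>n. norm (hn n - h) < 1 / real (Suc n)"
    by metis
  have conv: "hn \<longlonglongrightarrow> h"
  proof (rule LIM_zero_cancel, rule tendsto_norm_zero_cancel)
    show "(\<lambda>n. norm (hn n - h)) \<longlonglongrightarrow> 0"
      by (rule tendsto_sandwich[of "\<lambda>_. 0" _ _ "\<lambda>n. 1 / real (Suc n)"])
        (use hn(2) LIMSEQ_inverse_real_of_nat in \<open>auto simp: inverse_eq_divide less_imp_le\<close>)
  qed
  have bl: "bounded_linear (S (T - r))" using C0_semigroupD(1)[OF S] r by auto
  show ?thesis
  proof (rule tendsto_le[OF trivial_limit_sequentially])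
    show "(\<lambda>n. T * C * \<epsilon> * norm (hn n)) \<longlonglongrightarrow> T * C * \<epsilon> * norm h"
      by (intro tendsto_intros conv)
    show "(\<lambda>n. \<bar>inner (S (T - r) (hn n)) (\<phi> T) - inner (hn n) (\<phi> r)\<bar>)
        \<longlonglongrightarrow> \<bar>inner (S (T - r) h) (\<phi> T) - inner h (\<phi> r)\<bar>"
      by (intro tendsto_intros conv bounded_linear.tendsto[OF bl])
    show "\<forall>\<^sub>F n in sequentially. \<bar>inner (S (T - r) (hn n)) (\<phi> T) - inner (hn n) (\<phi> r)\<bar>
        \<le> T * C * \<epsilon> * norm (hn n)"
      by (intro always_eventually allI dom[OF hn(1)])
  qed
qed

section \<open>Pointwise linear maps and products with fixed vectors\<close>

lemma square_integrable_linear: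
  fixes h :: "'a::euclidean_space \<Rightarrow> 'b::euclidean_space"
  assumes h: "linear h" and f: "square_integrable f"
  shows "square_integrable (\<lambda>x. h (f x))"
proof -
  obtain B where B: "\<And>x. norm (h x) \<le> B * norm x" using linear_bounded[OF h] by blast
  have mh: "h \<in> borel_measurable borel"
    using linear_continuous_on[of h UNIV] h by (intro borel_measurable_continuous_onI) (simp add: linear_conv_bounded_linear)
  have m: "(\<lambda>x. h (f x)) \<in> borel_measurable torus"
    using f mh by (auto simp: square_integrable_def intro: measurable_compose)
  have "integrable torus (\<lambda>x. (norm (h (f x)))\<^sup>2)"
  proof (rule Bochner_Integration.integrable_bound)
    show "integrable torus (\<lambda>x. B\<^sup>2 * (norm (f x))\<^sup>2)" using f by (auto simp: square_integrable_def)
    have "(norm (h v))\<^sup>2 \<le> B\<^sup>2 * (norm v)\<^sup>2" for v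
      using power_mono[OF B[of v], of 2] by (simp add: power_mult_distrib)
    then show "AE x in torus. norm ((norm (h (f x)))\<^sup>2) \<le> norm (B\<^sup>2 * (norm (f x))\<^sup>2)" by simp
  qed (auto intro!: borel_measurable_power measurable_compose[OF m])
  then show ?thesis using m by (simp add: square_integrable_def)
qed

lemma l2_map_l2_of:
  fixes h :: "'a::euclidean_space \<Rightarrow> 'b::euclidean_space"
  assumes h: "linear h" and f: "square_integrable f"
  shows "l2_map h (l2_of f) = l2_of (\<lambda>x. h (f x))"
  unfolding l2_map_def
proof (subst l2_of_eq_iff)
  show "AE x in torus. h (rep_L2 (l2_of f) x) = h (f x)" using rep_l2_of[OF f] by auto
qed (rule square_integrable_linear[OF h] square_integrable_rep f)+

lemma rep_l2_map:
  fixes h :: "'a::euclidean_space \<Rightarrow> 'b::euclidean_space"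
  assumes "linear h"
  shows "AE x in torus. rep_L2 (l2_map h f) x = h (rep_L2 f x)"
  unfolding l2_map_def by (rule rep_l2_of square_integrable_linear[OF assms] square_integrable_rep)+

lemma l2_map_compose:
  fixes h :: "'a::euclidean_space \<Rightarrow> 'b::euclidean_space" and g :: "'c::euclidean_space \<Rightarrow> 'a"
  assumes "linear h" "linear g"
  shows "l2_map h (l2_map g f) = l2_map (\<lambda>v. h (g v)) f"
  unfolding l2_map_def[of g] l2_map_def[of "\<lambda>v. h (g v)"]
  by (rule l2_map_l2_of assms square_integrable_linear[OF assms(2)] square_integrable_rep)+

lemma l2_map_add_fun:
  fixes h g :: "'a::euclidean_space \<Rightarrow> 'b::euclidean_space"
  assumes "linear h" "linear g"
  shows "l2_map (\<lambda>v. h v + g v) f = l2_map h f + l2_map g f"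
  unfolding l2_map_def
  by (rule l2_of_add square_integrable_linear[OF assms(1)] square_integrable_linear[OF assms(2)]
      square_integrable_rep)+

lemma l2_map_id: "l2_map (\<lambda>v. v) f = f"
  by (simp add: l2_map_def)

text \<open>
  The pointwise product of a scalar function with a fixed vector. Weak derivatives and the adjoint of
  the generator are expressed by scalar products with such functions, where constant matrices act on the
  vector only.
\<close>

definition tens :: "real L2 \<Rightarrow> 'b::euclidean_space \<Rightarrow> 'b L2" where
  "tens p w = l2_map (\<lambda>r. r *\<^sub>R w) p"

lemma linear_scaleR_vector [simp]: "linear (\<lambda>r::real. r *\<^sub>R (w::'b::real_vector))"
  by (rule linearI) (auto simp: algebra_simps)

lemma tens_l2_of: "square_integrable p \<Longrightarrow> tens (l2_of p) w = l2_of (\<lambda>x. p x *\<^sub>R w)"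
  unfolding tens_def by (rule l2_map_l2_of) auto

lemma rep_tens: "AE x in torus. rep_L2 (tens p w) x = rep_L2 p x *\<^sub>R w"
  unfolding tens_def by (rule rep_l2_map) simp

lemma inner_tens_eq: "inner f (tens p w) = (LINT x|torus. (rep_L2 p x *\<^sub>R rep_L2 f x) \<bullet> w)"
  unfolding inner_rep
  using rep_tens[of p w] by (intro integral_cong_AE) (auto simp: inner_commute)

lemma inner_tens_tens: "inner (tens p v) (tens q w) = inner p q * (v \<bullet> w)"
proof -
  have "inner (tens p v) (tens q w) = (LINT x|torus. (rep_L2 p x \<bullet> rep_L2 q x) * (v \<bullet> w))"
    unfolding inner_tens_eq using rep_tens[of p v]
    by (intro integral_cong_AE) (auto simp: mult.commute)
  then show ?thesis by (simp add: inner_rep)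
qed

lemma norm_tens: "norm (tens p w) = norm p * norm w"
  unfolding norm_eq_sqrt_inner inner_tens_tens by (simp add: real_sqrt_mult)

lemma bounded_bilinear_tens: "bounded_bilinear (tens :: real L2 \<Rightarrow> 'b::euclidean_space \<Rightarrow> 'b L2)"
proof
  fix p q :: "real L2" and v w :: 'b and c :: real
  show "tens (p + q) w = tens p w + tens q w"
    by (rule l2_eqI_AE)
      (use rep_tens[of "p + q" w] rep_tens[of p w] rep_tens[of q w] rep_add[of p q]
        rep_add[of "tens p w" "tens q w"] in \<open>auto simp: algebra_simps\<close>)
  show "tens p (v + w) = tens p v + tens p w"
    by (rule l2_eqI_AE)
      (use rep_tens[of p "v + w"] rep_tens[of p v] rep_tens[of p w]
        rep_add[of "tens p v" "tens p w"] in \<open>auto simp: algebra_simps\<close>)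
  show "tens (c *\<^sub>R p) w = c *\<^sub>R tens p w"
    by (rule l2_eqI_AE)
      (use rep_tens[of "c *\<^sub>R p" w] rep_tens[of p w] rep_scaleR[of c p]
        rep_scaleR[of c "tens p w"] in \<open>auto simp: algebra_simps\<close>)
  show "tens p (c *\<^sub>R w) = c *\<^sub>R tens p w"
    by (rule l2_eqI_AE)
      (use rep_tens[of p "c *\<^sub>R w"] rep_tens[of p w] rep_scaleR[of c "tens p w"] in \<open>auto simp: algebra_simps\<close>)
  show "\<exists>K. \<forall>p (w::'b). norm (tens p w) \<le> norm p * norm w * K"
    by (rule exI[of _ 1]) (simp add: norm_tens)
qed

interpretation tens: bounded_bilinear "tens :: real L2 \<Rightarrow> 'b::euclidean_space \<Rightarrow> 'b L2"
  by (rule bounded_bilinear_tens)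

lemma inner_l2_map_tens:
  fixes h :: "'a::euclidean_space \<Rightarrow> 'b::euclidean_space"
  assumes h: "linear h"
  shows "inner (l2_map h f) (tens p w) = inner f (tens p (adjoint h w))"
proof -
  have "AE x in torus. (rep_L2 p x *\<^sub>R rep_L2 (l2_map h f) x) \<bullet> w
      = (rep_L2 p x *\<^sub>R rep_L2 f x) \<bullet> adjoint h w"
    using rep_l2_map[OF h, of f]
    by eventually_elim (simp add: adjoint_works[OF h] linear_scale[OF h])
  then show ?thesis unfolding inner_tens_eq by (intro integral_cong_AE) auto
qed

section \<open>Test functions and weak derivatives\<close>

lemma iterated_deriv_tower:
  fixes F :: "nat \<Rightarrow> real \<Rightarrow> real"
  assumes "\<And>i x. (F i has_real_derivative F (Suc i) x) (at x)"
  shows "(deriv ^^ k) (F i) = F (i + k)"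
proof (induction k)
  case (Suc k)
  have "deriv (F (i + k)) = F (Suc (i + k))" by (rule ext, rule DERIV_imp_deriv, rule assms)
  then show ?case using Suc by simp
qed simp

lemma test_function_tower:
  fixes F :: "nat \<Rightarrow> real \<Rightarrow> real"
  assumes F: "\<And>i x. (F i has_real_derivative F (Suc i) x) (at x)"
    and "\<And>x. F i (x + 2 * pi) = F i x"
  shows "test_function (F i)" "deriv (F i) = F (Suc i)"
proof -
  have it: "(deriv ^^ k) (F i) = F (i + k)" for k by (rule iterated_deriv_tower) (rule F)
  show "test_function (F i)"
    using F assms(2) by (auto simp: test_function_def it real_differentiable_def)
  show "deriv (F i) = F (Suc i)" using it[of 1] by simp
qed

lemma test_function_deriv: "test_function \<psi> \<Longrightarrow> test_function (deriv \<psi>)"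
proof -
  assume \<psi>: "test_function \<psi>"
  have "((deriv ^^ k) (deriv \<psi>)) differentiable (at x)" for k x
    using \<psi> unfolding test_function_def by (metis funpow_Suc_right o_apply)
  moreover have "deriv \<psi> (x + 2 * pi) = deriv \<psi> x" for x
  proof -
    have d: "\<psi> field_differentiable (at y)" for y
      using \<psi> unfolding test_function_def by (metis funpow_0 real_differentiable_def field_differentiable_def)
    have "((\<lambda>y. \<psi> (y + 2 * pi)) has_real_derivative deriv \<psi> (x + 2 * pi)) (at x)"
      using DERIV_shift[of \<psi> "deriv \<psi> (x + 2*pi)" x "2*pi"] d[THEN field_differentiable_derivI] by simp
    then have "(\<psi> has_real_derivative deriv \<psi> (x + 2 * pi)) (at x)"
      using \<psi> by (simp add: test_function_def)
    then show ?thesis using DERIV_imp_deriv by force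
  qed
  ultimately show ?thesis by (simp add: test_function_def)
qed

lemma test_function_continuous: "test_function \<psi> \<Longrightarrow> continuous_on UNIV \<psi>"
proof -
  assume "test_function \<psi>"
  then have "\<forall>k x. ((deriv ^^ k) \<psi>) differentiable (at x)" by (simp add: test_function_def)
  from spec[OF this, of 0] have "\<psi> differentiable (at x)" for x by simp
  then show ?thesis by (intro continuous_at_imp_continuous_on ballI differentiable_imp_continuous_within)
qed

lemma square_integrable_continuous:
  fixes f :: "real \<Rightarrow> 'a::euclidean_space"
  assumes f: "continuous_on UNIV f"
  shows "square_integrable f"
proof -
  have c: "compact (f ` {0..2*pi})" by (intro compact_continuous_image continuous_on_subset[OF f]) auto
  obtain C where "\<forall>y\<in>f ` {0..2*pi}. norm y \<le> C"
    using compact_imp_bounded[OF c] unfolding bounded_iff by blast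
  then have C: "norm (f x) \<le> C" if "x \<in> {0..2*pi}" for x using that by blast
  have m: "f \<in> borel_measurable torus" by (rule continuous_measurable_torus[OF f])
  have "integrable torus (\<lambda>x. (norm (f x))\<^sup>2)"
    using m C by (intro finite_measure.integrable_const_bound[OF finite_measure_torus, where B = "C\<^sup>2"])
      (auto intro!: AE_I2 power_mono)
  then show ?thesis using m by (simp add: square_integrable_def)
qed

lemma square_integrable_test: "test_function \<psi> \<Longrightarrow> square_integrable \<psi>"
  by (intro square_integrable_continuous test_function_continuous)

lemma integral_scaleR_inner:
  fixes f :: "'b::euclidean_space L2"
  assumes "square_integrable \<psi>"
  shows "(LINT x|torus. \<psi> x *\<^sub>R rep_L2 f x) \<bullet> w = inner f (tens (l2_of \<psi>) w)"
proof -
  have m: "\<psi> \<in> borel_measurable torus" using assms by (simp add: square_integrable_def)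
  have "integrable torus (\<lambda>x. \<psi> x * norm (rep_L2 f x))"
    using square_integrable_inner[OF assms, of "\<lambda>x. norm (rep_L2 f x)"] square_integrable_rep[of f]
    by (auto simp: square_integrable_def)
  then have i: "integrable torus (\<lambda>x. \<psi> x *\<^sub>R rep_L2 f x)"
    by (rule Bochner_Integration.integrable_bound) (use m in \<open>auto simp: abs_mult\<close>)
  have "(LINT x|torus. \<psi> x *\<^sub>R rep_L2 f x) \<bullet> w = (LINT x|torus. (\<psi> x *\<^sub>R rep_L2 f x) \<bullet> w)"
    by (rule integral_inner_left[symmetric]) (simp add: i)
  also have "\<dots> = inner f (tens (l2_of \<psi>) w)"
    unfolding inner_tens_eq using rep_l2_of[OF assms] m by (intro integral_cong_AE) auto
  finally show ?thesis .
qed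

text \<open>
  The vector-valued identity of integrals that defines a weak derivative becomes a statement on scalar
  products, so that weak derivatives are linear, commute with constant matrices and are compatible with
  limits.
\<close>

lemma has_weak_deriv_iff:
  "has_weak_deriv f g \<longleftrightarrow> (\<forall>\<psi> w. test_function \<psi> \<longrightarrow>
     inner f (tens (l2_of (deriv \<psi>)) w) = - inner g (tens (l2_of \<psi>) w))"
proof -
  have "(LINT x|torus. deriv \<psi> x *\<^sub>R rep_L2 f x) = - (LINT x|torus. \<psi> x *\<^sub>R rep_L2 g x) \<longleftrightarrow>
    (\<forall>w. inner f (tens (l2_of (deriv \<psi>)) w) = - inner g (tens (l2_of \<psi>) w))" if "test_function \<psi>" for \<psi>
  proof -
    have "a = - b \<longleftrightarrow> (\<forall>w. a \<bullet> w = - (b \<bullet> w))" for a b :: 'a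
      using vector_eq_rdot[of a "- b"] by simp
    then show ?thesis
      by (simp only: integral_scaleR_inner[OF square_integrable_test[OF that]]
          integral_scaleR_inner[OF square_integrable_test[OF test_function_deriv[OF that]]])
  qed
  then show ?thesis unfolding has_weak_deriv_def by blast
qed

lemma has_weak_deriv_map:
  fixes h :: "'a::euclidean_space \<Rightarrow> 'b::euclidean_space"
  assumes "linear h" "has_weak_deriv f g"
  shows "has_weak_deriv (l2_map h f) (l2_map h g)"
  using assms by (simp add: has_weak_deriv_iff inner_l2_map_tens)

lemma has_weak_deriv_add:
  "has_weak_deriv f g \<Longrightarrow> has_weak_deriv f' g' \<Longrightarrow> has_weak_deriv (f + f') (g + g')"
  by (simp add: has_weak_deriv_iff inner_add_left)

section \<open>Uniqueness of weak derivatives\<close>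

text \<open>
  Polynomials in the coordinates of the circle stay polynomials when differentiated along it. They are
  the test functions to which the Stone--Weierstrass theorem applies.
\<close>

lemma deriv_polynomial_cis:
  fixes p :: "complex \<Rightarrow> real"
  assumes "real_polynomial_function p"
  shows "\<exists>p'. real_polynomial_function p' \<and>
     (\<forall>x. ((\<lambda>x. p (cis x)) has_real_derivative p' (cis x)) (at x))"
  using assms
proof (induction rule: real_polynomial_function.induct)
  case (linear f)
  have "((\<lambda>x. f (cis x)) has_real_derivative f (\<i> * cis x)) (at x)" for x
  proof -
    have "((\<lambda>x. f (cis x)) has_vector_derivative f (\<i> * cis x)) (at x)"
      by (rule bounded_linear.has_vector_derivative[OF linear])
        (auto intro!: derivative_eq_intros simp: has_vector_derivative_def mult.commute scaleR_conv_of_real)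
    then show ?thesis by (simp add: has_real_derivative_iff_has_vector_derivative)
  qed
  moreover have "real_polynomial_function (\<lambda>z. f (\<i> * z))"
    by (intro real_polynomial_function.intros(1) bounded_linear_compose[OF linear] bounded_linear_mult_right)
  ultimately show ?case by (intro exI[of _ "\<lambda>z. f (\<i> * z)"]) auto
next
  case (const c)
  then show ?case by (intro exI[of _ "\<lambda>z. 0"]) (auto intro: real_polynomial_function.intros)
next
  case (add f g)
  then obtain f' g' where "real_polynomial_function f'" "real_polynomial_function g'"
    "\<And>x. ((\<lambda>x. f (cis x)) has_real_derivative f' (cis x)) (at x)"
    "\<And>x. ((\<lambda>x. g (cis x)) has_real_derivative g' (cis x)) (at x)" by blast
  then show ?case
    by (intro exI[of _ "\<lambda>z. f' z + g' z"]) (auto intro!: real_polynomial_function.intros(3) derivative_eq_intros)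
next
  case (mult f g)
  then obtain f' g' where fg: "real_polynomial_function f'" "real_polynomial_function g'"
    "\<And>x. ((\<lambda>x. f (cis x)) has_real_derivative f' (cis x)) (at x)"
    "\<And>x. ((\<lambda>x. g (cis x)) has_real_derivative g' (cis x)) (at x)" by blast
  have "real_polynomial_function (\<lambda>z. f' z * g z + g' z * f z)"
    using fg mult
    by (intro real_polynomial_function.intros(3) real_polynomial_function.intros(4))
  moreover have "((\<lambda>x. f (cis x) * g (cis x)) has_real_derivative
      f' (cis x) * g (cis x) + g' (cis x) * f (cis x)) (at x)" for x
    by (rule DERIV_mult[OF fg(3,4)])
  ultimately show ?case by (intro exI[of _ "\<lambda>z. f' z * g z + g' z * f z"] conjI allI)
qed

lemma cis_periodic: "cis (x + 2 * pi) = cis x"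
  by (simp add: cis_mult[symmetric])

lemma test_function_polynomial_cis:
  assumes "real_polynomial_function p"
  shows "test_function (\<lambda>x. p (cis x))"
proof -
  have "\<exists>q. \<forall>n. (real_polynomial_function (q n) \<and> (n = 0 \<longrightarrow> q n = p)) \<and>
     (\<forall>x. ((\<lambda>x. q n (cis x)) has_real_derivative q (Suc n) (cis x)) (at x))"
  proof (rule dependent_nat_choice)
    show "\<exists>q. real_polynomial_function q \<and> (0 = (0::nat) \<longrightarrow> q = p)" using assms by blast
  next
    fix q and n :: nat
    assume "real_polynomial_function q \<and> (n = 0 \<longrightarrow> q = p)"
    then show "\<exists>q'. (real_polynomial_function q' \<and> (Suc n = 0 \<longrightarrow> q' = p)) \<and>
        (\<forall>x. ((\<lambda>x. q (cis x)) has_real_derivative q' (cis x)) (at x))"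
      using deriv_polynomial_cis[of q] by auto
  qed
  then obtain q where q: "q 0 = p"
    "\<And>n x. ((\<lambda>x. q n (cis x)) has_real_derivative q (Suc n) (cis x)) (at x)" by blast
  show ?thesis
    using test_function_tower(1)[of "\<lambda>n x. q n (cis x)" 0] q by (simp add: cis_periodic)
qed

lemma cis_inj_on: "x \<in> {0..<2*pi} \<Longrightarrow> y \<in> {0..<2*pi} \<Longrightarrow> cis x = cis y \<Longrightarrow> x = y"
  using Arg2pi_unique[of 1 x "cis x"] Arg2pi_unique[of 1 y "cis y"] by (simp add: cis_conv_exp)

text \<open>
  Half-lines form an intersection-stable generator of the Borel sets, and the sets of integral zero
  are closed under complements and disjoint unions.
\<close>

lemma set_integral_zero_if_zero_on_half_lines:
  fixes v :: "real \<Rightarrow> real"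
  assumes iv: "integrable lborel v"
    and half: "\<And>a. (LINT x:{..a}|lborel. v x) = 0"
    and tot: "(LINT x:UNIV|lborel. v x) = 0"
    and A: "A \<in> sets borel"
  shows "(LINT x:A|lborel. v x) = 0"
proof -
  have A: "A \<in> sigma_sets UNIV (range atMost)" using assms(4) by (simp add: borel_eq_atMost)
  have "{..a} \<inter> {..b} = {..min a b}" for a b :: real by auto
  then have "Int_stable (range (atMost :: real \<Rightarrow> _))" by (auto simp: Int_stable_def)
  moreover have "range atMost \<subseteq> Pow (UNIV :: real set)" by simp
  ultimately show ?thesis using A
  proof (induction rule: sigma_sets_induct_disjoint)
    case (basic A)
    then obtain a where "A = {..a}" by blast
    then show ?case using half by simp
  next
    case empty then show ?case by (simp add: set_lebesgue_integral_def)
  next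
    case (compl A)
    have A: "A \<in> sets lborel" using compl(1) by (simp add: borel_eq_atMost)
    have si: "set_integrable lborel X v" if "X \<in> sets lborel" for X
      unfolding set_integrable_def using integrable_mult_indicator[OF that iv] .
    have "(LINT x:A \<union> (UNIV - A)|lborel. v x) = (LINT x:A|lborel. v x) + (LINT x:UNIV - A|lborel. v x)"
    proof (rule set_integral_Un[OF _ si[OF A] si])
      show "UNIV - A \<in> sets lborel" using sets.compl_sets[OF A] by simp
    qed blast
    moreover have "A \<union> (UNIV - A) = UNIV" by blast
    ultimately show ?case using tot compl(2) by simp
  next
    case (union A)
    have A: "A i \<in> sets lborel" for i
      using range_subsetD[OF union(2), of i] by (simp add: borel_eq_atMost)
    have "(LINT x:(\<Union>i. A i)|lborel. v x) = (\<Sum>i. LINT x:A i|lborel. v x)"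
    proof (rule lebesgue_integral_countable_add)
      show "A i \<in> sets lborel" for i by (rule A)
      show "i \<noteq> j \<Longrightarrow> A i \<inter> A j = {}" for i j using union(1) by (auto simp: disjoint_family_on_def)
      show "set_integrable lborel (\<Union>i. A i) v"
        unfolding set_integrable_def
        by (rule integrable_mult_indicator[OF sets.countable_UN iv]) (use A in blast)
    qed
    also have "\<dots> = 0" using union(3) by simp
    finally show ?case .
  qed
qed

text \<open>
  From test functions to continuous functions on the circle, to indicators of closed arcs, to
  half-lines, to Borel sets.
\<close>

lemma AE_zero_if_orthogonal_to_test_functions:
  fixes u :: "real \<Rightarrow> real"
  assumes u: "integrable torus u"
    and orth: "\<And>\<psi>. test_function \<psi> \<Longrightarrow> (LINT x|torus. \<psi> x * u x) = 0"
  shows "AE x in torus. u x = 0"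
proof -
  have mu [measurable]: "u \<in> borel_measurable torus" using u by auto
  have mcis [measurable]: "(\<lambda>x. f (cis x)) \<in> borel_measurable torus"
    if "continuous_on (sphere 0 1) f" for f :: "complex \<Rightarrow> real"
    by (intro continuous_measurable_torus continuous_on_compose2[OF that]) (auto intro!: continuous_intros)
  \<comment> \<open>Stone--Weierstrass replaces trigonometric polynomials by continuous functions on the circle.\<close>
  have cont: "(LINT x|torus. F (cis x) * u x) = 0" if F: "continuous_on (sphere 0 1) F" for F :: "complex \<Rightarrow> real"
  proof (rule ccontr)
    let ?I = "LINT x|torus. F (cis x) * u x"
    define n where "n = (LINT x|torus. \<bar>u x\<bar>)"
    assume "?I \<noteq> 0"
    have n0: "n \<ge> 0" by (simp add: n_def)
    define e where "e = \<bar>?I\<bar> / (2 * (n + 1))"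
    have e: "e > 0" unfolding e_def using \<open>?I \<noteq> 0\<close> n0 by (intro divide_pos_pos) auto
    obtain g where g: "real_polynomial_function g" "\<And>z. z \<in> sphere 0 1 \<Longrightarrow> \<bar>F z - g z\<bar> < e"
      using Stone_Weierstrass_real_polynomial_function[OF compact_sphere F e] by blast
    have cg: "continuous_on (sphere 0 1) g"
      by (intro continuous_at_imp_continuous_on ballI continuous_real_polymonial_function g(1))
    have bd: "integrable torus (\<lambda>x. f (cis x) * u x)" if f: "continuous_on (sphere 0 1) f" for f :: "complex \<Rightarrow> real"
    proof -
      have "bounded (f ` sphere 0 1)" by (intro compact_imp_bounded compact_continuous_image f compact_sphere)
      then obtain C where "\<forall>y\<in>f ` sphere 0 1. norm y \<le> C" unfolding bounded_iff by blast
      then have "\<bar>f (cis x)\<bar> \<le> C" for x by auto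
      then have C: "\<bar>f (cis x)\<bar> \<le> \<bar>C\<bar>" for x by (rule order_trans) simp
      show ?thesis
        by (rule Bochner_Integration.integrable_bound[of _ "\<lambda>x. \<bar>C\<bar> * \<bar>u x\<bar>"])
          (use u C mcis[OF f] in \<open>auto simp: abs_mult intro!: mult_right_mono\<close>)
    qed
    have "?I = (LINT x|torus. F (cis x) * u x) - (LINT x|torus. g (cis x) * u x)"
      using orth[OF test_function_polynomial_cis[OF g(1)]] by simp
    also have "\<dots> = (LINT x|torus. (F (cis x) - g (cis x)) * u x)"
      by (subst Bochner_Integration.integral_diff[symmetric, OF bd[OF F] bd[OF cg]])
        (simp add: left_diff_distrib)
    finally have "\<bar>?I\<bar> = \<bar>LINT x|torus. (F (cis x) - g (cis x)) * u x\<bar>" by simp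
    also have "\<dots> \<le> (LINT x|torus. e * \<bar>u x\<bar>)"
    proof (rule integral_abs_bound_integral)
      show "integrable torus (\<lambda>x. (F (cis x) - g (cis x)) * u x)"
        by (rule bd[OF continuous_on_diff[OF F cg]])
      show "\<bar>(F (cis x) - g (cis x)) * u x\<bar> \<le> e * \<bar>u x\<bar>" for x
        unfolding abs_mult using g(2)[of "cis x"] by (intro mult_right_mono) auto
    qed (simp add: u)
    also have "\<dots> = e * n" by (simp add: n_def)
    also have "\<dots> \<le> \<bar>?I\<bar> / 2"
    proof -
      have "\<bar>?I\<bar> * n \<le> \<bar>?I\<bar> * (n + 1)" by (intro mult_left_mono) auto
      then show ?thesis using n0 by (simp add: e_def field_simps)
    qed
    finally show False using \<open>?I \<noteq> 0\<close> by simp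
  qed
  \<comment> \<open>The indicator of a closed set is a bounded limit of continuous functions.\<close>
  have ind: "(LINT x|torus. indicator C (cis x) * u x) = 0" if C: "closed C" "C \<noteq> {}" for C :: "complex set"
  proof -
    define F where "F k z = max 0 (1 - real k * infdist z C)" for k z
    have Fc: "continuous_on (sphere 0 1) (F k)" for k
      unfolding F_def by (intro continuous_intros)
    have "(\<lambda>k. LINT x|torus. F k (cis x) * u x) \<longlonglongrightarrow> (LINT x|torus. indicator C (cis x) * u x)"
    proof (rule integral_dominated_convergence[where w = "\<lambda>x. \<bar>u x\<bar>"])
      have "(\<lambda>k. F k z) \<longlonglongrightarrow> indicator C z" for z
      proof (cases "z \<in> C")
        case True
        then show ?thesis by (simp add: F_def)
      next
        case False
        then have pos: "infdist z C > 0"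
          using C in_closed_iff_infdist_zero infdist_nonneg by (metis less_eq_real_def)
        obtain k0 where k0: "1 < real k0 * infdist z C" using reals_Archimedean3[OF pos] by blast
        have "F k z = 0" if "k \<ge> k0" for k
        proof -
          have "real k0 * infdist z C \<le> real k * infdist z C" using that pos by (intro mult_right_mono) auto
          then show ?thesis using k0 by (simp add: F_def)
        qed
        then show ?thesis using False
          by (intro tendsto_eventually eventually_sequentiallyI[of k0]) auto
      qed
      then show "AE x in torus. (\<lambda>k. F k (cis x) * u x) \<longlonglongrightarrow> indicator C (cis x) * u x"
        by (intro AE_I2 tendsto_intros)
      have "\<bar>F k z\<bar> \<le> 1" for k z by (simp add: F_def infdist_nonneg)
      then show "AE x in torus. norm (F k (cis x) * u x) \<le> \<bar>u x\<bar>" for k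
        by (intro AE_I2) (auto simp: abs_mult intro: mult_left_le_one_le)
      have "(\<lambda>x. indicator C (cis x)) \<in> borel_measurable (borel :: real measure)"
        using C(1) by (intro measurable_compose[OF borel_measurable_continuous_onI borel_measurable_indicator])
          (auto intro!: continuous_intros)
      then have "(\<lambda>x. indicator C (cis x) :: real) \<in> borel_measurable torus" by (rule measurable_torusI)
      then show "(\<lambda>x. indicator C (cis x) * u x) \<in> borel_measurable torus" by measurable
    qed (use mcis[OF Fc] u in auto)
    moreover have "(LINT x|torus. F k (cis x) * u x) = 0" for k by (rule cont[OF Fc])
    ultimately show ?thesis by (simp add: LIMSEQ_const_iff)
  qed
  define v where "v x = indicator {0..<2*pi} x * u x" for x
  have tl: "(LINT x|torus. f x) = (LINT x|lborel. indicator {0..<2*pi} x * f x)" for f :: "real \<Rightarrow> real"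
    unfolding torus_def by (subst integral_restrict_space) auto
  have iv: "integrable lborel v"
    using u unfolding torus_def v_def by (subst (asm) integrable_restrict_space) auto
  have half: "(LINT x:{..a}|lborel. v x) = 0" for a
  proof -
    consider "a < 0" | "0 \<le> a" "a < 2 * pi" | "a \<ge> 2 * pi" by linarith
    then show ?thesis
    proof cases
      case 1
      have "indicat_real {..a} x *\<^sub>R v x = 0" for x using 1 by (auto simp: v_def indicator_def)
      then show ?thesis by (simp only: set_lebesgue_integral_def Bochner_Integration.integral_zero)
    next
      case 2
      have "(LINT x:{..a}|lborel. v x) = (LINT x|lborel. indicator {0..<2*pi} x * (indicator (cis ` {0..a}) (cis x) * u x))"
        unfolding set_lebesgue_integral_def
      proof (rule Bochner_Integration.integral_cong[OF refl])
        fix x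
        have "cis x \<in> cis ` {0..a} \<longleftrightarrow> x \<le> a" if x: "x \<in> {0..<2*pi}"
        proof
          assume "cis x \<in> cis ` {0..a}"
          then obtain y where y: "y \<in> {0..a}" "cis x = cis y" by blast
          then have "x = y" using 2 by (intro cis_inj_on[OF x]) auto
          then show "x \<le> a" using y by simp
        qed (use x in auto)
        then show "indicat_real {..a} x *\<^sub>R v x = indicator {0..<2*pi} x * (indicator (cis ` {0..a}) (cis x) * u x)"
          by (cases "x \<in> {0..<2*pi}") (simp_all only: v_def indicator_def, simp_all)
      qed
      also have "\<dots> = (LINT x|torus. indicator (cis ` {0..a}) (cis x) * u x)" by (rule tl[symmetric])
      also have "\<dots> = 0"
      proof (rule ind)
        show "closed (cis ` {0..a})"
          by (intro compact_imp_closed compact_continuous_image continuous_intros) simp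
      qed (use 2 in simp)
      finally show ?thesis .
    next
      case 3
      have "indicat_real {..a} x *\<^sub>R v x = indicator {0..<2*pi} x * (1 * u x)" for x
        using 3 by (auto simp: v_def indicator_def)
      then have "(LINT x:{..a}|lborel. v x) = (LINT x|lborel. indicator {0..<2*pi} x * (1 * u x))"
        by (simp only: set_lebesgue_integral_def)
      also have "\<dots> = (LINT x|torus. 1 * u x)" by (rule tl[symmetric])
      also have "\<dots> = 0" by (rule cont) simp
      finally show ?thesis .
    qed
  qed
  have tot: "(LINT x:UNIV|lborel. v x) = 0"
  proof -
    have "indicat_real UNIV x *\<^sub>R v x = indicat_real {..2*pi} x *\<^sub>R v x" for x
      by (auto simp: v_def indicator_def)
    then have "(LINT x:UNIV|lborel. v x) = (LINT x:{..2*pi}|lborel. v x)"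
      by (simp only: set_lebesgue_integral_def)
    then show ?thesis using half by simp
  qed
  have all: "(LINT x:A|lborel. v x) = 0" if "A \<in> sets borel" for A
    by (rule set_integral_zero_if_zero_on_half_lines[OF iv half tot that])
  have "AE x in lborel. v x = 0"
    using density_unique_real[of lborel v "\<lambda>x. 0"] iv all by (auto simp: set_lebesgue_integral_def)
  then have "AE x in lborel. x \<in> {0..<2*pi} \<longrightarrow> u x = 0" by eventually_elim (auto simp: v_def)
  then show ?thesis unfolding torus_def by (subst AE_restrict_space_iff) auto
qed

lemma L2_zero_if_orthogonal_to_test_functions:
  assumes "\<And>\<psi> w. test_function \<psi> \<Longrightarrow> inner g (tens (l2_of \<psi>) w) = 0"
  shows "g = (0 :: 'b::euclidean_space L2)"
proof -
  have lin: "linear (\<lambda>v::'b. v \<bullet> b)" for b by (rule linearI) (auto simp: inner_add_left)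
  have "AE x in torus. \<forall>b\<in>Basis. rep_L2 g x \<bullet> b = 0"
  proof (intro AE_finite_allI finite_Basis)
    fix b :: 'b assume "b \<in> Basis"
    have sq: "square_integrable (\<lambda>x. rep_L2 g x \<bullet> b)"
      by (rule square_integrable_linear[OF lin] square_integrable_rep)+
    have so: "square_integrable (\<lambda>x. 1::real)"
      by (rule square_integrable_bounded[where C=1]) auto
    show "AE x in torus. rep_L2 g x \<bullet> b = 0"
    proof (rule AE_zero_if_orthogonal_to_test_functions)
      show "integrable torus (\<lambda>x. rep_L2 g x \<bullet> b)" using square_integrable_inner[OF sq so] by simp
      fix \<psi> assume \<psi>: "test_function \<psi>"
      have "(LINT x|torus. \<psi> x * (rep_L2 g x \<bullet> b)) = (LINT x|torus. (rep_L2 (l2_of \<psi>) x *\<^sub>R rep_L2 g x) \<bullet> b)"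
        using rep_l2_of[OF square_integrable_test[OF \<psi>]] square_integrable_test[OF \<psi>]
        by (intro integral_cong_AE) (auto simp: square_integrable_def)
      also have "\<dots> = 0" using assms[OF \<psi>, of b] by (simp add: inner_tens_eq)
      finally show "(LINT x|torus. \<psi> x * (rep_L2 g x \<bullet> b)) = 0" .
    qed
  qed
  then have "AE x in torus. rep_L2 g x = 0" by eventually_elim (auto intro: euclidean_eqI)
  moreover have "AE x in torus. rep_L2 (0 :: 'b L2) x = 0"
    using rep_scaleR[of 0 "0 :: 'b L2"] by simp
  ultimately have "AE x in torus. rep_L2 g x = rep_L2 (0 :: 'b L2) x" by eventually_elim simp
  then show ?thesis by (rule l2_eqI_AE)
qed

text \<open>
  This gives a meaning to the descriptor in the definition of \<^const>\<open>weak_deriv\<close>.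
\<close>

lemma weak_deriv_eqI:
  assumes "has_weak_deriv f g"
  shows "weak_deriv f = g"
  unfolding weak_deriv_def
proof (rule the_equality)
  show "has_weak_deriv f g" by (rule assms)
next
  fix g' assume "has_weak_deriv f g'"
  then have "inner (g' - g) (tens (l2_of \<psi>) w) = 0" if "test_function \<psi>" for \<psi> w
    using assms that by (simp add: has_weak_deriv_iff inner_diff_left)
  then show "g' = g" using L2_zero_if_orthogonal_to_test_functions[of "g' - g"] by simp
qed

section \<open>Block structure and the adjoint of the generator\<close>

definition inj_hyp :: "real ^ 'h \<Rightarrow> real ^ ('h::finite + 'p::finite)" where
  "inj_hyp y = (\<chi> i. case i of Inl a \<Rightarrow> y $ a | Inr _ \<Rightarrow> 0)"

definition inj_par :: "real ^ 'p \<Rightarrow> real ^ ('h::finite + 'p::finite)" where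
  "inj_par z = (\<chi> i. case i of Inl _ \<Rightarrow> 0 | Inr a \<Rightarrow> z $ a)"

definition proj_hyp :: "real ^ ('h::finite + 'p::finite) \<Rightarrow> real ^ 'h" where
  "proj_hyp v = (\<chi> i. v $ Inl i)"

definition proj_par :: "real ^ ('h::finite + 'p::finite) \<Rightarrow> real ^ 'p" where
  "proj_par v = (\<chi> i. v $ Inr i)"

lemma vec_sum_eqI:
  fixes u v :: "'a ^ ('h::finite + 'p::finite)"
  shows "(\<And>a. u $ Inl a = v $ Inl a) \<Longrightarrow> (\<And>a. u $ Inr a = v $ Inr a) \<Longrightarrow> u = v"
  unfolding vec_eq_iff by (metis sum.exhaust)

lemma linear_blocks [simp]: "linear inj_hyp" "linear inj_par" "linear proj_hyp" "linear proj_par"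
  by (auto intro!: linearI simp: vec_eq_iff inj_hyp_def inj_par_def proj_hyp_def proj_par_def split: sum.split)

lemma blocks_decompose: "inj_hyp (proj_hyp v) + inj_par (proj_par v) = v"
  by (rule vec_sum_eqI) (auto simp: inj_hyp_def inj_par_def proj_hyp_def proj_par_def)

lemma UNIV_sum_Plus: "(UNIV :: ('a + 'b) set) = range Inl \<union> range Inr"
  by (auto, metis rangeI sum.exhaust)

lemma sum_UNIV_sum:
  fixes f :: "('h::finite + 'p::finite) \<Rightarrow> 'a::comm_monoid_add"
  shows "(\<Sum>j\<in>UNIV. f j) = (\<Sum>a\<in>UNIV. f (Inl a)) + (\<Sum>a\<in>UNIV. f (Inr a))"
  unfolding UNIV_sum_Plus
  by (subst sum.union_disjoint) (auto simp: sum.reindex)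

lemma block_matrix_mult_parabolic:
  fixes D :: "real ^ 'p::finite ^ 'p"
  shows "(block_matrix 0 0 0 D :: real ^ ('h::finite + 'p) ^ ('h + 'p)) *v v = inj_par (D *v proj_par v)"
  by (rule vec_sum_eqI)
    (simp_all add: matrix_vector_mult_def block_matrix_def inj_par_def proj_par_def sum_UNIV_sum)

text \<open>
  The hyperbolic components have only one derivative, but \<open>B\<close> does not see them.
\<close>

lemma op_domain_derivatives:
  fixes D :: "real ^ 'p::finite ^ 'p" and f :: "(real ^ ('h::finite + 'p)) L2"
  assumes B: "B = block_matrix 0 0 0 D" and f: "f \<in> op_domain"
  obtains f' g1 g2 where "has_weak_deriv f f'" "has_weak_deriv (l2_map (\<lambda>v. B *v v) f) g1" "has_weak_deriv g1 g2"
proof -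
  have hp: "hyp_part f = l2_map proj_hyp f" "par_part f = l2_map proj_par f"
    by (simp_all add: hyp_part_def par_part_def proj_hyp_def[abs_def] proj_par_def[abs_def])
  obtain h1 where h1: "has_weak_deriv (hyp_part f) h1" using f by (auto simp: op_domain_def)
  obtain p1 p2 where p: "has_weak_deriv (par_part f) p1" "has_weak_deriv p1 p2"
    using f by (auto simp: op_domain_def numeral_2_eq_2)
  have "f = l2_map inj_hyp (hyp_part f) + l2_map inj_par (par_part f)"
    unfolding hp
    by (simp add: l2_map_compose l2_map_id blocks_decompose linear_compose[unfolded o_def]
        flip: l2_map_add_fun)
  then have 1: "has_weak_deriv f (l2_map inj_hyp h1 + l2_map inj_par p1)"
    using has_weak_deriv_add[OF has_weak_deriv_map[OF linear_blocks(1) h1]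
        has_weak_deriv_map[OF linear_blocks(2) p(1)]] by metis
  have lD: "linear (\<lambda>z. inj_par (D *v z) :: real ^ ('h + 'p))"
    using linear_compose[OF matrix_vector_mul_linear[of D] linear_blocks(2)] by (simp add: o_def)
  have "l2_map (\<lambda>v. B *v v) f = l2_map (\<lambda>z. inj_par (D *v z)) (par_part f)"
    unfolding hp l2_map_compose[OF lD linear_blocks(4)] B block_matrix_mult_parabolic ..
  then show ?thesis
    using that[OF 1, of "l2_map (\<lambda>z. inj_par (D *v z)) p1" "l2_map (\<lambda>z. inj_par (D *v z)) p2"]
      has_weak_deriv_map[OF lD p(1)] has_weak_deriv_map[OF lD p(2)] by metis
qed

lemma inner_matrix_tens:
  fixes A :: "real ^ 'n::finite ^ 'm::finite"
  shows "inner (l2_map (\<lambda>v. A *v v) f) (tens p w) = inner f (tens p (transpose A *v w))"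
  using inner_l2_map_tens[OF matrix_vector_mul_linear[of A], of f p w]
  by (simp add: adjoint_matrix)

text \<open>
  Weak derivatives move onto the test function for elements of the domain of the operator; scalar
  products are continuous, so the identity survives the closure of the graph.
\<close>

lemma generator_adjoint:
  fixes D :: "real ^ 'p::finite ^ 'p" and h k :: "(real ^ ('h::finite + 'p)) L2"
  assumes S: "semigroup_generated B A K S" and B: "B = block_matrix 0 0 0 D"
    and hk: "(h, k) \<in> generator_graph S" and \<psi>: "test_function \<psi>"
  shows "inner k (tens (l2_of \<psi>) w) = inner h
    (tens (l2_of (deriv (deriv \<psi>))) (transpose B *v w) + tens (l2_of (deriv \<psi>)) (transpose A *v w)
     - tens (l2_of \<psi>) (transpose K *v w))" (is "inner k ?p = inner h ?q")
proof -
  note \<psi>' = test_function_deriv[OF \<psi>]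
  have "closed {x. inner (snd x) ?p = inner (fst x) ?q}"
    by (intro closed_Collect_eq continuous_intros)
  moreover have "(\<lambda>f. (f, - parabolic_transport_op B A K f)) ` op_domain
      \<subseteq> {x. inner (snd x) ?p = inner (fst x) ?q}"
  proof (rule image_subsetI, unfold mem_Collect_eq fst_conv snd_conv inner_minus_left)
    fix f :: "(real ^ ('h + 'p)) L2" assume f: "f \<in> op_domain"
    obtain f' g1 g2 where d: "has_weak_deriv f f'" "has_weak_deriv (l2_map (\<lambda>v. B *v v) f) g1"
      "has_weak_deriv g1 g2" by (rule op_domain_derivatives[OF B f])
    have "inner (weak_deriv (weak_deriv (l2_map (\<lambda>v. B *v v) f))) ?p = inner g2 ?p"
      by (simp add: weak_deriv_eqI[OF d(2)] weak_deriv_eqI[OF d(3)])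
    also have "\<dots> = - inner g1 (tens (l2_of (deriv \<psi>)) w)"
      using d(3) \<psi> by (auto simp: has_weak_deriv_iff)
    also have "\<dots> = inner (l2_map (\<lambda>v. B *v v) f) (tens (l2_of (deriv (deriv \<psi>))) w)"
      using d(2) \<psi>' by (auto simp: has_weak_deriv_iff)
    also have "\<dots> = inner f (tens (l2_of (deriv (deriv \<psi>))) (transpose B *v w))"
      by (rule inner_matrix_tens)
    finally have 1: "inner (weak_deriv (weak_deriv (l2_map (\<lambda>v. B *v v) f))) ?p
      = inner f (tens (l2_of (deriv (deriv \<psi>))) (transpose B *v w))" .
    have 2: "inner (l2_map (\<lambda>v. A *v v) (weak_deriv f)) ?p = - inner f (tens (l2_of (deriv \<psi>)) (transpose A *v w))"
    proof -
      have "inner f (tens (l2_of (deriv \<psi>)) v) = - inner f' (tens (l2_of \<psi>) v)" for v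
        using d(1) \<psi> by (auto simp: has_weak_deriv_iff)
      then show ?thesis by (simp only: weak_deriv_eqI[OF d(1)] inner_matrix_tens minus_minus)
    qed
    show "- inner (parabolic_transport_op B A K f) ?p = inner f ?q"
      by (simp only: parabolic_transport_op_def inner_add_left inner_minus_left inner_add_right
          inner_diff_right 1 2 inner_matrix_tens[of K])
  qed
  ultimately have "closure ((\<lambda>f. (f, - parabolic_transport_op B A K f)) ` op_domain)
      \<subseteq> {x. inner (snd x) ?p = inner (fst x) ?q}" by (rule closure_minimal[rotated])
  then show ?thesis using hk S unfolding semigroup_generated_def by auto
qed

section \<open>Travelling profiles\<close>

text \<open>
  Taylor's formula with a bounded second derivative makes the difference quotients converge uniformly,
  hence in the mean square.
\<close>

lemma translated_profile_has_vector_derivative: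
  fixes F :: "nat \<Rightarrow> real \<Rightarrow> real"
  assumes F: "\<And>i x. (F i has_real_derivative F (Suc i) x) (at x)"
    and bound: "\<And>i x. \<bar>F i x\<bar> \<le> M i"
  shows "((\<lambda>s. l2_of (\<lambda>x. F i (x - \<mu> * s))) has_vector_derivative
    (- \<mu>) *\<^sub>R l2_of (\<lambda>x. F (Suc i) (x - \<mu> * s))) (at s within X)"
proof -
  have cF: "continuous_on UNIV (F i)" for i
    using F by (intro DERIV_continuous_on[of _ _ "F (Suc i)"]) (auto intro: has_field_derivative_at_within)
  have sq: "square_integrable (\<lambda>x. F i (x - \<mu> * s))" for i s
    by (intro square_integrable_continuous continuous_on_compose2[OF cF]) (auto intro!: continuous_intros)
  have M0: "0 \<le> M i" for i using bound[of i 0] by linarith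
  have taylor: "\<bar>F i (y + h) - F i y - h * F (Suc i) y\<bar> \<le> M (i + 2) * h\<^sup>2" for y h
  proof -
    have lip: "\<bar>F (Suc i) z - F (Suc i) y\<bar> \<le> M (i + 2) * \<bar>z - y\<bar>" for z
    proof -
      have "norm (F (Suc i) z - F (Suc i) y) \<le> M (i + 2) * norm (z - y)"
        by (rule field_differentiable_bound[of UNIV "F (Suc i)" "F (i + 2)"])
          (use F[of "Suc i"] bound[of "i + 2"] in auto)
      then show ?thesis by simp
    qed
    have "norm (F i (y + h) - F i y - (y + h - y) *\<^sub>R F (Suc i) y) \<le> norm (y + h - y) * (M (i + 2) * \<bar>h\<bar>)"
    proof (rule vector_differentiable_bound_linearization[where S = "closed_segment y (y + h)" and f' = "F (Suc i)"])
      show "(F i has_vector_derivative F (Suc i) x) (at x within closed_segment y (y + h))" for x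
        using F[of i x] by (auto simp: has_real_derivative_iff_has_vector_derivative intro: has_vector_derivative_at_within)
      show "norm (F (Suc i) x - F (Suc i) y) \<le> M (i + 2) * \<bar>h\<bar>" if "x \<in> closed_segment y (y + h)" for x
      proof -
        have "\<bar>x - y\<bar> \<le> \<bar>h\<bar>" using that by (auto simp: closed_segment_eq_real_ivl split: if_splits)
        then have "M (i + 2) * \<bar>x - y\<bar> \<le> M (i + 2) * \<bar>h\<bar>" using M0 by (intro mult_left_mono) auto
        then show ?thesis using lip[of x] by simp
      qed
    qed auto
    then show ?thesis by (simp add: power2_eq_square mult_ac)
  qed
  define L where "L s = l2_of (\<lambda>x. F i (x - \<mu> * s))" for s
  define L' where "L' = l2_of (\<lambda>x. F (Suc i) (x - \<mu> * s))"
  define C where "C = sqrt (2 * pi) * (M (i + 2) * \<mu>\<^sup>2)"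
  have C0: "C \<ge> 0" using M0 by (simp add: C_def)
  have est: "norm (L t - L s - (t - s) *\<^sub>R ((- \<mu>) *\<^sub>R L')) \<le> C * (t - s)\<^sup>2" for t
  proof -
    have "L t - L s - (t - s) *\<^sub>R ((- \<mu>) *\<^sub>R L')
       = L t + (-1) *\<^sub>R L s + (\<mu> * (t - s)) *\<^sub>R L'" by (simp add: algebra_simps)
    also have "\<dots> = l2_of (\<lambda>x. F i (x - \<mu> * t) + (-1) *\<^sub>R F i (x - \<mu> * s) + (\<mu> * (t - s)) *\<^sub>R F (Suc i) (x - \<mu> * s))"
      unfolding L_def L'_def
      by (subst l2_of_add l2_of_scaleR, (intro square_integrable_add square_integrable_scaleR sq)+)+ simp
    finally have eq: "L t - L s - (t - s) *\<^sub>R ((- \<mu>) *\<^sub>R L') =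
      l2_of (\<lambda>x. F i (x - \<mu> * t) + (-1) *\<^sub>R F i (x - \<mu> * s) + (\<mu> * (t - s)) *\<^sub>R F (Suc i) (x - \<mu> * s))" .
    have "norm (L t - L s - (t - s) *\<^sub>R ((- \<mu>) *\<^sub>R L')) \<le> sqrt (2 * pi) * (M (i + 2) * (\<mu> * (t - s))\<^sup>2)"
      unfolding eq
    proof (rule norm_l2_of_le)
      show "norm (F i (x - \<mu> * t) + (-1) *\<^sub>R F i (x - \<mu> * s) + (\<mu> * (t - s)) *\<^sub>R F (Suc i) (x - \<mu> * s))
          \<le> M (i + 2) * (\<mu> * (t - s))\<^sup>2" for x
        using taylor[of "x - \<mu> * s" "- (\<mu> * (t - s))", unfolded power2_minus] by (simp add: algebra_simps)
      show "(\<lambda>x. F i (x - \<mu> * t) + (-1) *\<^sub>R F i (x - \<mu> * s) + (\<mu> * (t - s)) *\<^sub>R F (Suc i) (x - \<mu> * s))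
          \<in> borel_measurable torus"
        using sq[of i t] sq[of i s] sq[of "Suc i" s] by (auto simp: square_integrable_def)
    qed
    then show ?thesis by (simp add: C_def power_mult_distrib mult_ac)
  qed
  have "(L has_vector_derivative (- \<mu>) *\<^sub>R L') (at s within X)"
    unfolding has_vector_derivative_def has_derivative_within_alt
  proof (intro conjI allI impI bounded_linear_scaleR_left)
    fix e :: real assume e: "e > 0"
    show "\<exists>d>0. \<forall>y\<in>X. norm (y - s) < d \<longrightarrow> norm (L y - L s - (y - s) *\<^sub>R (- \<mu>) *\<^sub>R L') \<le> e * norm (y - s)"
    proof (intro exI[of _ "e / (C + 1)"] conjI ballI impI)
      show "0 < e / (C + 1)" using e C0 by simp
      fix y assume y: "norm (y - s) < e / (C + 1)"
      then have "(C + 1) * \<bar>y - s\<bar> \<le> e" using C0 by (simp add: field_simps)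
      then have "C * \<bar>y - s\<bar> \<le> e" using C0 by (simp add: algebra_simps)
      then have "C * \<bar>y - s\<bar> * \<bar>y - s\<bar> \<le> e * \<bar>y - s\<bar>" by (rule mult_right_mono) simp
      then have "C * (y - s)\<^sup>2 \<le> e * norm (y - s)"
        by (simp add: power2_eq_square mult.assoc flip: abs_mult)
      then show "norm (L y - L s - (y - s) *\<^sub>R (- \<mu>) *\<^sub>R L') \<le> e * norm (y - s)" using est[of y] by linarith
    qed
  qed
  then show ?thesis unfolding L_def L'_def .
qed

text \<open>
  \<open>X j w\<close> stands for the \<open>j\<close>-th derivative of the profile times the vector \<open>w\<close>. Collecting the terms
  with the same derivative of the profile yields the recursion for \<open>c\<close>, except for the derivatives of
  order 0 and 1, where terms with index above \<open>P\<close> are missing. The induction on \<open>P\<close> shifts \<open>X\<close> by one.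
\<close>

lemma residual_telescopes:
  fixes X :: "nat \<Rightarrow> 'x::real_vector \<Rightarrow> 'y::real_vector"
  assumes lin: "\<And>i. linear (X i)"
    and c0: "b (c 0) = 0" "b (c 1) + a (c 0) = 0"
    and c: "\<And>q. b (c (Suc (Suc q))) + a (c (Suc q)) + c' q - k (c q) = 0"
  shows "(\<Sum>p\<le>P. X (Suc (Suc (P - p))) (b (c p)) + X (Suc (P - p)) (a (c p)) + X (P - p) (c' p - k (c p)))
    = - X 1 (b (c (Suc P))) - X 0 (b (c (Suc (Suc P))) + a (c (Suc P)))"
  using lin
proof (induction P arbitrary: X)
  case 0
  have "c' 0 - k (c 0) = - (b (c (Suc (Suc 0))) + a (c (Suc 0)))" using c[of 0]
    by (simp add: algebra_simps eq_neg_iff_add_eq_0)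
  moreover have "a (c 0) = - b (c (Suc 0))" using c0(2) by (simp add: eq_neg_iff_add_eq_0 add.commute)
  ultimately show ?case
    using c0(1) by (simp add: linear_0[OF 0] linear_neg[OF 0] linear_diff[OF 0] linear_add[OF 0])
next
  case (Suc P)
  note lin = Suc.prems
  have eq: "c' (Suc P) - k (c (Suc P)) = - (b (c (Suc (Suc (Suc P)))) + a (c (Suc (Suc P))))"
    using c[of "Suc P"] by (simp add: algebra_simps eq_neg_iff_add_eq_0)
  have "(\<Sum>p\<le>P. X (Suc (Suc (Suc P - p))) (b (c p)) + X (Suc (Suc P - p)) (a (c p)) + X (Suc P - p) (c' p - k (c p)))
    = (\<Sum>p\<le>P. X (Suc (Suc (Suc (P - p)))) (b (c p)) + X (Suc (Suc (P - p))) (a (c p)) + X (Suc (P - p)) (c' p - k (c p)))"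
    by (intro sum.cong) (auto simp: Suc_diff_le)
  also have "\<dots> = - X (Suc 1) (b (c (Suc P))) - X (Suc 0) (b (c (Suc (Suc P))) + a (c (Suc P)))"
    using Suc.IH[of "\<lambda>i. X (Suc i)"] lin by simp
  finally have S: "(\<Sum>p\<le>P. X (Suc (Suc (Suc P - p))) (b (c p)) + X (Suc (Suc P - p)) (a (c p)) + X (Suc P - p) (c' p - k (c p)))
    = - X (Suc 1) (b (c (Suc P))) - X (Suc 0) (b (c (Suc (Suc P))) + a (c (Suc P)))" .
  show ?case
    unfolding sum.atMost_Suc S by (simp add: eq linear_neg[OF lin] linear_add[OF lin] linear_diff[OF lin])
qed

section \<open>Formal solutions of the adjoint symbol on a hyperbolic branch\<close>

text \<open>
  Taylor coefficients of an entire function of exponential type, in the normalisation where the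
  derivative of the function is the shift of the sequence. In this class linear differential equations
  with constant coefficients are plain recursions.
\<close>

definition exp_type :: "(nat \<Rightarrow> 'a::real_normed_vector) \<Rightarrow> bool" where
  "exp_type \<alpha> \<longleftrightarrow> (\<exists>C r. \<forall>j. norm (\<alpha> j) \<le> C * r ^ j)"

lemma exp_typeE:
  assumes "exp_type \<alpha>"
  obtains C r where "C \<ge> 0" "r \<ge> 1" "\<And>j. norm (\<alpha> j) \<le> C * r ^ j"
proof -
  obtain C r where Cr: "\<And>j. norm (\<alpha> j) \<le> C * r ^ j" using assms by (auto simp: exp_type_def)
  have "norm (\<alpha> j) \<le> \<bar>C\<bar> * (max 1 \<bar>r\<bar>) ^ j" for j
  proof -
    have "norm (\<alpha> j) \<le> \<bar>C * r ^ j\<bar>" using Cr[of j] by linarith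
    also have "\<dots> = \<bar>C\<bar> * \<bar>r\<bar> ^ j" by (simp add: abs_mult power_abs)
    also have "\<dots> \<le> \<bar>C\<bar> * (max 1 \<bar>r\<bar>) ^ j" by (intro mult_left_mono power_mono) auto
    finally show ?thesis .
  qed
  then show ?thesis using that[of "\<bar>C\<bar>" "max 1 \<bar>r\<bar>"] by auto
qed

lemma exp_type_linear:
  fixes L :: "'a::euclidean_space \<Rightarrow> 'b::real_normed_vector"
  assumes L: "linear L" and \<alpha>: "exp_type \<alpha>"
  shows "exp_type (\<lambda>j. L (\<alpha> j))"
proof -
  obtain B where B: "B > 0" "\<And>x. norm (L x) \<le> B * norm x" using linear_bounded_pos[OF L] by blast
  obtain C r where C: "C \<ge> 0" "r \<ge> 1" "\<And>j. norm (\<alpha> j) \<le> C * r ^ j" by (rule exp_typeE[OF \<alpha>]) blast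
  have "norm (L (\<alpha> j)) \<le> (B * C) * r ^ j" for j
  proof -
    have "norm (L (\<alpha> j)) \<le> B * norm (\<alpha> j)" by (rule B)
    also have "\<dots> \<le> B * (C * r ^ j)" using C(3) B(1) by (intro mult_left_mono) auto
    finally show ?thesis by (simp add: mult_ac)
  qed
  then show ?thesis unfolding exp_type_def by blast
qed

lemma exp_type_add:
  assumes "exp_type \<alpha>" "exp_type \<beta>"
  shows "exp_type (\<lambda>j. \<alpha> j + \<beta> j)"
proof -
  obtain C r where C: "C \<ge> 0" "r \<ge> 1" "\<And>j. norm (\<alpha> j) \<le> C * r ^ j" by (rule exp_typeE[OF assms(1)]) blast
  obtain D t where D: "D \<ge> 0" "t \<ge> 1" "\<And>j. norm (\<beta> j) \<le> D * t ^ j" by (rule exp_typeE[OF assms(2)]) blast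
  have "norm (\<alpha> j + \<beta> j) \<le> (C + D) * (max r t) ^ j" for j
  proof -
    have "norm (\<alpha> j + \<beta> j) \<le> C * r ^ j + D * t ^ j"
      using norm_triangle_ineq[of "\<alpha> j" "\<beta> j"] C(3)[of j] D(3)[of j] by linarith
    also have "\<dots> \<le> C * (max r t) ^ j + D * (max r t) ^ j"
      using C D by (intro add_mono mult_left_mono power_mono) auto
    finally show ?thesis by (simp add: algebra_simps)
  qed
  then show ?thesis unfolding exp_type_def by blast
qed

lemma exp_type_uminus: "exp_type \<alpha> \<Longrightarrow> exp_type (\<lambda>j. - \<alpha> j)"
  by (simp add: exp_type_def)

lemma exp_type_diff: "exp_type \<alpha> \<Longrightarrow> exp_type \<beta> \<Longrightarrow> exp_type (\<lambda>j. \<alpha> j - \<beta> j)"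
  using exp_type_add[OF _ exp_type_uminus] by fastforce

lemma exp_type_Suc:
  assumes "exp_type \<alpha>" shows "exp_type (\<lambda>j. \<alpha> (Suc j))"
proof -
  obtain C r where C: "C \<ge> 0" "r \<ge> 1" "\<And>j. norm (\<alpha> j) \<le> C * r ^ j" by (rule exp_typeE[OF assms]) blast
  have "norm (\<alpha> (Suc j)) \<le> (C * r) * r ^ j" for j using C(3)[of "Suc j"] by (simp add: mult_ac)
  then show ?thesis unfolding exp_type_def by blast
qed

text \<open>
  The solution of \<open>h' = L h + \<beta>\<close>, on the level of coefficients; its growth rate is at most that of \<open>\<beta>\<close>
  plus a bound of \<open>L\<close>.
\<close>

lemma exp_type_recursion:
  fixes L :: "'a::euclidean_space \<Rightarrow> 'a"
  assumes L: "linear L" and \<beta>: "exp_type \<beta>" and h: "\<And>j. h (Suc j) = L (h j) + \<beta> j"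
  shows "exp_type h"
proof -
  obtain B where B: "B > 0" "\<And>x. norm (L x) \<le> B * norm x" using linear_bounded_pos[OF L] by blast
  obtain C r where C: "C \<ge> 0" "r \<ge> 1" "\<And>j. norm (\<beta> j) \<le> C * r ^ j" by (rule exp_typeE[OF \<beta>]) blast
  define D where "D = norm (h 0) + C"
  have D: "C \<le> D" "0 \<le> D" using C(1) by (auto simp: D_def)
  have "norm (h j) \<le> D * (B + r) ^ j" for j
  proof (induction j)
    case 0 then show ?case using C(1) by (simp add: D_def)
  next
    case (Suc j)
    have "norm (h (Suc j)) \<le> B * norm (h j) + C * r ^ j"
      unfolding h using norm_triangle_ineq[of "L (h j)" "\<beta> j"] B(2)[of "h j"] C(3)[of j] by linarith
    also have "\<dots> \<le> B * (D * (B + r) ^ j) + D * (B + r) ^ j"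
      using Suc B(1) C D by (intro add_mono mult_left_mono mult_mono power_mono) auto
    also have "\<dots> = (B + 1) * (D * (B + r) ^ j)" by (simp add: algebra_simps)
    also have "\<dots> \<le> (B + r) * (D * (B + r) ^ j)"
      using C B D by (intro mult_right_mono mult_nonneg_nonneg zero_le_power) auto
    finally show ?case by (simp add: mult_ac)
  qed
  then show ?thesis unfolding exp_type_def by blast
qed

lemma exp_type_zero: "exp_type (\<lambda>j. 0)"
  unfolding exp_type_def by (intro exI[of _ 0]) simp

text \<open>
  The exponential generating function of the sequence.
\<close>

definition egf :: "(nat \<Rightarrow> 'a::euclidean_space) \<Rightarrow> real \<Rightarrow> 'a" where
  "egf \<alpha> s = (\<Sum>j. (s ^ j / fact j) *\<^sub>R \<alpha> j)"

lemma egf_summable: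
  fixes \<alpha> :: "nat \<Rightarrow> 'a::euclidean_space"
  assumes "exp_type \<alpha>"
  shows "summable (\<lambda>j. (s ^ j / fact j) *\<^sub>R \<alpha> j)"
proof -
  obtain C r where C: "C \<ge> 0" "r \<ge> 1" "\<And>j. norm (\<alpha> j) \<le> C * r ^ j" by (rule exp_typeE[OF assms]) blast
  show ?thesis
  proof (rule summable_comparison_test')
    show "summable (\<lambda>j. C * (inverse (fact j) * (\<bar>s\<bar> * r) ^ j))"
      by (intro summable_mult summable_exp)
    show "norm ((s ^ j / fact j) *\<^sub>R \<alpha> j) \<le> C * (inverse (fact j) * (\<bar>s\<bar> * r) ^ j)" if "j \<ge> 0" for j
    proof -
      have "norm ((s ^ j / fact j) *\<^sub>R \<alpha> j) = (\<bar>s\<bar> ^ j / fact j) * norm (\<alpha> j)"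
        by (simp add: power_abs)
      also have "\<dots> \<le> (\<bar>s\<bar> ^ j / fact j) * (C * r ^ j)" by (intro mult_left_mono C) auto
      finally show ?thesis by (simp add: power_mult_distrib divide_inverse mult_ac)
    qed
  qed
qed

lemma egf_linear:
  fixes L :: "'a::euclidean_space \<Rightarrow> 'b::euclidean_space"
  assumes L: "linear L" and "exp_type \<alpha>"
  shows "L (egf \<alpha> s) = egf (\<lambda>j. L (\<alpha> j)) s"
proof -
  have bl: "bounded_linear L" using L by (simp add: linear_conv_bounded_linear)
  show ?thesis unfolding egf_def
    by (subst bounded_linear.suminf[OF bl egf_summable[OF assms(2)]]) (simp add: linear_scale[OF L])
qed

lemma egf_add: "exp_type \<alpha> \<Longrightarrow> exp_type \<beta> \<Longrightarrow> egf (\<lambda>j. \<alpha> j + \<beta> j) s = egf \<alpha> s + egf \<beta> s"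
  unfolding egf_def by (subst suminf_add) (simp_all add: egf_summable scaleR_add_right)

lemma egf_diff: "exp_type \<alpha> \<Longrightarrow> exp_type \<beta> \<Longrightarrow> egf (\<lambda>j. \<alpha> j - \<beta> j) s = egf \<alpha> s - egf \<beta> s"
  unfolding egf_def by (subst suminf_diff) (simp_all add: egf_summable scaleR_diff_right)

lemma egf_zero [simp]: "egf (\<lambda>j. 0) s = 0"
  by (simp add: egf_def)

lemma egf_at_0 [simp]: "egf \<alpha> 0 = \<alpha> 0"
proof -
  have "egf \<alpha> 0 = (\<Sum>j. if j = 0 then \<alpha> 0 else 0)"
    unfolding egf_def by (intro suminf_cong) auto
  then show ?thesis using suminf_finite[of "{0}" "\<lambda>j. if j = 0 then \<alpha> 0 else 0"] by simp
qed

lemma egf_has_vector_derivative: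
  assumes g: "exp_type \<alpha>"
  shows "(egf \<alpha> has_vector_derivative egf (\<lambda>j. \<alpha> (Suc j)) s) (at s)"
  unfolding has_vector_derivative_def has_derivative_componentwise_within[of "egf \<alpha>"]
proof
  fix i :: 'a assume "i \<in> Basis"
  have lin: "linear (\<lambda>v::'a. v \<bullet> i)" by (rule linearI) (auto simp: inner_add_left)
  define c where "c j = (\<alpha> j \<bullet> i) / fact j" for j
  have eq: "egf \<alpha> x \<bullet> i = (\<Sum>j. c j * x ^ j)" for x
    unfolding egf_linear[OF lin g] by (simp add: egf_def c_def mult_ac)
  have eq': "egf (\<lambda>j. \<alpha> (Suc j)) s \<bullet> i = (\<Sum>j. diffs c j * s ^ j)"
  proof -
    have "diffs c j = (\<alpha> (Suc j) \<bullet> i) / fact j" for j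
      by (simp add: c_def diffs_def fact_Suc del: of_nat_Suc)
    then show ?thesis
      unfolding egf_linear[OF lin exp_type_Suc[OF g]] by (simp add: egf_def mult_ac)
  qed
  have "((\<lambda>x. \<Sum>j. c j * x ^ j) has_field_derivative (\<Sum>j. diffs c j * s ^ j)) (at s)"
  proof (rule termdiffs_strong_converges_everywhere)
    fix y :: real
    show "summable (\<lambda>j. c j * y ^ j)"
      using egf_summable[OF exp_type_linear[OF lin g], of y] by (simp add: c_def mult_ac)
  qed
  then show "((\<lambda>x. egf \<alpha> x \<bullet> i) has_derivative (\<lambda>x. (x *\<^sub>R egf (\<lambda>j. \<alpha> (Suc j)) s) \<bullet> i)) (at s)"
    by (simp add: eq eq' has_field_derivative_def mult_commute_abs)
qed

text \<open>
  \<open>b\<close>, \<open>a\<close>, \<open>k\<close> stand for \<open>B\<^sup>T\<close>, \<open>A\<^sup>T - \<mu>\<close>, \<open>K\<^sup>T\<close>. The map \<open>J\<close> is the projection onto the hyperbolic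
  components and \<open>di\<close> inverts \<open>b\<close> on the parabolic ones. Within the hyperbolic components, \<open>Pi\<close> is the
  projection onto the kernel of the compression \<open>J a\<close>, and \<open>G\<close> inverts it on the complement.
\<close>

locale hyperbolic_branch =
  fixes b a k di J G Pi :: "'x::euclidean_space \<Rightarrow> 'x"
  assumes lin: "linear b" "linear a" "linear k" "linear di" "linear J" "linear G" "linear Pi"
    and b_di: "b (di x) = x - J x"
    and b_J: "b (J x) = 0"
    and J_J: "J (J x) = J x" and J_G: "J (G x) = G x" and J_Pi: "J (Pi x) = Pi x"
    and Pi_J: "Pi (J x) = Pi x" and Pi_Pi: "Pi (Pi x) = Pi x"
    and aG: "J (a (G x)) = J x - Pi x"
    and aPi: "J (a (Pi x)) = 0"
begin

text \<open>
  The part of the recursion that the next coefficient \<open>d\<close> has to compensate by \<open>b d\<close>.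
\<close>

definition r :: "(nat \<Rightarrow> 'x) \<Rightarrow> (nat \<Rightarrow> 'x) \<Rightarrow> nat \<Rightarrow> 'x" where
  "r c' c j = a (c j) + c' (Suc j) - k (c' j)"

text \<open>
  The hyperbolic part of the following defect, if only the parabolic part \<open>- di (r c' c)\<close> of the next
  coefficient is taken into account.
\<close>

definition R :: "(nat \<Rightarrow> 'x) \<Rightarrow> (nat \<Rightarrow> 'x) \<Rightarrow> nat \<Rightarrow> 'x" where
  "R c' c j = J (c (Suc j) - a (di (r c' c j)) - k (c j))"

text \<open>
  Two consecutive coefficients can be continued by one more step: the defect is in the range of \<open>b\<close>,
  and the hyperbolic part of the following defect is in the range of the compression of \<open>a\<close>. The second
  condition is a differential equation for the kernel component of \<open>c\<close>, as \<open>R\<close> contains the derivative of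
  \<open>c\<close>.
\<close>

definition solvable :: "(nat \<Rightarrow> 'x) \<Rightarrow> (nat \<Rightarrow> 'x) \<Rightarrow> bool" where
  "solvable c' c \<longleftrightarrow> exp_type c' \<and> exp_type c \<and> (\<forall>j. J (r c' c j) = 0) \<and> (\<forall>j. Pi (R c' c j) = 0)"

lemmas ladd = lin[THEN linear_add]
lemmas ldiff = lin[THEN linear_diff]
lemmas lscale = lin[THEN linear_scale]
lemmas lneg = lin[THEN linear_neg]
lemmas lzero = lin[THEN linear_0]
lemmas exp_type_lin = lin[THEN exp_type_linear]

lemma linear_Gamma: "linear (\<lambda>x. Pi (a (di (a x)) + k x))"
  by (rule linearI) (simp_all add: ladd lscale algebra_simps)

lemma exp_type_r: "exp_type c' \<Longrightarrow> exp_type c \<Longrightarrow> exp_type (r c' c)"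
  unfolding r_def by (intro exp_type_add exp_type_diff exp_type_lin exp_type_Suc)

lemma solvable_init:
  assumes e: "Pi e = e"
  shows "\<exists>c. solvable (\<lambda>j. 0) c \<and> c 0 = e \<and> (\<forall>j. b (c j) = 0)"
proof -
  define h where "h = rec_nat e (\<lambda>_ x. Pi (a (di (a x)) + k x))"
  have h0: "h 0 = e" and hS: "h (Suc j) = Pi (a (di (a (h j))) + k (h j)) + 0" for j
    by (simp_all add: h_def)
  have gh: "exp_type h"
    by (rule exp_type_recursion[where L = "\<lambda>x. Pi (a (di (a x)) + k x)" and \<beta> = "\<lambda>j. 0"])
      (rule linear_Gamma exp_type_zero hS)+
  have Ph: "Pi (h j) = h j" for j by (cases j) (simp_all add: h0 e hS Pi_Pi)
  have Jah: "J (a (h j)) = 0" for j using aPi[of "h j"] by (simp add: Ph)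
  have bh: "b (h j) = 0" for j by (metis Ph J_Pi b_J)
  have "Pi (R (\<lambda>j. 0) h j) = 0" for j
    unfolding R_def Pi_J r_def by (simp add: ldiff lzero ladd Ph hS Pi_Pi)
  then have "solvable (\<lambda>j. 0) h"
    unfolding solvable_def by (auto simp: exp_type_zero gh r_def lzero Jah)
  then show ?thesis using h0 bh by blast
qed

text \<open>
  The next coefficient is \<open>- di r - G R + h\<close>: the first term solves the recursion, the second one makes
  the next defect purely parabolic, and \<open>h\<close>, with values in the range of \<open>Pi\<close>, solves the differential
  equation that makes the step after it possible.
\<close>

lemma solvable_step:
  assumes s: "solvable c' c" and e: "Pi e = e" "e \<noteq> 0"
  shows "\<exists>d. solvable c d \<and> (\<forall>j. b (d j) + r c' c j = 0) \<and> e \<bullet> d 0 = 0"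
proof -
  have gc: "exp_type c'" "exp_type c" and Jr: "\<And>j. J (r c' c j) = 0" and PR: "\<And>j. Pi (R c' c j) = 0"
    using s by (auto simp: solvable_def)
  have gR: "exp_type (R c' c)" unfolding R_def by (intro exp_type_lin exp_type_diff exp_type_r exp_type_Suc gc)
  define p where "p j = - di (r c' c j) - G (R c' c j)" for j
  have gp: "exp_type p" unfolding p_def by (intro exp_type_diff exp_type_uminus exp_type_lin exp_type_r gc gR)
  define q where "q j = p (Suc j) - a (di (r c p j)) - k (p j)" for j
  have gq: "exp_type q" unfolding q_def by (intro exp_type_diff exp_type_lin exp_type_r exp_type_Suc gp gc)
  \<comment> \<open>The free initial value of the kernel component is used to make \<open>d 0\<close> orthogonal to \<open>e\<close>.\<close>
  define h where "h = rec_nat (- (e \<bullet> p 0 / (e \<bullet> e)) *\<^sub>R e) (\<lambda>j x. Pi (a (di (a x)) + k x) - Pi (q j))"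
  have h0: "h 0 = - (e \<bullet> p 0 / (e \<bullet> e)) *\<^sub>R e"
    and hS: "h (Suc j) = Pi (a (di (a (h j))) + k (h j)) - Pi (q j)" for j
    by (simp_all add: h_def)
  have gh: "exp_type h"
    by (rule exp_type_recursion[where L = "\<lambda>x. Pi (a (di (a x)) + k x)" and \<beta> = "\<lambda>j. - Pi (q j)",
          OF linear_Gamma exp_type_uminus[OF exp_type_lin(7)[OF gq]]]) (simp add: hS)
  have Ph: "Pi (h j) = h j" for j
    by (cases j) (simp_all add: h0 e lscale lneg hS Pi_Pi ldiff)
  have Jah: "J (a (h j)) = 0" for j using aPi[of "h j"] by (simp add: Ph)
  have bh: "b (h j) = 0" for j by (metis Ph J_Pi b_J)
  have bG: "b (G x) = 0" for x by (metis J_G b_J)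
  define d where "d j = p j + h j" for j
  have gd: "exp_type d" unfolding d_def by (intro exp_type_add gp gh)
  have bd: "b (d j) + r c' c j = 0" for j
    by (simp add: d_def p_def ladd ldiff lneg b_di bh bG Jr)
  have JR: "J (R c' c j) = R c' c j" for j by (simp add: R_def J_J)
  have "J (r c d j) = 0" for j
  proof -
    have "J (r c d j) = R c' c j - J (a (G (R c' c j))) + J (a (h j))"
      unfolding r_def[of c d] R_def[of c' c j] d_def p_def
      by (simp add: ladd ldiff lneg algebra_simps)
    then show ?thesis by (simp add: aG JR PR Jah)
  qed
  moreover have "Pi (R c d j) = 0" for j
  proof -
    have "r c d j = r c p j + a (h j)" by (simp add: r_def d_def ladd)
    then have "Pi (R c d j) = Pi (q j) + Pi (h (Suc j)) - Pi (a (di (a (h j))) + k (h j))"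
      unfolding R_def Pi_J q_def by (simp add: d_def ladd ldiff)
    then show ?thesis by (simp add: hS ldiff Pi_Pi)
  qed
  ultimately have "solvable c d" using gc gd by (simp add: solvable_def)
  moreover have "e \<bullet> d 0 = 0" using e(2) by (simp add: d_def h0 inner_add_right inner_diff_right)
  ultimately show ?thesis using bd by blast
qed

text \<open>
  The normalisation \<open>e \<bullet> c (Suc q) 0 = 0\<close> will reduce the pairing of the wave with the initial datum to
  its leading term.
\<close>

lemma formal_solution:
  assumes e: "Pi e = e" "e \<noteq> 0"
  obtains c c' :: "nat \<Rightarrow> real \<Rightarrow> 'x" where
    "\<And>q s. (c q has_vector_derivative c' q s) (at s)"
    "c 0 0 = e" "\<And>q. e \<bullet> c (Suc q) 0 = 0"
    "\<And>s. b (c 0 s) = 0" "\<And>s. b (c 1 s) + a (c 0 s) = 0"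
    "\<And>q s. b (c (Suc (Suc q)) s) + a (c (Suc q) s) + c' q s - k (c q s) = 0"
proof -
  define init where "init x \<longleftrightarrow> fst x = (\<lambda>j. 0) \<and> snd x 0 = e \<and> (\<forall>j. b (snd x j) = 0)"
    for x :: "(nat \<Rightarrow> 'x) \<times> (nat \<Rightarrow> 'x)"
  have "\<exists>f. \<forall>n. (solvable (fst (f n)) (snd (f n)) \<and> (n = 0 \<longrightarrow> init (f n))) \<and>
     (fst (f (Suc n)) = snd (f n) \<and> (\<forall>j. b (snd (f (Suc n)) j) + r (fst (f n)) (snd (f n)) j = 0)
      \<and> e \<bullet> snd (f (Suc n)) 0 = 0)"
  proof (rule dependent_nat_choice)
    obtain c where "solvable (\<lambda>j. 0) c" "c 0 = e" "\<forall>j. b (c j) = 0"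
      using solvable_init[OF e(1)] by blast
    then show "\<exists>x. solvable (fst x) (snd x) \<and> (0 = (0::nat) \<longrightarrow> init x)"
      by (intro exI[of _ "(\<lambda>j. 0, c)"]) (simp add: init_def)
  next
    fix x :: "(nat \<Rightarrow> 'x) \<times> (nat \<Rightarrow> 'x)" and n :: nat
    assume "solvable (fst x) (snd x) \<and> (n = 0 \<longrightarrow> init x)"
    then obtain d where "solvable (snd x) d" "\<forall>j. b (d j) + r (fst x) (snd x) j = 0" "e \<bullet> d 0 = 0"
      using solvable_step[OF _ e] by blast
    then show "\<exists>y. (solvable (fst y) (snd y) \<and> (Suc n = 0 \<longrightarrow> init y)) \<and>
       (fst y = snd x \<and> (\<forall>j. b (snd y j) + r (fst x) (snd x) j = 0) \<and> e \<bullet> snd y 0 = 0)"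
      by (intro exI[of _ "(snd x, d)"]) simp
  qed
  then obtain f where f: "\<And>n. solvable (fst (f n)) (snd (f n))" "init (f 0)"
    "\<And>n. fst (f (Suc n)) = snd (f n)"
    "\<And>n j. b (snd (f (Suc n)) j) + r (fst (f n)) (snd (f n)) j = 0"
    "\<And>n. e \<bullet> snd (f (Suc n)) 0 = 0" by blast
  define g where "g n = snd (f n)" for n
  have exp_type: "exp_type (g n)" for n using f(1) by (simp add: g_def solvable_def)
  have g0: "g 0 0 = e" "\<And>j. b (g 0 j) = 0" using f(2) by (auto simp: g_def init_def)
  have g1: "b (g 1 j) + a (g 0 j) = 0" for j
    using f(4)[of 0 j] f(2) by (simp add: g_def init_def r_def lzero)
  have g2: "b (g (Suc (Suc q)) j) + a (g (Suc q) j) + g q (Suc j) - k (g q j) = 0" for q j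
    using f(4)[of "Suc q" j] by (simp add: g_def r_def f(3) algebra_simps)
  have eg: "egf (\<lambda>j. 0 :: 'x) s = 0" for s by simp
  show ?thesis
  proof (rule that[of "\<lambda>q. egf (g q)" "\<lambda>q. egf (\<lambda>j. g q (Suc j))"])
    show "(egf (g q) has_vector_derivative egf (\<lambda>j. g q (Suc j)) s) (at s)" for q s
      by (rule egf_has_vector_derivative[OF exp_type])
    show "egf (g 0) 0 = e" by (simp add: g0)
    show "e \<bullet> egf (g (Suc q)) 0 = 0" for q using f(5) by (simp add: g_def)
    show "b (egf (g 0) s) = 0" for s by (simp add: egf_linear[OF lin(1) exp_type] g0)
    show "b (egf (g 1) s) + a (egf (g 0) s) = 0" for s
      unfolding egf_linear[OF lin(1) exp_type] egf_linear[OF lin(2) exp_type]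
      by (subst egf_add[symmetric]) (intro exp_type_lin exp_type, intro exp_type_lin exp_type, simp only: g1 egf_zero)
    show "b (egf (g (Suc (Suc q))) s) + a (egf (g (Suc q)) s) + egf (\<lambda>j. g q (Suc j)) s - k (egf (g q) s) = 0"
      for q s
    proof -
      have "b (egf (g (Suc (Suc q))) s) + a (egf (g (Suc q)) s) + egf (\<lambda>j. g q (Suc j)) s - k (egf (g q) s)
        = egf (\<lambda>j. b (g (Suc (Suc q)) j) + a (g (Suc q) j) + g q (Suc j) - k (g q j)) s"
        unfolding egf_linear[OF lin(1) exp_type] egf_linear[OF lin(2) exp_type] egf_linear[OF lin(3) exp_type]
        by (simp add: egf_add egf_diff exp_type_add exp_type_linear[OF lin(1)] exp_type_linear[OF lin(2)]
            exp_type_linear[OF lin(3)] exp_type exp_type_Suc)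
      then show ?thesis by (simp only: g2 egf_zero)
    qed
  qed
qed

end

section \<open>Spectra, and the hyperbolic branch of slowest speed\<close>

text \<open>
  Spectra are defined with complex eigenvectors of real matrices.
\<close>

definition cmat :: "real ^ 'n ^ 'm \<Rightarrow> complex ^ 'n ^ 'm" where
  "cmat M = map_matrix complex_of_real M"

lemma cmat_nth [simp]: "cmat M $ i $ j = complex_of_real (M $ i $ j)"
  by (simp add: cmat_def map_matrix_def)

lemma cmat_mult:
  fixes M :: "real ^ 'n::finite ^ 'm::finite" and N :: "real ^ 'k::finite ^ 'n"
  shows "cmat (M ** N) = cmat M ** cmat N"
  by (simp add: vec_eq_iff matrix_matrix_mult_def)

lemma cmat_one: "cmat (mat 1 :: real ^ 'n::finite ^ 'n) = mat 1"
  by (simp add: vec_eq_iff mat_def)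

lemma Sp_iff: "l \<in> Sp M \<longleftrightarrow> (\<exists>v. v \<noteq> 0 \<and> cmat M *v v = l *s v)"
  by (simp add: Sp_def cmat_def)

lemma invertible_if_Sp_positive:
  fixes D :: "real ^ 'p::finite ^ 'p"
  assumes "\<forall>l\<in>Sp D. Re l > 0"
  shows "invertible D"
proof -
  have "x = 0" if x: "D *v x = 0" for x
  proof (rule ccontr)
    assume "x \<noteq> 0"
    define v :: "complex ^ 'p" where "v = (\<chi> i. of_real (x $ i))"
    have "v \<noteq> 0" using \<open>x \<noteq> 0\<close> by (auto simp: v_def vec_eq_iff)
    moreover have "cmat D *v v = 0 *s v"
    proof -
      have "(cmat D *v v) $ i = of_real ((D *v x) $ i)" for i
        by (simp add: matrix_vector_mult_def v_def)
      then show ?thesis by (simp add: vec_eq_iff x)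
    qed
    ultimately have "0 \<in> Sp D" unfolding Sp_iff by blast
    then show False using assms by force
  qed
  then show ?thesis by (metis invertible_left_inverse matrix_left_invertible_ker)
qed

lemma matrix_inv_mult:
  fixes A :: "real ^ 'n::finite ^ 'n"
  assumes "invertible A"
  shows "A ** matrix_inv A = mat 1" "matrix_inv A ** A = mat 1"
  using someI_ex[OF assms[unfolded invertible_def]] by (auto simp: matrix_inv_def)

text \<open>
  The spectrum of a real diagonalizable matrix is the set of the diagonal entries of its
  diagonal form, so the minimum that defines the speed is attained by a real eigenvalue.
\<close>

lemma min_speed_attained:
  fixes A' :: "real ^ 'h::finite ^ 'h"
  assumes dg: "diagonalizable A'"
  obtains P \<Delta> :: "real ^ 'h ^ 'h" and i where "invertible P" "\<And>i j. i \<noteq> j \<Longrightarrow> \<Delta> $ i $ j = 0"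
    "A' = P ** \<Delta> ** matrix_inv P" "min_speed A' = \<bar>\<Delta> $ i $ i\<bar>"
proof -
  obtain P \<Delta> :: "real ^ 'h ^ 'h" where P: "invertible P" and \<Delta>: "\<And>i j. i \<noteq> j \<Longrightarrow> \<Delta> $ i $ j = 0"
    and A': "A' = P ** \<Delta> ** matrix_inv P"
    using dg unfolding diagonalizable_def by blast
  let ?I = "matrix_inv P"
  have PI: "P ** ?I = mat 1" "?I ** P = mat 1" using matrix_inv_mult[OF P] by auto
  have cPI: "cmat P ** cmat ?I = mat 1" "cmat ?I ** cmat P = mat 1"
    by (simp_all add: PI cmat_one flip: cmat_mult)
  have c\<Delta>: "(cmat \<Delta> *v w) $ i = of_real (\<Delta> $ i $ i) * w $ i" for w i
  proof -
    have "(cmat \<Delta> *v w) $ i = (\<Sum>j\<in>UNIV. if j = i then of_real (\<Delta> $ i $ i) * w $ i else 0)"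
      unfolding matrix_vector_mult_def by (simp only: vec_lambda_beta, rule sum.cong) (use \<Delta> in auto)
    then show ?thesis by simp
  qed
  have sub: "Sp A' \<subseteq> range (\<lambda>i. of_real (\<Delta> $ i $ i))"
  proof
    fix l assume "l \<in> Sp A'"
    then obtain v where v: "v \<noteq> 0" "cmat A' *v v = l *s v" by (auto simp: Sp_iff)
    define w where "w = cmat ?I *v v"
    have vw: "v = cmat P *v w" by (simp add: w_def matrix_vector_mul_assoc cPI)
    have "w \<noteq> 0" using v(1) vw by auto
    then obtain i where i: "w $ i \<noteq> 0" by (auto simp: vec_eq_iff)
    have "cmat ?I ** cmat A' = cmat \<Delta> ** cmat ?I"
      by (simp add: A' PI matrix_mul_assoc flip: cmat_mult)
    then have "cmat \<Delta> *v w = cmat ?I *v (cmat A' *v v)" by (simp add: w_def matrix_vector_mul_assoc)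
    also have "\<dots> = l *s w" by (simp add: v(2) w_def vector_scalar_commute)
    finally have "of_real (\<Delta> $ i $ i) * w $ i = l * w $ i" using c\<Delta>[of w i] by auto
    then show "l \<in> range (\<lambda>i. of_real (\<Delta> $ i $ i))" using i by auto
  qed
  have mem: "of_real (\<Delta> $ i $ i) \<in> Sp A'" for i
  proof -
    define x :: "complex ^ 'h" where "x = axis i 1"
    have "cmat \<Delta> *v x = of_real (\<Delta> $ i $ i) *s x"
      unfolding vec_eq_iff c\<Delta> by (simp add: x_def axis_def)
    then have "cmat A' *v (cmat P *v x) = of_real (\<Delta> $ i $ i) *s (cmat P *v x)"
      by (simp add: A' cmat_mult matrix_vector_mul_assoc[symmetric] vector_scalar_commute)
         (simp add: matrix_vector_mul_assoc matrix_mul_assoc cPI vector_scalar_commute)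
    moreover have "cmat P *v x \<noteq> 0"
    proof
      assume "cmat P *v x = 0"
      then have "cmat ?I *v (cmat P *v x) = 0" by simp
      then have "x = 0" by (simp add: matrix_vector_mul_assoc cPI)
      then show False by (simp add: x_def)
    qed
    ultimately show ?thesis unfolding Sp_iff by blast
  qed
  have fin: "finite (cmod ` Sp A')" using finite_subset[OF sub] by simp
  have ne: "cmod ` Sp A' \<noteq> {}" using mem by blast
  have "min_speed A' \<in> cmod ` Sp A'" unfolding min_speed_def by (rule Min_in[OF fin ne])
  then obtain i where "min_speed A' = \<bar>\<Delta> $ i $ i\<bar>" using sub by auto
  then show ?thesis using that[OF P \<Delta> A'] by blast
qed

lemma block_projections [simp]:
  "proj_hyp (inj_hyp y :: real ^ ('h::finite + 'p::finite)) = y" "proj_par (inj_hyp y :: real ^ ('h + 'p)) = 0"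
  "proj_hyp (inj_par z :: real ^ ('h + 'p)) = 0" "proj_par (inj_par z :: real ^ ('h + 'p)) = z"
  by (simp_all add: vec_eq_iff inj_hyp_def inj_par_def proj_hyp_def proj_par_def)

lemma transpose_parabolic:
  "transpose (block_matrix 0 0 0 D :: real ^ ('h::finite + 'p::finite) ^ ('h + 'p)) = block_matrix 0 0 0 (transpose D)"
  unfolding vec_eq_iff by (auto simp: transpose_def block_matrix_def split: sum.split)

lemma proj_hyp_transpose_block:
  "proj_hyp (transpose (block_matrix A' A12 A21 A22 :: real ^ ('h::finite + 'p::finite) ^ ('h + 'p)) *v inj_hyp y)
    = transpose A' *v y"
  by (simp add: vec_eq_iff proj_hyp_def inj_hyp_def matrix_vector_mult_def transpose_def block_matrix_def sum_UNIV_sum)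

text \<open>
  In the eigenbasis of \<open>A'\<^sup>T\<close> the projection \<open>Pi\<close> and the partial inverse \<open>G\<close> multiply the coordinates by
  functions of the eigenvalue, which is how they are defined here (\<open>mult\<close>).
\<close>

lemma adjoint_profiles:
  fixes D :: "real ^ 'p::finite ^ 'p" and A' :: "real ^ 'h::finite ^ 'h"
    and A B K :: "real ^ ('h + 'p) ^ ('h + 'p)"
  assumes D: "\<forall>l\<in>Sp D. Re l > 0"
    and B: "B = block_matrix 0 0 0 D" and A: "A = block_matrix A' A12 A21 A22"
    and dg: "diagonalizable A'"
  obtains \<mu> e and c c' :: "nat \<Rightarrow> real \<Rightarrow> real ^ ('h + 'p)" where
    "\<bar>\<mu>\<bar> = min_speed A'" "e \<noteq> 0"
    "\<And>q s. (c q has_vector_derivative c' q s) (at s)"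
    "c 0 0 = e" "\<And>q. e \<bullet> c (Suc q) 0 = 0"
    "\<And>s. transpose B *v c 0 s = 0"
    "\<And>s. transpose B *v c 1 s + (transpose A *v c 0 s - \<mu> *\<^sub>R c 0 s) = 0"
    "\<And>q s. transpose B *v c (Suc (Suc q)) s + (transpose A *v c (Suc q) s - \<mu> *\<^sub>R c (Suc q) s)
       + c' q s - transpose K *v c q s = 0"
proof -
  obtain P \<Delta> :: "real ^ 'h ^ 'h" and i0 where P: "invertible P" and \<Delta>: "\<And>i j. i \<noteq> j \<Longrightarrow> \<Delta> $ i $ j = 0"
    and A': "A' = P ** \<Delta> ** matrix_inv P" and i0: "min_speed A' = \<bar>\<Delta> $ i0 $ i0\<bar>"
    by (rule min_speed_attained[OF dg]) blast
  define \<mu> where "\<mu> = \<Delta> $ i0 $ i0"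
  define U W where "U = transpose P" and "W = transpose (matrix_inv P)"
  have UW: "U ** W = mat 1" "W ** U = mat 1"
    using matrix_inv_mult[OF P] unfolding U_def W_def by (simp_all flip: matrix_transpose_mul)
  define mult where "mult f y = W *v (\<chi> i. f i * (U *v y) $ i)" for f y
  have mult_mult: "mult f (mult g y) = mult (\<lambda>i. f i * g i) y" for f g y
    by (simp add: mult_def matrix_vector_mul_assoc UW mult.assoc)
  have mult_1: "mult (\<lambda>i. 1) y = y" for y
    by (simp add: mult_def matrix_vector_mul_assoc UW)
  have mult_diff: "mult f y - mult g y = mult (\<lambda>i. f i - g i) y" for f g y
    unfolding mult_def matrix_vector_mult_diff_distrib[symmetric]
    by (rule arg_cong[where f = "(*v) W"]) (simp add: vec_eq_iff algebra_simps)
  have mult_scale: "\<mu> *\<^sub>R mult f y = mult (\<lambda>i. \<mu> * f i) y" for f y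
    unfolding mult_def matrix_vector_mult_scaleR[symmetric]
    by (rule arg_cong[where f = "(*v) W"]) (simp add: vec_eq_iff)
  have mult_lin: "linear (mult f)" for f
  proof (rule linearI)
    show "mult f (x + y) = mult f x + mult f y" for x y
      unfolding mult_def matrix_vector_right_distrib[symmetric]
      by (rule arg_cong[where f = "(*v) W"]) (simp add: vec_eq_iff matrix_vector_right_distrib algebra_simps)
    show "mult f (r *\<^sub>R x) = r *\<^sub>R mult f x" for r x
      unfolding mult_def matrix_vector_mult_scaleR[symmetric]
      by (rule arg_cong[where f = "(*v) W"]) (simp add: vec_eq_iff matrix_vector_mult_scaleR)
  qed
  have At: "transpose A' *v y = mult (\<lambda>i. \<Delta> $ i $ i) y" for y
  proof -
    have "transpose \<Delta> = \<Delta>" unfolding vec_eq_iff transpose_def by (simp, metis \<Delta>)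
    then have "transpose A' = W ** (\<Delta> ** U)" unfolding A' W_def U_def by (simp add: matrix_transpose_mul)
    moreover have "\<Delta> *v z = (\<chi> i. \<Delta> $ i $ i * z $ i)" for z
    proof -
      have "(\<Delta> *v z) $ i = (\<Sum>j\<in>UNIV. if j = i then \<Delta> $ i $ i * z $ i else 0)" for i
        unfolding matrix_vector_mult_def by (simp only: vec_lambda_beta, rule sum.cong) (use \<Delta> in auto)
      then show ?thesis by (simp add: vec_eq_iff)
    qed
    ultimately show ?thesis by (simp add: mult_def flip: matrix_vector_mul_assoc)
  qed
  define \<chi>0 where "\<chi>0 i = (if \<Delta> $ i $ i = \<mu> then 1 else 0 :: real)" for i
  define g0 where "g0 i = (if \<Delta> $ i $ i = \<mu> then 0 else 1 / (\<Delta> $ i $ i - \<mu>))" for i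
  define J where "J = (\<lambda>x :: real ^ ('h + 'p). inj_hyp (proj_hyp x) :: real ^ ('h + 'p))"
  define Pi where "Pi = (\<lambda>x :: real ^ ('h + 'p). inj_hyp (mult \<chi>0 (proj_hyp x)) :: real ^ ('h + 'p))"
  define G where "G = (\<lambda>x :: real ^ ('h + 'p). inj_hyp (mult g0 (proj_hyp x)) :: real ^ ('h + 'p))"
  define di where "di = (\<lambda>x :: real ^ ('h + 'p). inj_par (matrix_inv (transpose D) *v proj_par x) :: real ^ ('h + 'p))"
  define b where "b = (\<lambda>x. transpose B *v x)"
  define a where "a = (\<lambda>x. transpose A *v x - \<mu> *\<^sub>R x)"
  define k where "k = (\<lambda>x. transpose K *v x)"
  have invD: "transpose D ** matrix_inv (transpose D) = mat 1"
    by (rule matrix_inv_mult(1)[OF transpose_invertible[OF invertible_if_Sp_positive[OF D]]])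
  have b: "b x = inj_par (transpose D *v proj_par x)" for x
    unfolding b_def B transpose_parabolic block_matrix_mult_parabolic ..
  have Ja: "J (a (inj_hyp y)) = inj_hyp (mult (\<lambda>i. \<Delta> $ i $ i - \<mu>) y)" for y
  proof -
    have "proj_hyp (a (inj_hyp y)) = transpose A' *v y - \<mu> *\<^sub>R y"
      unfolding a_def A
      by (simp only: linear_diff[OF linear_blocks(3)] linear_scale[OF linear_blocks(3)]
          proj_hyp_transpose_block block_projections)
    also have "\<dots> = mult (\<lambda>i. \<Delta> $ i $ i) y - \<mu> *\<^sub>R mult (\<lambda>i. 1) y" by (simp only: At mult_1)
    also have "\<dots> = mult (\<lambda>i. \<Delta> $ i $ i - \<mu>) y" by (simp add: mult_scale mult_diff)
    finally show ?thesis by (simp add: J_def)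
  qed
  have lin_comp: "linear (\<lambda>x. f (g x))" if "linear f" "linear g" for f :: "real ^ 'a::finite \<Rightarrow> real ^ 'b::finite" and g :: "real ^ 'c::finite \<Rightarrow> real ^ 'a"
    using linear_compose[OF that(2,1)] by (simp add: o_def)
  have lins: "linear b" "linear a" "linear k" "linear di" "linear J" "linear G" "linear Pi"
    unfolding b_def a_def k_def di_def J_def G_def Pi_def
    by (intro matrix_vector_mul_linear linear_compose_sub linear_scaleR
        lin_comp[OF linear_blocks(2) lin_comp[OF matrix_vector_mul_linear linear_blocks(4)]]
        lin_comp[OF linear_blocks(1) linear_blocks(3)]
        lin_comp[OF linear_blocks(1) lin_comp[OF mult_lin linear_blocks(3)]])+
  interpret hyperbolic_branch b a k di J G Pi
  proof (rule hyperbolic_branch.intro)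
    fix x
    show "b (di x) = x - J x"
    proof -
      have "b (di x) = inj_par (proj_par x)" by (simp add: b di_def matrix_vector_mul_assoc invD)
      then show ?thesis using blocks_decompose[of x] by (simp add: J_def algebra_simps)
    qed
    show "b (J x) = 0" by (simp add: b J_def linear_0)
    show "J (J x) = J x" "J (G x) = G x" "J (Pi x) = Pi x" "Pi (J x) = Pi x"
      by (simp_all add: J_def G_def Pi_def)
    show "Pi (Pi x) = Pi x"
    proof -
      have "(\<lambda>i. \<chi>0 i * \<chi>0 i) = \<chi>0" by (auto simp: \<chi>0_def)
      then show ?thesis by (simp add: Pi_def mult_mult)
    qed
    show "J (a (G x)) = J x - Pi x"
    proof -
      have "(\<lambda>i. (\<Delta> $ i $ i - \<mu>) * g0 i) = (\<lambda>i. 1 - \<chi>0 i)" by (auto simp: g0_def \<chi>0_def)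
      then have "J (a (G x)) = inj_hyp (mult (\<lambda>i. 1) (proj_hyp x) - mult \<chi>0 (proj_hyp x))"
        by (simp add: G_def Ja mult_mult mult_diff)
      then show ?thesis by (simp add: mult_1 J_def Pi_def linear_diff)
    qed
    show "J (a (Pi x)) = 0"
    proof -
      have "(\<lambda>i. (\<Delta> $ i $ i - \<mu>) * \<chi>0 i) = (\<lambda>i. 0)" by (auto simp: \<chi>0_def)
      moreover have "mult (\<lambda>i. 0) y = 0" for y by (simp add: mult_def flip: zero_vec_def)
      ultimately show ?thesis by (simp add: Pi_def Ja mult_mult linear_0)
    qed
  qed (rule lins)+
  define e where "e = (inj_hyp (W *v axis i0 1) :: real ^ ('h + 'p))"
  have Pe: "Pi e = e"
  proof -
    have "(\<chi> i. \<chi>0 i * axis i0 (1::real) $ i) = axis i0 1"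
      by (auto simp: vec_eq_iff axis_def \<chi>0_def \<mu>_def)
    then show ?thesis by (simp add: Pi_def e_def mult_def matrix_vector_mul_assoc UW)
  qed
  have e0: "e \<noteq> 0"
  proof
    assume "e = 0"
    then have "proj_hyp e = 0" by (simp add: linear_0)
    then have "U *v (W *v axis i0 1) = 0" by (simp add: e_def)
    then show False by (simp add: matrix_vector_mul_assoc UW)
  qed
  have \<mu>: "\<bar>\<mu>\<bar> = min_speed A'" by (simp add: i0 \<mu>_def)
  show ?thesis
  proof (rule formal_solution[OF Pe e0])
    fix c c'
    assume cc: "\<And>q s. (c q has_vector_derivative c' q s) (at s)"
      "c 0 0 = e" "\<And>q. e \<bullet> c (Suc q) 0 = 0"
      "\<And>s. b (c 0 s) = 0" "\<And>s. b (c 1 s) + a (c 0 s) = 0"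
      "\<And>q s. b (c (Suc (Suc q)) s) + a (c (Suc q) s) + c' q s - k (c q s) = 0"
    from that[OF \<mu> e0 cc(1-3) cc(4-6)[unfolded b_def a_def k_def]] show ?thesis .
  qed
qed

section \<open>Localised oscillating trigonometric polynomials\<close>

text \<open>
  The \<open>j\<close>-th derivative of \<open>exp (\<i> * n * z) * ((1 + cos (z - x0)) / 2) ^ R\<close>, as a finite Fourier sum.
  The sum gives the derivatives, the global bound and the Fourier coefficients; the product form
  (\<open>complex_packet_closed_form\<close>) gives the localisation.
\<close>

definition complex_packet :: "nat \<Rightarrow> nat \<Rightarrow> real \<Rightarrow> nat \<Rightarrow> complex \<Rightarrow> complex" where
  "complex_packet n R x0 j z = (\<Sum>l\<le>2*R. of_real (real ((2*R) choose l) / 4^R)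
     * ((\<i> * of_int (int n + int l - int R)) ^ j
        * exp (\<i> * (of_int (int n + int l - int R) * z - of_real (of_int (int l - int R) * x0)))))"

definition packet :: "nat \<Rightarrow> nat \<Rightarrow> real \<Rightarrow> nat \<Rightarrow> real \<Rightarrow> real" where
  "packet n R x0 j x = Re (complex_packet n R x0 j (of_real x))"

lemma complex_packet_derivative: "(complex_packet n R x0 j has_field_derivative complex_packet n R x0 (Suc j) z) (at z)"
  unfolding complex_packet_def by (auto intro!: derivative_eq_intros sum.cong)

lemma packet_derivative: "(packet n R x0 j has_real_derivative packet n R x0 (Suc j) x) (at x)"
proof -
  have "((\<lambda>x. complex_packet n R x0 j (of_real x)) has_vector_derivative complex_packet n R x0 (Suc j) (of_real x)) (at x)"
    by (rule has_vector_derivative_real_field[OF complex_packet_derivative])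
  then have "((\<lambda>x. Re (complex_packet n R x0 j (of_real x))) has_vector_derivative Re (complex_packet n R x0 (Suc j) (of_real x))) (at x)"
    by (rule bounded_linear.has_vector_derivative[OF bounded_linear_Re])
  then show ?thesis
    by (simp add: packet_def[abs_def] has_real_derivative_iff_has_vector_derivative)
qed

lemma packet_periodic: "packet n R x0 j (x + 2 * pi) = packet n R x0 j x"
proof -
  have "exp (\<i> * (of_int k * of_real (x + 2 * pi) - c)) = exp (\<i> * (of_int k * of_real x - c))" for k :: int and c :: complex
  proof -
    have "\<i> * (of_int k * of_real (x + 2 * pi) - c) = \<i> * (of_int k * of_real x - c) + of_int k * (2 * of_real pi * \<i>)"
      by (simp add: algebra_simps)
    moreover have "exp (of_int k * (2 * of_real pi * \<i>) :: complex) = 1"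
      using exp_integer_2pi[of "of_int k"] by (simp add: mult_ac)
    ultimately show ?thesis by (simp add: exp_add)
  qed
  then show ?thesis unfolding packet_def complex_packet_def by (simp only:)
qed

lemma sum_binomial_weights: "(\<Sum>l\<le>2*R. real ((2*R) choose l) / 4^R) = 1"
proof -
  have "(\<Sum>l\<le>2*R. real ((2*R) choose l)) = 2 ^ (2*R)"
    using choose_row_sum[of "2*R"] by (metis of_nat_sum of_nat_power of_nat_numeral)
  then show ?thesis by (simp add: power_mult flip: sum_divide_distrib)
qed

lemma packet_bound:
  assumes "R \<le> n"
  shows "\<bar>packet n R x0 j x\<bar> \<le> (real n + real R) ^ j"
proof -
  have "\<bar>packet n R x0 j x\<bar> \<le> norm (complex_packet n R x0 j (of_real x))"
    unfolding packet_def by (rule abs_Re_le_cmod)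
  also have "\<dots> \<le> (\<Sum>l\<le>2*R. real ((2*R) choose l) / 4^R * (real n + real R) ^ j)"
    unfolding complex_packet_def
  proof (rule sum_norm_le)
    fix l assume l: "l \<in> {..2*R}"
    let ?k = "int n + int l - int R"
    have e: "norm (exp (\<i> * (of_int ?k * of_real x - of_real (of_int (int l - int R) * x0)))) = 1"
      by (simp add: norm_exp_eq_Re)
    have "norm (\<i> * of_int ?k :: complex) = real_of_int \<bar>?k\<bar>" by (simp add: norm_mult del: of_int_diff of_int_add)
    also have "\<dots> \<le> real n + real R" using l assms by simp
    finally have "norm ((\<i> * of_int ?k :: complex) ^ j) \<le> (real n + real R) ^ j"
      unfolding norm_power by (intro power_mono) auto
    then have "norm (of_real (real ((2*R) choose l) / 4^R) :: complex) * (norm ((\<i> * of_int ?k :: complex) ^ j) * 1)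
        \<le> real ((2*R) choose l) / 4^R * (real n + real R) ^ j"
      by (simp only: norm_of_real mult_1_right) (intro mult_mono, auto)
    then show "norm (of_real (real ((2*R) choose l) / 4^R) * ((\<i> * of_int ?k) ^ j
      * exp (\<i> * (of_int ?k * of_real x - of_real (of_int (int l - int R) * x0)))) :: complex)
       \<le> real ((2*R) choose l) / 4^R * (real n + real R) ^ j"
      by (simp only: norm_mult e)
  qed
  also have "\<dots> = (\<Sum>l\<le>2*R. real ((2*R) choose l) / 4^R) * (real n + real R) ^ j"
    by (rule sum_distrib_right[symmetric])
  also have "\<dots> = (real n + real R) ^ j" by (simp only: sum_binomial_weights mult_1)
  finally show ?thesis .
qed

lemma complex_packet_closed_form:
  "complex_packet n R x0 0 z = exp (\<i> * (of_nat n * z)) * exp (- (\<i> * (of_nat R * (z - of_real x0))))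
     * ((1 + exp (\<i> * (z - of_real x0))) / 2) ^ (2*R)"
proof -
  define w where "w = z - of_real x0"
  define E where "E = exp (\<i> * w)"
  have tm: "exp (\<i> * (of_int (int n + int l - int R) * z - of_real (of_int (int l - int R) * x0)))
      = exp (\<i> * (of_nat n * z)) * exp (- (\<i> * (of_nat R * w))) * E ^ l" for l
  proof -
    have "E ^ l = exp (of_nat l * (\<i> * w))" by (simp add: E_def exp_of_nat_mult)
    then show ?thesis
      by (simp add: w_def algebra_simps flip: exp_add)
  qed
  have "complex_packet n R x0 0 z = (\<Sum>l\<le>2*R. of_nat ((2*R) choose l) * E ^ l) / 4 ^ R
      * (exp (\<i> * (of_nat n * z)) * exp (- (\<i> * (of_nat R * w))))"
    unfolding complex_packet_def tm by (simp add: sum_distrib_left sum_divide_distrib mult_ac sum_distrib_right)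
  also have "(\<Sum>l\<le>2*R. of_nat ((2*R) choose l) * E ^ l) = (1 + E) ^ (2*R)"
    using binomial_ring[of E 1 "2*R"] by (simp add: add.commute)
  also have "(1 + E) ^ (2*R) / 4 ^ R = ((1 + E) / 2) ^ (2*R)"
    by (simp add: power_divide power_mult)
  finally show ?thesis by (simp add: E_def w_def mult_ac)
qed

lemma iterated_deriv_complex_packet: "(deriv ^^ j) (complex_packet n R x0 0) = complex_packet n R x0 j"
proof (induction j)
  case (Suc j)
  have "deriv (complex_packet n R x0 j) = complex_packet n R x0 (Suc j)" by (rule ext, rule DERIV_imp_deriv, rule complex_packet_derivative)
  then show ?case using Suc by simp
qed simp

text \<open>
  The base \<open>(1 + exp (\<i> * w)) / 2\<close> of the power has modulus below 1 for real \<open>w\<close> away from 0, hence also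
  in a small complex neighbourhood. Cauchy's inequalities on circles of radius \<open>1 / n\<close> then bound all
  derivatives.
\<close>

lemma packet_small_off_support:
  assumes \<delta>: "0 < \<delta>" "\<delta> \<le> pi"
  obtains q n0 where "0 < q" "q < 1"
    "\<And>n R x0 j x. n \<ge> n0 \<Longrightarrow> R \<le> n \<Longrightarrow> cos (x - x0) \<le> cos \<delta> \<Longrightarrow>
       \<bar>packet n R x0 j x\<bar> \<le> fact j * exp 2 * real n ^ j * q ^ (2*R)"
proof -
  define q0 where "q0 = sqrt ((1 + cos \<delta>) / 2)"
  have cd: "cos \<delta> < 1" using cos_monotone_0_pi[of 0 \<delta>] \<delta> by simp
  have c1: "1 + cos \<delta> \<ge> 0" using cos_ge_minus_one[of \<delta>] by linarith
  have q0: "0 \<le> q0" "q0 < 1" using cd c1 by (auto simp: q0_def)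
  have "((\<lambda>u::complex. exp u) \<longlongrightarrow> exp 0) (at 0)" by (intro tendsto_intros)
  then have "eventually (\<lambda>u::complex. dist (exp u) (exp 0) < 1 - q0) (at 0)"
    using q0 by (auto simp: tendsto_iff)
  then obtain d where d: "d > 0" "\<And>u::complex. u \<noteq> 0 \<Longrightarrow> norm u < d \<Longrightarrow> norm (exp u - 1) < 1 - q0"
    by (auto simp: eventually_at dist_norm)
  have d': "norm (exp u - 1) \<le> 1 - q0" if "norm u < d" for u :: complex
    using d(2)[of u] that q0 by (cases "u = 0") auto
  obtain n0 :: nat where n0: "n0 > 0" "1 / real n0 < d"
    using reals_Archimedean[OF d(1)] by (metis inverse_eq_divide zero_less_Suc)
  define q where "q = (1 + q0) / 2"
  have q: "0 < q" "q < 1" using q0 by (auto simp: q_def)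
  show ?thesis
  proof (rule that[OF q])
    fix n R :: nat and x0 x :: real and j :: nat
    assume n: "n \<ge> n0" and R: "R \<le> n" and c: "cos (x - x0) \<le> cos \<delta>"
    have npos: "real n > 0" using n n0 by simp
    have rd: "1 / real n < d"
      using n n0 npos by (meson frac_le le_less_trans of_nat_0_less_iff of_nat_mono zero_le_one order_refl)
    have real_case: "norm (1 + exp (\<i> * of_real (x - x0))) \<le> 2 * q0"
    proof -
      have "(norm (1 + exp (\<i> * of_real (x - x0))))\<^sup>2 = 2 + 2 * cos (x - x0)"
        unfolding cmod_power2
        by (simp add: Re_exp Im_exp power2_eq_square algebra_simps)
      also have "\<dots> \<le> (2 * q0)\<^sup>2" using c c1 by (simp add: q0_def power_mult_distrib)
      finally show ?thesis using q0 by (auto intro: power2_le_imp_le)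
    qed
    have bound: "norm (complex_packet n R x0 0 z) \<le> exp 2 * q ^ (2*R)" if z: "norm (of_real x - z) = 1 / real n" for z
    proof -
      define h where "h = z - of_real x"
      have h: "norm h = 1 / real n" using z by (simp add: h_def norm_minus_commute)
      have im: "\<bar>Im h\<bar> \<le> 1 / real n" using abs_Im_le_cmod[of h] h by simp
      have Imz: "Im z = Im h" by (simp add: h_def)
      have e1: "norm (exp (\<i> * (of_nat n * z))) \<le> exp 1"
      proof -
        have "- (real n * Im z) \<le> real n * (1 / real n)"
          unfolding Imz using im npos by (metis abs_le_D2 minus_mult_right mult_left_mono less_imp_le)
        then show ?thesis using npos by (simp add: norm_exp_eq_Re Re_exp)
      qed
      have e2: "norm (exp (- (\<i> * (of_nat R * (z - of_real x0))))) \<le> exp 1"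
      proof -
        have "real R * Im z \<le> real R * \<bar>Im h\<bar>" unfolding Imz by (intro mult_left_mono) auto
        also have "\<dots> \<le> real n * (1 / real n)" using im R by (intro mult_mono) auto
        finally have "real R * Im z \<le> real n * (1 / real n)" .
        then show ?thesis using npos by (simp add: norm_exp_eq_Re)
      qed
      have e3: "norm ((1 + exp (\<i> * (z - of_real x0))) / 2) \<le> q"
      proof -
        have split: "exp (\<i> * (z - of_real x0)) = exp (\<i> * of_real (x - x0)) * exp (\<i> * h)"
          by (simp add: h_def algebra_simps flip: exp_add)
        have eq: "1 + exp (\<i> * (z - of_real x0)) = (1 + exp (\<i> * of_real (x - x0)))
            + exp (\<i> * of_real (x - x0)) * (exp (\<i> * h) - 1)"
          unfolding split by (simp add: algebra_simps)
        have "norm (1 + exp (\<i> * (z - of_real x0))) \<le> 2 * q0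
            + norm (exp (\<i> * of_real (x - x0)) * (exp (\<i> * h) - 1))"
          unfolding eq by (rule order_trans[OF norm_triangle_ineq add_right_mono[OF real_case]])
        also have "norm (exp (\<i> * of_real (x - x0)) * (exp (\<i> * h) - 1)) = norm (exp (\<i> * h) - 1)"
          by (simp add: norm_mult)
        also have "\<dots> \<le> 1 - q0" using d'[of "\<i> * h"] h rd by (simp add: norm_mult)
        finally show ?thesis by (simp add: q_def norm_divide)
      qed
      have "norm (complex_packet n R x0 0 z) \<le> exp 1 * exp 1 * q ^ (2*R)"
        unfolding complex_packet_closed_form norm_mult norm_power
        by (intro mult_mono power_mono e1 e2 e3 mult_nonneg_nonneg zero_le_power norm_ge_zero exp_ge_zero)
      also have "exp 1 * exp 1 = (exp 2 :: real)" by (simp flip: exp_add)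
      finally show ?thesis .
    qed
    \<comment> \<open>On the circle of radius \<open>1 / n\<close> the oscillating factor is still bounded, and \<open>j\<close> derivatives cost only \<open>n ^ j\<close>.\<close>
    have "norm ((deriv ^^ j) (complex_packet n R x0 0) (of_real x)) \<le> fact j * (exp 2 * q ^ (2*R)) / (1 / real n) ^ j"
    proof (rule Cauchy_inequality)
      have fd: "complex_packet n R x0 0 field_differentiable (at z)" for z
        using complex_packet_derivative field_differentiable_def by blast
      show "complex_packet n R x0 0 holomorphic_on ball (of_real x) (1 / real n)"
        by (simp add: holomorphic_on_def field_differentiable_at_within fd)
      show "continuous_on (cball (of_real x) (1 / real n)) (complex_packet n R x0 0)"
        by (intro continuous_at_imp_continuous_on ballI field_differentiable_imp_continuous_at fd)
    qed (use npos bound in auto)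
    also have "\<dots> = fact j * exp 2 * real n ^ j * q ^ (2*R)" by (simp add: power_divide)
    finally have "norm (complex_packet n R x0 j (of_real x)) \<le> fact j * exp 2 * real n ^ j * q ^ (2*R)"
      unfolding iterated_deriv_complex_packet .
    then show "\<bar>packet n R x0 j x\<bar> \<le> fact j * exp 2 * real n ^ j * q ^ (2*R)"
      unfolding packet_def using abs_Re_le_cmod order_trans by blast
  qed
qed

lemma integral_torus_deriv:
  fixes F :: "real \<Rightarrow> real"
  assumes F: "\<And>x. (F has_real_derivative f x) (at x)" and f: "continuous_on UNIV f"
  shows "(LINT x|torus. f x) = F (2 * pi) - F 0"
proof -
  have "(LINT x|torus. f x) = (LINT x|lborel. indicator {0..<2*pi} x *\<^sub>R f x)"
    unfolding torus_def by (subst integral_restrict_space) auto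
  also have "\<dots> = (LINT x|lborel. indicator {0..2*pi} x *\<^sub>R f x)"
  proof (rule integral_cong_AE)
    have "AE x in lborel. x \<noteq> 2 * pi" by (rule AE_lborel_singleton)
    then show "AE x in lborel. indicator {0..<2*pi} x *\<^sub>R f x = indicator {0..2*pi} x *\<^sub>R f x"
      by eventually_elim (auto simp: indicator_def)
  qed (use borel_measurable_continuous_onI[OF f] in auto)
  also have "\<dots> = F (2 * pi) - F 0"
    by (rule integral_FTC_Icc)
      (use F f in \<open>auto simp: has_real_derivative_iff_has_vector_derivative intro: has_vector_derivative_at_within continuous_on_subset\<close>)
  finally show ?thesis .
qed

lemma integral_torus_cos:
  "(LINT x|torus. cos (real_of_int k * x + b)) = (if k = 0 then 2 * pi * cos b else 0)"
proof (cases "k = 0")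
  case True
  then show ?thesis by (simp add: measure_torus)
next
  case False
  have "(LINT x|torus. cos (real_of_int k * x + b))
      = sin (real_of_int k * (2 * pi) + b) / of_int k - sin (real_of_int k * 0 + b) / of_int k"
    by (rule integral_torus_deriv) (use False in \<open>auto intro!: derivative_eq_intros continuous_intros\<close>)
  also have "sin (real_of_int k * (2 * pi) + b) = sin b"
    by (metis add.commute mult.commute mult.assoc sin_int_2pin cos_int_2pin sin_add mult_1_right mult_zero_right add_0_right)
  finally show ?thesis using False by simp
qed

lemma square_integrable_cos: "square_integrable (\<lambda>x. cos (c * x + b))"
  by (rule square_integrable_continuous) (intro continuous_intros)

lemma integral_torus_cos_cos:
  assumes "k + m \<noteq> 0"
  shows "(LINT x|torus. cos (real_of_int m * x + a) * cos (real_of_int k * x + b))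
     = (if k = m then pi * cos (a - b) else 0)"
proof -
  have int: "integrable torus (\<lambda>x. cos (c * x + b))" for c b
    using square_integrable_inner[OF square_integrable_cos[of c b] square_integrable_cos[of 0 0]] by simp
  have "cos (real_of_int m * x + a) * cos (real_of_int k * x + b)
     = (cos (real_of_int (m - k) * x + (a - b)) + cos (real_of_int (m + k) * x + (a + b))) / 2" for x
    unfolding cos_times_cos by (simp add: algebra_simps)
  then have "(LINT x|torus. cos (real_of_int m * x + a) * cos (real_of_int k * x + b))
     = (LINT x|torus. (cos (real_of_int (m - k) * x + (a - b)) + cos (real_of_int (m + k) * x + (a + b))) / 2)"
    by (simp only:)
  also have "\<dots> = ((LINT x|torus. cos (real_of_int (m - k) * x + (a - b))) + (LINT x|torus. cos (real_of_int (m + k) * x + (a + b)))) / 2"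
    by (simp only: integral_divide_zero Bochner_Integration.integral_add[OF int int])
  finally have "(LINT x|torus. cos (real_of_int m * x + a) * cos (real_of_int k * x + b))
     = ((LINT x|torus. cos (real_of_int (m - k) * x + (a - b))) + (LINT x|torus. cos (real_of_int (m + k) * x + (a + b)))) / 2" .
  then show ?thesis using assms by (simp only: integral_torus_cos) auto
qed

text \<open>
  The coefficient of frequency \<open>m\<close> of the packet is read off. For \<open>j\<close> divisible by 4 the \<open>j\<close>-th derivative
  multiplies it by \<open>m ^ j\<close> without a phase.
\<close>

lemma packet_pairing:
  assumes R: "R < n" and m: "m > 0" and j: "4 dvd j" and far: "m = n \<or> m < n - R \<or> m > n + R"
  shows "(LINT x|torus. cos (real m * x) * packet n R x0 j x)
     = (if m = n then pi * real n ^ j * (real ((2*R) choose R) / 4^R) else 0)"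
proof -
  have ij: "(\<i> * z) ^ j = z ^ j" for z :: complex
  proof -
    obtain t where "j = 4 * t" using j by (auto elim: dvdE)
    moreover have "\<i> ^ 4 = (1::complex)" by (simp add: power4_eq_xxxx)
    ultimately show ?thesis by (simp add: power_mult_distrib power_mult)
  qed
  define k where "k l = int n + int l - int R" for l
  define b where "b l = real ((2*R) choose l) / 4^R" for l
  define \<theta> where "\<theta> l = - (of_int (int l - int R) * x0)" for l
  have kpos: "k l > 0" for l using R by (simp add: k_def)
  have pf: "packet n R x0 j x = (\<Sum>l\<le>2*R. b l * of_int (k l) ^ j * cos (of_int (k l) * x + \<theta> l))" for x
  proof -
    have "Re (of_real (b l) * (of_int (k l) ^ j * exp (\<i> * (of_int (k l) * of_real x - of_real (of_int (int l - int R) * x0)))))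
      = b l * of_int (k l) ^ j * cos (of_int (k l) * x + \<theta> l)" for l
    proof -
      have "\<i> * (of_int (k l) * of_real x - of_real (of_int (int l - int R) * x0)) = \<i> * of_real (of_int (k l) * x + \<theta> l)"
        by (simp add: \<theta>_def)
      then have "exp (\<i> * (of_int (k l) * of_real x - of_real (of_int (int l - int R) * x0))) = cis (of_int (k l) * x + \<theta> l)"
        by (simp only: cis_conv_exp)
      then have "of_real (b l) * (of_int (k l) ^ j * exp (\<i> * (of_int (k l) * of_real x - of_real (of_int (int l - int R) * x0))))
        = of_real (b l * of_int (k l) ^ j) * cis (of_int (k l) * x + \<theta> l)" by simp
      then show ?thesis by (simp only: times_complex.sel Re_complex_of_real Im_complex_of_real cis.sel)
    qed
    then show ?thesis
      unfolding packet_def complex_packet_def ij k_def[symmetric] b_def[symmetric] Re_sum by (simp only:)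
  qed
  have sqi: "integrable torus (\<lambda>x. cos (real m * x) * cos (c * x + a))" for c a
    using square_integrable_inner[OF square_integrable_cos[of "real m" 0] square_integrable_cos[of c a]] by simp
  have "(LINT x|torus. cos (real m * x) * packet n R x0 j x)
    = (LINT x|torus. (\<Sum>l\<le>2*R. (b l * of_int (k l) ^ j) * (cos (real m * x) * cos (of_int (k l) * x + \<theta> l))))"
    unfolding pf sum_distrib_left by (simp add: mult_ac)
  also have "\<dots> = (\<Sum>l\<le>2*R. (b l * of_int (k l) ^ j) * (LINT x|torus. cos (real m * x) * cos (of_int (k l) * x + \<theta> l)))"
    by (subst Bochner_Integration.integral_sum) (auto intro!: integrable_mult_right sqi)
  also have "\<dots> = (\<Sum>l\<le>2*R. if l = R \<and> m = n then b R * real n ^ j * pi else 0)"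
  proof (rule sum.cong[OF refl])
    fix l assume l: "l \<in> {..2*R}"
    have "(LINT x|torus. cos (real m * x) * cos (of_int (k l) * x + \<theta> l)) = (if k l = int m then pi * cos (0 - \<theta> l) else 0)"
      using integral_torus_cos_cos[of "k l" "int m" 0 "\<theta> l"] kpos[of l] m by simp
    moreover have "k l = int m \<longleftrightarrow> l = R \<and> m = n" using far l R by (auto simp: k_def)
    ultimately show "(b l * of_int (k l) ^ j) * (LINT x|torus. cos (real m * x) * cos (of_int (k l) * x + \<theta> l))
        = (if l = R \<and> m = n then b R * real n ^ j * pi else 0)"
      by (auto simp: \<theta>_def k_def)
  qed
  also have "\<dots> = (if m = n then pi * real n ^ j * (real ((2*R) choose R) / 4^R) else 0)"
    by (auto simp: b_def sum.delta)
  finally show ?thesis .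
qed

section \<open>A lacunary initial datum\<close>

text \<open>
  The \<open>i\<close>-th derivative of \<open>cos (m * x)\<close>, divided by \<open>m ^ i\<close>.
\<close>

definition cos_mode :: "nat \<Rightarrow> nat \<Rightarrow> real L2" where
  "cos_mode i m = l2_of (\<lambda>x. cos (real m * x + real i * (pi / 2)))"

lemma norm_cos_mode: "norm (cos_mode i m) \<le> sqrt (2 * pi)"
  unfolding cos_mode_def
  using norm_l2_of_le[of "\<lambda>x. cos (real m * x + real i * (pi / 2))" 1] square_integrable_cos[of "real m" "real i * (pi/2)"]
  by (simp add: square_integrable_def)

text \<open>
  Integration by parts over a period.
\<close>

lemma cos_mode_deriv:
  assumes \<psi>: "test_function \<psi>"
  shows "inner (cos_mode i m) (l2_of (deriv \<psi>)) = - (real m * inner (cos_mode (Suc i) m) (l2_of \<psi>))"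
proof -
  define c where "c i x = cos (real m * x + real i * (pi / 2))" for i x
  have cc: "continuous_on UNIV (c i)" for i unfolding c_def by (intro continuous_intros)
  have dc: "(c i has_real_derivative real m * c (Suc i) x) (at x)" for x
  proof -
    have "real m * x + real (Suc i) * (pi / 2) = (real m * x + real i * (pi / 2)) + pi / 2"
      by (simp add: algebra_simps)
    then have "c (Suc i) x = - sin (real m * x + real i * (pi / 2))"
      unfolding c_def by (simp only: cos_add) simp
    then show ?thesis unfolding c_def[of i] by (auto intro!: derivative_eq_intros)
  qed
  have d\<psi>: "(\<psi> has_real_derivative deriv \<psi> x) (at x)" for x
  proof -
    have "\<forall>k x. ((deriv ^^ k) \<psi>) differentiable (at x)" using \<psi> by (simp add: test_function_def)
    from spec[OF this, of 0] have "\<psi> differentiable (at x)" by simp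
    then show ?thesis by (metis DERIV_deriv_iff_real_differentiable)
  qed
  note c\<psi> = test_function_continuous[OF \<psi>] test_function_continuous[OF test_function_deriv[OF \<psi>]]
  have sc: "square_integrable (c i)" for i by (rule square_integrable_continuous[OF cc])
  note s\<psi> = square_integrable_continuous[OF c\<psi>(1)] square_integrable_continuous[OF c\<psi>(2)]
  have i1: "integrable torus (\<lambda>x. c i x * deriv \<psi> x)" using square_integrable_inner[OF sc s\<psi>(2)] by simp
  have i2: "integrable torus (\<lambda>x. real m * (c (Suc i) x * \<psi> x))" using square_integrable_inner[OF sc s\<psi>(1)] by simp
  have "(LINT x|torus. c i x * deriv \<psi> x + real m * (c (Suc i) x * \<psi> x)) = c i (2*pi) * \<psi> (2*pi) - c i 0 * \<psi> 0"
  proof (rule integral_torus_deriv)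
    show "((\<lambda>x. c i x * \<psi> x) has_real_derivative c i x * deriv \<psi> x + real m * (c (Suc i) x * \<psi> x)) (at x)" for x
      using DERIV_mult[OF dc d\<psi>, of x] by (simp add: algebra_simps)
    show "continuous_on UNIV (\<lambda>x. c i x * deriv \<psi> x + real m * (c (Suc i) x * \<psi> x))"
      by (intro continuous_on_add continuous_on_mult continuous_on_const cc c\<psi>)
  qed
  moreover have "c i (2*pi) = c i 0"
  proof -
    have "real m * (2 * pi) + real i * (pi / 2) = real i * (pi / 2) + 2 * real m * pi" by simp
    then show ?thesis unfolding c_def by (simp only: cos_add cos_2npi sin_2npi) simp
  qed
  moreover have "\<psi> (2*pi) = \<psi> 0" using \<psi> unfolding test_function_def by (metis add_0)
  ultimately have "(LINT x|torus. c i x * deriv \<psi> x) + (LINT x|torus. real m * (c (Suc i) x * \<psi> x)) = 0"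
    using i1 i2 by simp
  then show ?thesis
    unfolding cos_mode_def c_def[symmetric] inner_l2_of[OF sc s\<psi>(2)] inner_l2_of[OF sc s\<psi>(1)] by simp
qed

definition lacunary_freq :: "nat \<Rightarrow> nat \<Rightarrow> nat" where
  "lacunary_freq J j = 4 * 2 ^ (j + J)"

text \<open>
  The \<open>i\<close>-th derivative of the scalar series with coefficients \<open>n\<^sub>j\<^bsup>-k-1\<^esup>\<close>; it converges for \<open>i \<le> k\<close>, as
  its coefficients are then at most \<open>n\<^sub>j\<^bsup>-1\<^esup>\<close> and the frequencies grow geometrically.
\<close>

definition lacunary :: "nat \<Rightarrow> nat \<Rightarrow> nat \<Rightarrow> real L2" where
  "lacunary k J i = (\<Sum>j. (real (lacunary_freq J j) ^ i / real (lacunary_freq J j) ^ Suc k) *\<^sub>R cos_mode i (lacunary_freq J j))"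

lemma lacunary_summable:
  assumes "i \<le> k"
  shows "summable (\<lambda>j. (real (lacunary_freq J j) ^ i / real (lacunary_freq J j) ^ Suc k) *\<^sub>R cos_mode i (lacunary_freq J j))"
proof (rule summable_comparison_test')
  show "summable (\<lambda>j. (1/2) ^ j * sqrt (2 * pi))" by (intro summable_mult2 summable_geometric) auto
  fix j
  let ?m = "real (lacunary_freq J j)"
  have "(1::real) \<le> 2 ^ (j + J)" "(2::real) ^ j \<le> 2 ^ (j + J)"
    by (rule one_le_power, simp) (rule power_increasing; simp)
  moreover have "?m = 4 * 2 ^ (j + J)" by (simp add: lacunary_freq_def)
  ultimately have m: "?m \<ge> 2 ^ j" "?m \<ge> 1" by linarith+
  have "?m ^ i * ?m \<le> ?m ^ Suc k" using power_increasing[of "Suc i" "Suc k" ?m] assms m by (simp add: mult.commute)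
  then have "?m ^ i / ?m ^ Suc k \<le> 1 / ?m" using m by (simp add: field_simps)
  also have "\<dots> \<le> (1/2) ^ j" using m by (simp add: power_one_over field_simps)
  finally have "?m ^ i / ?m ^ Suc k \<le> (1/2) ^ j" .
  then have "(?m ^ i / ?m ^ Suc k) * norm (cos_mode i (lacunary_freq J j)) \<le> (1/2) ^ j * sqrt (2 * pi)"
    by (intro mult_mono norm_cos_mode) auto
  then show "norm ((?m ^ i / ?m ^ Suc k) *\<^sub>R cos_mode i (lacunary_freq J j)) \<le> (1/2) ^ j * sqrt (2 * pi)"
    by simp
qed

lemma inner_lacunary:
  assumes "i \<le> k"
  shows "inner (lacunary k J i) y = (\<Sum>j. (real (lacunary_freq J j) ^ i / real (lacunary_freq J j) ^ Suc k) * inner (cos_mode i (lacunary_freq J j)) y)"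
  unfolding lacunary_def
  by (subst bounded_linear.suminf[OF bounded_linear_inner_left[of y] lacunary_summable[OF assms]]) simp

lemma inner_lacunary_summable:
  assumes "i \<le> k"
  shows "summable (\<lambda>j. (real (lacunary_freq J j) ^ i / real (lacunary_freq J j) ^ Suc k) * inner (cos_mode i (lacunary_freq J j)) y)"
  using bounded_linear.summable[OF bounded_linear_inner_left[of y] lacunary_summable[OF assms]] by simp

lemma lacunary_weak_deriv:
  assumes "Suc i \<le> k"
  shows "has_weak_deriv (tens (lacunary k J i) V) (tens (lacunary k J (Suc i)) V)"
  unfolding has_weak_deriv_iff inner_tens_tens
proof (intro allI impI)
  fix \<psi> :: "real \<Rightarrow> real" and w assume \<psi>: "test_function \<psi>"
  have "inner (lacunary k J i) (l2_of (deriv \<psi>)) = (\<Sum>j. - ((real (lacunary_freq J j) ^ Suc i / real (lacunary_freq J j) ^ Suc k) * inner (cos_mode (Suc i) (lacunary_freq J j)) (l2_of \<psi>)))"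
  proof -
    have gen: "a / b * - (m * x) = - (m * a / b * x)" for a b m x :: real by simp
    have "i \<le> k" using assms by simp
    then show ?thesis by (simp only: inner_lacunary cos_mode_deriv[OF \<psi>] gen power_Suc[of _ i])
  qed
  also have "\<dots> = - inner (lacunary k J (Suc i)) (l2_of \<psi>)"
    unfolding inner_lacunary[OF assms] by (rule suminf_minus[OF inner_lacunary_summable[OF assms]])
  finally show "inner (lacunary k J i) (l2_of (deriv \<psi>)) * (V \<bullet> w) = - (inner (lacunary k J (Suc i)) (l2_of \<psi>) * (V \<bullet> w))"
    by simp
qed

lemma lacunary_sobolev: "d \<le> k \<Longrightarrow> tens (lacunary k J (k - d)) V \<in> sobolev d"
proof (induction d)
  case (Suc d)
  have "Suc (k - Suc d) = k - d" using Suc.prems by simp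
  then show ?case
    using lacunary_weak_deriv[of "k - Suc d" k J V] Suc by auto
qed simp

lemma lacunary_orthogonal_low:
  assumes "\<bar>n\<bar> < 4 * 2 ^ J"
  shows "inner (lacunary k J 0) (l2_of (\<lambda>x. cos (of_int n * x + b))) = 0"
proof -
  have "inner (cos_mode 0 (lacunary_freq J j)) (l2_of (\<lambda>x. cos (of_int n * x + b))) = 0" for j
  proof -
    have "(4::int) * 2 ^ J \<le> int (lacunary_freq J j)"
      by (simp add: lacunary_freq_def power_add)
    then have ne: "n + int (lacunary_freq J j) \<noteq> 0" "n \<noteq> int (lacunary_freq J j)" using assms by linarith+
    have "inner (cos_mode 0 (lacunary_freq J j)) (l2_of (\<lambda>x. cos (of_int n * x + b)))
       = (LINT x|torus. cos (of_int (int (lacunary_freq J j)) * x + 0) * cos (of_int n * x + b))"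
      unfolding cos_mode_def by (subst inner_l2_of[OF square_integrable_cos square_integrable_cos]) simp
    then show ?thesis using integral_torus_cos_cos[OF ne(1), of 0 b] ne(2) by simp
  qed
  then show ?thesis by (subst inner_lacunary) simp_all
qed

lemma lacunary_fourier_coeff_zero:
  fixes V :: "real ^ 'd::finite"
  assumes "\<bar>n\<bar> < 4 * 2 ^ J"
  shows "fourier_coeff (tens (lacunary k J 0) V) n = 0"
proof -
  define g where "g = rep_L2 (lacunary k J 0)"
  have zero: "(LINT x|torus. g x * cos (of_int n * x + b)) = 0" for b
    using lacunary_orthogonal_low[OF assms, of k b]
      inner_l2_of[OF square_integrable_rep[of "lacunary k J 0"] square_integrable_cos[of "of_int n" b]]
    by (simp add: g_def)
  have int: "integrable torus (\<lambda>x. g x * cos (of_int n * x + b))" for b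
    using square_integrable_inner[OF square_integrable_rep[of "lacunary k J 0"] square_integrable_cos[of "of_int n" b]]
    by (simp add: g_def)
  have mg: "g \<in> borel_measurable torus" by (simp add: g_def)
  have mc: "(\<lambda>x. cis (- (of_int n * x))) \<in> borel_measurable torus"
    by (rule continuous_measurable_torus) (intro continuous_intros)
  have comp: "(LINT x|torus. complex_of_real (rep_L2 (tens (lacunary k J 0) V) x $ i) * cis (- (of_int n * x))) = 0" for i
  proof -
    have "(LINT x|torus. complex_of_real (rep_L2 (tens (lacunary k J 0) V) x $ i) * cis (- (of_int n * x)))
      = (LINT x|torus. of_real (V $ i) * (of_real (g x * cos (of_int n * x + 0)) + \<i> * of_real (g x * cos (of_int n * x + pi / 2))))"
    proof (rule integral_cong_AE)
      show "AE x in torus. complex_of_real (rep_L2 (tens (lacunary k J 0) V) x $ i) * cis (- (of_int n * x))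
         = of_real (V $ i) * (of_real (g x * cos (of_int n * x + 0)) + \<i> * of_real (g x * cos (of_int n * x + pi / 2)))"
        using rep_tens[of "lacunary k J 0" V]
        by eventually_elim (simp add: g_def complex_eq_iff cos_add)
      have "(\<lambda>x. rep_L2 (tens (lacunary k J 0) V) x $ i) \<in> borel_measurable torus"
        by (rule measurable_compose[OF measurable_rep]) simp
      then show "(\<lambda>x. complex_of_real (rep_L2 (tens (lacunary k J 0) V) x $ i) * cis (- (of_int n * x))) \<in> borel_measurable torus"
        using mc by (intro borel_measurable_times) auto
      have "(\<lambda>x. g x * cos (of_int n * x + b)) \<in> borel_measurable torus" for b
        using int[of b] by (rule borel_measurable_integrable)
      then have "(\<lambda>x. complex_of_real (g x * cos (of_int n * x + b))) \<in> borel_measurable torus" for b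
        by (rule measurable_compose) simp
      then show "(\<lambda>x. of_real (V $ i) * (complex_of_real (g x * cos (of_int n * x + 0)) + \<i> * of_real (g x * cos (of_int n * x + pi / 2)))) \<in> borel_measurable torus"
        by (intro borel_measurable_times borel_measurable_add borel_measurable_const)
    qed
    also have "\<dots> = 0"
      using int zero by (simp only: integral_mult_right_zero Bochner_Integration.integral_add integral_complex_of_real integrable_of_real integrable_mult_right) simp
    finally show ?thesis .
  qed
  show ?thesis unfolding fourier_coeff_def vec_eq_iff by (simp only: comp vec_lambda_beta zero_index) simp
qed

text \<open>
  The frequencies of the packet lie in \<open>[3 * R, 5 * R]\<close>, while the neighbours of \<open>4 * R\<close> in the series are
  \<open>2 * R\<close> and \<open>8 * R\<close>.
\<close>

lemma lacunary_packet_pairing: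
  assumes P: "4 dvd P" and R: "R = 2 ^ (i + J)"
  shows "inner (lacunary k J 0) (l2_of (packet (4 * R) R x0 P))
    = pi * real (4 * R) ^ P / real (4 * R) ^ Suc k * (real ((2*R) choose R) / 4^R)"
proof -
  have n: "lacunary_freq J i = 4 * R" by (simp add: lacunary_freq_def R)
  have cpk: "continuous_on UNIV (packet (4*R) R x0 P)"
    by (rule DERIV_continuous_on[OF has_field_derivative_at_within[OF packet_derivative]])
  have term': "inner (cos_mode 0 (lacunary_freq J j)) (l2_of (packet (4 * R) R x0 P))
    = (if j = i then pi * real (4 * R) ^ P * (real ((2*R) choose R) / 4^R) else 0)" for j
  proof -
    have far: "lacunary_freq J j = 4 * R \<or> lacunary_freq J j < 4 * R - R \<or> lacunary_freq J j > 4 * R + R"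
    proof (cases j i rule: linorder_cases)
      case less
      then have "(2::nat) ^ Suc (j + J) \<le> R" unfolding R by (intro power_increasing) auto
      moreover have "R > 0" by (simp add: R)
      ultimately have "4 * 2 ^ (j + J) < 3 * R" by simp
      then show ?thesis by (simp add: lacunary_freq_def)
    next
      case greater
      then have "(2::nat) ^ (Suc (i + J)) \<le> 2 ^ (j + J)" by (intro power_increasing) auto
      moreover have "R > 0" by (simp add: R)
      ultimately show ?thesis by (simp add: lacunary_freq_def flip: R)
    qed (simp add: n)
    have inj: "lacunary_freq J j = 4 * R \<longleftrightarrow> j = i" by (simp add: lacunary_freq_def R)
    have "inner (cos_mode 0 (lacunary_freq J j)) (l2_of (packet (4 * R) R x0 P))
      = (LINT x|torus. cos (real (lacunary_freq J j) * x) * packet (4*R) R x0 P x)"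
      unfolding cos_mode_def
      by (subst inner_l2_of[OF square_integrable_cos square_integrable_continuous[OF cpk]]) simp
    also have "\<dots> = (if j = i then pi * real (4 * R) ^ P * (real ((2*R) choose R) / 4^R) else 0)"
      using packet_pairing[of R "4*R" "lacunary_freq J j" P x0] far P inj by (simp add: R lacunary_freq_def)
    finally show ?thesis .
  qed
  have "inner (lacunary k J 0) (l2_of (packet (4 * R) R x0 P))
    = (\<Sum>j. if j = i then 1 / real (4 * R) ^ Suc k * (pi * real (4 * R) ^ P * (real ((2*R) choose R) / 4^R)) else 0)"
    by (subst inner_lacunary) (auto simp: term' n intro!: suminf_cong)
  also have "\<dots> = 1 / real (4 * R) ^ Suc k * (pi * real (4 * R) ^ P * (real ((2*R) choose R) / 4^R))"
    using suminf_finite[of "{i}" "\<lambda>j. if j = i then 1 / real (4 * R) ^ Suc k * (pi * real (4 * R) ^ P * (real ((2*R) choose R) / 4^R)) else 0"]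
    by simp
  finally show ?thesis by simp
qed

section \<open>Long gaps of the control region\<close>

text \<open>
  For non-measurable sets the measure is 0 by convention.
\<close>

lemma measure_subset_interval:
  assumes "A \<subseteq> {a..b::real}" "a \<le> b"
  shows "measure lborel A \<le> b - a"
proof (cases "A \<in> sets lborel")
  case True
  have "measure lborel A \<le> measure lborel {a..b}"
    by (rule measure_mono_fmeasurable[OF assms(1) True]) (simp add: fmeasurable_def emeasure_lborel_Icc_eq)
  then show ?thesis using assms by simp
next
  case False
  then show ?thesis using assms by (simp add: measure_notin_sets)
qed

lemma cis_inj_shift:
  assumes "cis x = cis y" "\<theta> \<le> x" "x < \<theta> + 2 * pi" "\<theta> \<le> y" "y < \<theta> + 2 * pi"
  shows "x = y"
proof -
  have "cis (x - \<theta>) = cis (y - \<theta>)" using assms(1) by (simp flip: cis_divide)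
  then have "x - \<theta> = y - \<theta>" using assms by (intro cis_inj_on) auto
  then show ?thesis by simp
qed

text \<open>
  Cutting the circle at a point of \<open>\<omega>\<close> turns a connected component of the complement into an interval.
  Its length is the arc length, although the arc length is measured in the fundamental domain, where the
  arc may consist of two pieces.
\<close>

lemma long_gap_contains_long_interval:
  assumes \<omega>: "openin (top_of_set (sphere 0 1)) \<omega>" "\<omega> \<noteq> {}" and L: "0 \<le> L" "L < gap_length \<omega>"
  obtains a b where "L < b - a" "b - a < 2 * pi" "\<And>x. a \<le> x \<Longrightarrow> x \<le> b \<Longrightarrow> cis x \<notin> \<omega>"
proof -
  have bdd: "bdd_above (insert 0 (arc_length ` components (sphere 0 1 - \<omega>)))"
  proof (rule bdd_aboveI[of _ "2 * pi"])
    fix x assume x: "x \<in> insert 0 (arc_length ` components (sphere 0 1 - \<omega>))"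
    have "arc_length I \<le> 2 * pi" for I
      unfolding arc_length_def by (rule order_trans[OF measure_subset_interval[of _ 0 "2*pi"]]) auto
    then show "x \<le> 2 * pi" using x by auto
  qed
  obtain l where l: "l \<in> insert 0 (arc_length ` components (sphere 0 1 - \<omega>))" "L < l"
    using L(2) unfolding gap_length_def by (subst (asm) less_cSup_iff[OF _ bdd]) auto
  then obtain I where I: "I \<in> components (sphere 0 1 - \<omega>)" "L < arc_length I"
    using L(1) by auto
  have Isub: "I \<subseteq> sphere 0 1 - \<omega>" and Icon: "connected I" and Ine: "I \<noteq> {}"
    using in_components_subset[OF I(1)] in_components_connected[OF I(1)] in_components_nonempty[OF I(1)] by auto
  obtain p where p: "p \<in> \<omega>" using \<omega>(2) by blast
  have np: "norm p = 1" using p openin_imp_subset[OF \<omega>(1)] by auto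
  define \<theta> where "\<theta> = Arg2pi p"
  have \<theta>: "0 \<le> \<theta>" "\<theta> < 2 * pi" by (auto simp: \<theta>_def Arg2pi_ge_0 Arg2pi_lt_2pi)
  have cp: "cis \<theta> = p" using Arg2pi_eq[of p] np by (simp add: \<theta>_def cis_conv_exp)
  have p0: "p \<noteq> 0" using np by auto
  define g where "g z = \<theta> + pi + Arg (- z / p)" for z
  have npos: "- z / p \<notin> \<real>\<^sub>\<le>\<^sub>0" if z: "z \<in> I" for z
  proof
    assume "- z / p \<in> \<real>\<^sub>\<le>\<^sub>0"
    then obtain t where t: "- z / p = of_real t" "t \<le> 0" by (rule nonpos_Reals_cases)
    have "norm (- z / p) = 1" using z Isub np by (auto simp: norm_divide)
    then have "norm (complex_of_real t) = 1" by (simp only: t(1))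
    then have "t = -1" using t(2) by simp
    then have "z = p" using t p0 by (simp add: field_simps)
    then show False using z Isub p by auto
  qed
  have cg: "cis (g z) = z" if z: "z \<in> I" for z
  proof -
    have nz: "norm z = 1" using z Isub by auto
    then have "z \<noteq> 0" by auto
    then have "cis (Arg (- z / p)) = - z / p"
      using cis_Arg[of "- z / p"] p0 nz np by (simp add: sgn_div_norm norm_divide)
    moreover have "cis (g z) = cis \<theta> * cis pi * cis (Arg (- z / p))" by (simp only: g_def cis_mult)
    ultimately show ?thesis using p0 by (simp add: cp)
  qed
  have gr: "\<theta> < g z" "g z < \<theta> + 2 * pi" if z: "z \<in> I" for z
  proof -
    have "Arg (- z / p) \<noteq> pi"
    proof
      assume "Arg (- z / p) = pi"
      then have "- z / p \<in> \<real>\<^sub>\<le>\<^sub>0" using Arg_eq_pi[of "- z / p"] by (auto simp: complex_nonpos_Reals_iff)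
      then show False using npos[OF z] by blast
    qed
    then show "\<theta> < g z" "g z < \<theta> + 2 * pi"
      using mpi_less_Arg[of "- z / p"] Arg_le_pi[of "- z / p"] by (auto simp: g_def)
  qed
  have "continuous_on I g"
    unfolding g_def using npos p0
    by (intro continuous_intros continuous_at_imp_continuous_on ballI continuous_at_compose[of _ "\<lambda>z. - z / p" Arg, unfolded o_def] continuous_at_Arg) auto
  then have "is_interval (g ` I)" using connected_continuous_image[OF _ Icon] by (simp add: is_interval_connected_1)
  then have interval: "x \<in> g ` I" if "a \<in> g ` I" "b \<in> g ` I" "a \<le> x" "x \<le> b" for a b x
    using that unfolding is_interval_1 by blast
  have "\<exists>a\<in>g ` I. \<exists>b\<in>g ` I. L < b - a"
  proof (rule ccontr)
    assume "\<not> ?thesis"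
    then have short: "b - a \<le> L" if "a \<in> g ` I" "b \<in> g ` I" for a b using that by force
    define \<alpha> where "\<alpha> = Inf (g ` I)"
    have bb: "bdd_below (g ` I)" using gr(1) by (intro bdd_belowI[of _ \<theta>]) (auto intro: less_imp_le)
    have \<alpha>: "\<theta> \<le> \<alpha>" unfolding \<alpha>_def using Ine gr(1) by (intro cInf_greatest) (auto intro: less_imp_le)
    have lo: "\<alpha> \<le> a" if "a \<in> g ` I" for a unfolding \<alpha>_def by (rule cInf_lower[OF that bb])
    have hi: "b \<le> \<alpha> + L" if b: "b \<in> g ` I" for b
    proof -
      have "b - L \<le> \<alpha>" unfolding \<alpha>_def using Ine short[OF _ b] by (intro cInf_greatest) (auto simp: algebra_simps)
      then show ?thesis by simp
    qed
    define A where "A = {x \<in> {0..<2*pi}. cis x \<in> I}"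
    have Acase: "(\<alpha> \<le> x \<and> x \<le> \<alpha> + L) \<or> (\<alpha> \<le> x + 2 * pi \<and> x + 2 * pi \<le> \<alpha> + L)" if x: "x \<in> A" for x
    proof -
      have z: "cis x \<in> I" and xr: "0 \<le> x" "x < 2 * pi" using x by (auto simp: A_def)
      have gx: "g (cis x) \<in> g ` I" using z by blast
      show ?thesis
      proof (cases "\<theta> \<le> x")
        case True
        have "x = g (cis x)"
          by (rule cis_inj_shift[of _ _ \<theta>]) (use cg[OF z] gr[OF z] True xr \<theta> in auto)
        then show ?thesis using lo[OF gx] hi[OF gx] by simp
      next
        case False
        have "x + 2 * pi = g (cis x)"
          by (rule cis_inj_shift[of _ _ \<theta>]) (use cg[OF z] gr[OF z] False xr \<theta> in \<open>auto simp: cis_periodic\<close>)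
        then show ?thesis using lo[OF gx] hi[OF gx] by simp
      qed
    qed
    have "measure lborel A \<le> L"
    proof -
      consider "\<alpha> + L < 2 * pi" | "2 * pi \<le> \<alpha>" | "\<alpha> < 2 * pi" "2 * pi \<le> \<alpha> + L" by linarith
      then show ?thesis
      proof cases
        case 1
        have "A \<subseteq> {\<alpha>..\<alpha> + L}" using Acase 1 by (force simp: A_def)
        then show ?thesis using measure_subset_interval[of A \<alpha> "\<alpha> + L"] L by simp
      next
        case 2
        have "A \<subseteq> {\<alpha> - 2 * pi..\<alpha> + L - 2 * pi}" using Acase 2 by (force simp: A_def)
        then show ?thesis using measure_subset_interval[of A "\<alpha> - 2 * pi" "\<alpha> + L - 2 * pi"] L by simp
      next
        case 3
        have sub: "A \<subseteq> {\<alpha>..2 * pi} \<union> {0..\<alpha> + L - 2 * pi}" using Acase by (force simp: A_def)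
        show ?thesis
        proof (cases "A \<in> sets lborel")
          case True
          have "measure lborel A \<le> measure lborel ({\<alpha>..2 * pi} \<union> {0..\<alpha> + L - 2 * pi})"
            by (rule measure_mono_fmeasurable[OF sub True]) (rule fmeasurable.Un; simp add: fmeasurable_def emeasure_lborel_Icc_eq)
          also have "\<dots> \<le> measure lborel {\<alpha>..2 * pi} + measure lborel {0..\<alpha> + L - 2 * pi}"
            by (rule measure_Un_le) auto
          also have "\<dots> = L" using 3 by simp
          finally show ?thesis .
        qed (simp add: measure_notin_sets L)
      qed
    qed
    then show False using I(2) by (simp add: arc_length_def A_def)
  qed
  then obtain a b where ab: "a \<in> g ` I" "b \<in> g ` I" "L < b - a" by blast
  show ?thesis
  proof (rule that[of b a])
    show "L < b - a" by (rule ab)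
    show "b - a < 2 * pi" using ab gr by force
    fix x assume "a \<le> x" "x \<le> b"
    then have "x \<in> g ` I" using interval[OF ab(1,2)] by simp
    then have "cis x \<in> I" using cg by auto
    then show "cis x \<notin> \<omega>" using Isub by blast
  qed
qed

section \<open>The inequality forced by steering to zero\<close>

lemma measurable_indicator_arc:
  assumes \<omega>: "openin (top_of_set (sphere 0 1)) \<omega>"
  shows "(\<lambda>x. indicator \<omega> (cis x) :: real) \<in> borel_measurable torus"
proof -
  obtain U where U: "open U" "\<omega> = sphere 0 1 \<inter> U" using \<omega> by (auto simp: openin_open)
  have "indicator \<omega> (cis x) = (indicator U (cis x) :: real)" for x by (auto simp: U indicator_def)
  moreover have "(\<lambda>x. indicator U (cis x) :: real) \<in> borel_measurable borel"
    using U(1) by (intro measurable_compose[OF borel_measurable_continuous_onI borel_measurable_indicator])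
      (auto intro!: continuous_intros)
  ultimately show ?thesis by (intro measurable_torusI) simp
qed

text \<open>
  A function supported in \<open>\<omega>\<close> only tests the restriction of \<open>\<Phi>\<close> to \<open>\<omega>\<close>; then Cauchy--Schwarz. If the
  left factor is not square-integrable, its class is 0 by convention.
\<close>

lemma inner_localized_le:
  fixes v \<Phi> :: "real \<Rightarrow> 'b::euclidean_space"
  assumes \<omega>: "openin (top_of_set (sphere 0 1)) \<omega>"
    and \<Phi>: "continuous_on UNIV \<Phi>" and small: "\<And>x. cis x \<in> \<omega> \<Longrightarrow> norm (\<Phi> x) \<le> \<eta>" and \<eta>: "0 \<le> \<eta>"
  shows "\<bar>inner (l2_of (\<lambda>x. indicator \<omega> (cis x) *\<^sub>R v x)) (l2_of \<Phi>)\<bar>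
    \<le> norm (l2_of (\<lambda>x. indicator \<omega> (cis x) *\<^sub>R v x)) * (sqrt (2 * pi) * \<eta>)"
proof (cases "square_integrable (\<lambda>x. indicator \<omega> (cis x) *\<^sub>R v x)")
  case True
  have m: "(\<lambda>x. indicator \<omega> (cis x) *\<^sub>R \<Phi> x) \<in> borel_measurable torus"
    by (intro borel_measurable_scaleR measurable_indicator_arc[OF \<omega>] continuous_measurable_torus[OF \<Phi>])
  have b: "norm (indicator \<omega> (cis x) *\<^sub>R \<Phi> x) \<le> \<eta>" for x
    using small[of x] \<eta> by (auto simp: indicator_def)
  have "inner (l2_of (\<lambda>x. indicator \<omega> (cis x) *\<^sub>R v x)) (l2_of \<Phi>)
      = inner (l2_of (\<lambda>x. indicator \<omega> (cis x) *\<^sub>R v x)) (l2_of (\<lambda>x. indicator \<omega> (cis x) *\<^sub>R \<Phi> x))"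
    unfolding inner_l2_of[OF True square_integrable_continuous[OF \<Phi>]]
      inner_l2_of[OF True square_integrable_bounded[OF m b]]
    by (intro Bochner_Integration.integral_cong) (auto simp: indicator_def)
  also have "\<bar>\<dots>\<bar> \<le> norm (l2_of (\<lambda>x. indicator \<omega> (cis x) *\<^sub>R v x)) * norm (l2_of (\<lambda>x. indicator \<omega> (cis x) *\<^sub>R \<Phi> x))"
    by (rule Cauchy_Schwarz_ineq2)
  also have "\<dots> \<le> norm (l2_of (\<lambda>x. indicator \<omega> (cis x) *\<^sub>R v x)) * (sqrt (2 * pi) * \<eta>)"
    by (intro mult_left_mono norm_l2_of_le[OF m b]) simp
  finally show ?thesis .
next
  case False
  then show ?thesis by (simp add: l2_of_def)
qed

text \<open>
  By Fubini, the energy \<open>H s\<close> of the control at time \<open>s\<close> is finite for almost all \<open>s\<close> and integrable in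
  time. The majorant is \<open>1 + \<beta>\<^sup>2 * H\<close>, because the square of the norm of the forcing is at most
  \<open>\<beta>\<^sup>2 * H\<close>.
\<close>

lemma forcing_norm_bound:
  fixes M :: "real ^ 'm::finite ^ 'd::finite"
  assumes u: "admissible_control T \<omega> u"
  obtains b N where "b integrable_on {0..T}" "negligible N" "\<And>s. 0 \<le> b s"
    "\<And>s. s \<in> {0..T} - N \<Longrightarrow> norm (forcing M \<omega> u s) \<le> b s"
proof -
  define Q where "Q = {(t, x). 0 < t \<and> t < T \<and> 0 \<le> x \<and> x < 2 * pi \<and> cis x \<in> \<omega>}"
  define w where "w p = indicator Q p *\<^sub>R (norm (u p))\<^sup>2" for p
  have "integrable lborel w"
    using u unfolding admissible_control_def Let_def Q_def[symmetric] w_def set_integrable_def by blast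
  then have iw: "integrable (lborel \<Otimes>\<^sub>M lborel) w" by (simp add: lborel_prod)
  define H where "H s = (LINT x|lborel. w (s, x))" for s
  have iH: "integrable lborel H" unfolding H_def by (rule lborel_pair.integrable_fst'[OF iw])
  have w0: "w p \<ge> 0" for p by (simp add: w_def)
  have H0: "H s \<ge> 0" for s unfolding H_def using w0 by simp
  have "AE s in lborel. integrable lborel (\<lambda>x. w (s, x))" by (rule lborel_pair.AE_integrable_fst'[OF iw])
  then obtain N0 where N0': "N0 \<in> null_sets lborel"
    "{s \<in> space lborel. \<not> integrable lborel (\<lambda>x. w (s, x))} \<subseteq> N0"
    unfolding eventually_ae_filter by blast
  have N0: "integrable lborel (\<lambda>x. w (s, x))" if "s \<notin> N0" for s
  proof (rule ccontr)
    assume "\<not> integrable lborel (\<lambda>x. w (s, x))"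
    then have "s \<in> {s \<in> space lborel. \<not> integrable lborel (\<lambda>x. w (s, x))}"
      by (simp only: mem_Collect_eq space_lborel space_borel UNIV_I simp_thms)
    with N0'(2) that show False by blast
  qed
  obtain \<beta> where \<beta>: "\<And>v. norm (M *v v) \<le> \<beta> * norm v"
    using linear_bounded[OF matrix_vector_mul_linear[of M]] by blast
  define b where "b s = 1 + \<beta>\<^sup>2 * H s" for s
  show ?thesis
  proof (rule that[of b "insert 0 (insert T N0)"])
    show "b integrable_on {0..T}"
    proof -
      have "set_integrable lborel {0..T} H"
        unfolding set_integrable_def by (intro integrable_mult_indicator iH) simp
      then have "H integrable_on {0..T}" by (rule set_borel_integral_eq_integral(1))
      then have "(\<lambda>s. \<beta>\<^sup>2 * H s) integrable_on {0..T}" by (rule integrable_on_mult_right)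
      then show ?thesis unfolding b_def by (intro Henstock_Kurzweil_Integration.integrable_add) auto
    qed
    show "negligible (insert 0 (insert T N0))"
      using N0'(1) by (simp add: negligible_iff_null_sets null_sets_completionI)
    show "0 \<le> b s" for s using H0 by (simp add: b_def)
    fix s assume s: "s \<in> {0..T} - insert 0 (insert T N0)"
    define g where "g x = indicator \<omega> (cis x) *\<^sub>R (M *v u (s, x))" for x
    have F: "forcing M \<omega> u s = l2_of g" by (simp add: forcing_def g_def[abs_def])
    show "norm (forcing M \<omega> u s) \<le> b s"
    proof (cases "square_integrable g")
      case True
      have "(norm (l2_of g))\<^sup>2 = (LINT x|lborel. indicator {0..<2*pi} x *\<^sub>R (norm (g x))\<^sup>2)"
        unfolding norm_l2_of_squared[OF True] torus_def by (subst integral_restrict_space) auto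
      also have "\<dots> \<le> (LINT x|lborel. \<beta>\<^sup>2 * w (s, x))"
      proof (rule integral_mono)
        show "integrable lborel (\<lambda>x. indicator {0..<2*pi} x *\<^sub>R (norm (g x))\<^sup>2)"
        proof -
          have "integrable torus (\<lambda>x. (norm (g x))\<^sup>2)" using True by (simp add: square_integrable_def)
          then show ?thesis unfolding torus_def by (subst (asm) integrable_restrict_space) auto
        qed
        show "integrable lborel (\<lambda>x. \<beta>\<^sup>2 * w (s, x))" using s by (intro integrable_mult_right N0) blast
        fix x
        have "(norm (M *v u (s, x)))\<^sup>2 \<le> \<beta>\<^sup>2 * (norm (u (s, x)))\<^sup>2"
          using power_mono[OF \<beta>[of "u (s, x)"] norm_ge_zero, of 2] by (simp add: power_mult_distrib)
        then show "indicator {0..<2*pi} x *\<^sub>R (norm (g x))\<^sup>2 \<le> \<beta>\<^sup>2 * w (s, x)"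
          using s by (auto simp: w_def g_def Q_def indicator_def)
      qed
      also have "\<dots> = \<beta>\<^sup>2 * H s" by (simp add: H_def)
      finally have "(norm (l2_of g))\<^sup>2 \<le> \<beta>\<^sup>2 * H s" .
      moreover have "norm (l2_of g) \<le> 1 + (norm (l2_of g))\<^sup>2"
      proof -
        have "0 \<le> (norm (l2_of g) - 1/2)\<^sup>2" by simp
        then show ?thesis by (simp add: power2_diff power_divide)
      qed
      ultimately show ?thesis unfolding F b_def by linarith
    next
      case False
      then show ?thesis using H0 by (simp add: F l2_of_def b_def)
    qed
  qed
qed

lemma has_integral_bound_off_negligible:
  fixes g b :: "real \<Rightarrow> real"
  assumes g: "(g has_integral I) {0..T}" and b: "b integrable_on {0..T}" and N: "negligible N"
    and bound: "\<And>s. s \<in> {0..T} - N \<Longrightarrow> \<bar>g s\<bar> \<le> c * b s" and "c \<ge> 0" "\<And>s. b s \<ge> 0"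
  shows "\<bar>I\<bar> \<le> c * integral {0..T} b"
proof -
  define g' where "g' s = (if s \<in> N then 0 else g s)" for s
  have g': "(g' has_integral I) {0..T}"
    by (rule has_integral_spike[OF N _ g]) (auto simp: g'_def)
  have "norm (integral {0..T} g') \<le> integral {0..T} (\<lambda>s. c * b s)"
  proof (rule Henstock_Kurzweil_Integration.integral_norm_bound_integral)
    show "g' integrable_on {0..T}" using g' by blast
    show "(\<lambda>s. c * b s) integrable_on {0..T}" by (rule integrable_on_mult_right[OF b])
    show "norm (g' s) \<le> c * b s" if "s \<in> {0..T}" for s
      using bound[of s] that assms(5,6) by (auto simp: g'_def)
  qed
  then show ?thesis using integral_unique[OF g'] by simp
qed

text \<open>
  \<open>\<epsilon>\<close> bounds the residual in the adjoint equation, \<open>\<eta>\<close> the size of the wave on the control region.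
\<close>

definition approximate_adjoint_wave ::
  "(real \<Rightarrow> (real ^ 'd::finite) L2 \<Rightarrow> (real ^ 'd) L2) \<Rightarrow> real \<Rightarrow> complex set \<Rightarrow>
   (real \<Rightarrow> real \<Rightarrow> real ^ 'd) \<Rightarrow> real \<Rightarrow> real \<Rightarrow> bool" where
  "approximate_adjoint_wave S T \<omega> \<Phi> \<epsilon> \<eta> \<longleftrightarrow> 0 \<le> \<eta> \<and> (\<exists>\<phi>' \<Lambda>. \<forall>s\<in>{0..T}.
     ((\<lambda>s. l2_of (\<Phi> s)) has_vector_derivative \<phi>' s) (at s within {0..T}) \<and>
     (\<forall>h k. (h, k) \<in> generator_graph S \<longrightarrow> inner k (l2_of (\<Phi> s)) = inner h (\<Lambda> s)) \<and>
     norm (\<phi>' s + \<Lambda> s) \<le> \<epsilon> \<and> continuous_on UNIV (\<Phi> s) \<and>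
     (\<forall>x. cis x \<in> \<omega> \<longrightarrow> norm (\<Phi> s x) \<le> \<eta>))"

text \<open>
  Duhamel's formula is paired with the final value of the wave. By \<open>approximate_adjoint_solution\<close>,
  the free evolution contributes the pairing of \<open>f0\<close> with the initial value, and each forcing term its
  pairing with the wave at the same time, which is small because the forcing lives on \<open>\<omega>\<close>.
\<close>

lemma steering_inequality:
  fixes S :: "real \<Rightarrow> (real ^ 'd::finite) L2 \<Rightarrow> (real ^ 'd) L2" and M :: "real ^ 'm::finite ^ 'd"
  assumes S: "C0_semigroup S" and T: "T > 0" and u: "admissible_control T \<omega> u"
    and \<omega>: "openin (top_of_set (sphere 0 1)) \<omega>"
    and duhamel: "((\<lambda>s. S (T - s) (forcing M \<omega> u s)) has_integral (0 - S T f0)) {0..T}"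
  obtains C where "C \<ge> 0"
    "\<And>\<Phi> \<epsilon> \<eta>. approximate_adjoint_wave S T \<omega> \<Phi> \<epsilon> \<eta> \<Longrightarrow>
      \<bar>inner f0 (l2_of (\<Phi> 0))\<bar> \<le> C * (\<epsilon> + \<eta>)"
proof -
  obtain C1 where C1: "C1 \<ge> 1" "\<And>t x. t \<in> {0..T} \<Longrightarrow> norm (S t x) \<le> C1 * norm x"
    using C0_semigroup_locally_bounded[OF S] by blast
  obtain b N where b: "b integrable_on {0..T}" "negligible N" "\<And>s. 0 \<le> b s"
    "\<And>s. s \<in> {0..T} - N \<Longrightarrow> norm (forcing M \<omega> u s) \<le> b s"
    by (rule forcing_norm_bound[OF u, of M]) blast
  define I where "I = integral {0..T} b"
  have I0: "I \<ge> 0" unfolding I_def by (intro Henstock_Kurzweil_Integration.integral_nonneg b)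
  define C where "C = T * C1 * norm f0 + (sqrt (2 * pi) + T * C1) * I"
  have C0: "C \<ge> 0" using T C1 I0 by (simp add: C_def)
  show ?thesis
  proof (rule that[OF C0])
    fix \<Phi> and \<epsilon> \<eta> :: real
    assume wave: "approximate_adjoint_wave S T \<omega> \<Phi> \<epsilon> \<eta>"
    then obtain \<phi>' \<Lambda> where \<eta>: "\<eta> \<ge> 0" and w: "\<And>s. s \<in> {0..T} \<Longrightarrow>
        ((\<lambda>s. l2_of (\<Phi> s)) has_vector_derivative \<phi>' s) (at s within {0..T}) \<and>
        (\<forall>h k. (h, k) \<in> generator_graph S \<longrightarrow> inner k (l2_of (\<Phi> s)) = inner h (\<Lambda> s)) \<and>
        norm (\<phi>' s + \<Lambda> s) \<le> \<epsilon> \<and> continuous_on UNIV (\<Phi> s) \<and>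
        (\<forall>x. cis x \<in> \<omega> \<longrightarrow> norm (\<Phi> s x) \<le> \<eta>)"
      unfolding approximate_adjoint_wave_def by blast
    have d: "((\<lambda>s. l2_of (\<Phi> s)) has_vector_derivative \<phi>' s) (at s within {0..T})"
      and res: "norm (\<phi>' s + \<Lambda> s) \<le> \<epsilon>" and cont: "continuous_on UNIV (\<Phi> s)" if "s \<in> {0..T}" for s
      using w[OF that] by simp_all
    have adj: "inner k (l2_of (\<Phi> s)) = inner h (\<Lambda> s)" if "(h, k) \<in> generator_graph S" "s \<in> {0..T}" for h k s
      using w[OF that(2)] that(1) by simp
    have small: "norm (\<Phi> s x) \<le> \<eta>" if "s \<in> {0..T}" "cis x \<in> \<omega>" for s x
      using w[OF that(1)] that(2) by simp
    have eps: "\<epsilon> \<ge> 0" using res[of 0] T by (auto intro: order_trans[OF norm_ge_zero])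
    have approx: "\<bar>inner (S (T - r) h) (l2_of (\<Phi> T)) - inner h (l2_of (\<Phi> r))\<bar> \<le> T * C1 * \<epsilon> * norm h"
      if "r \<in> {0..T}" for r h
      by (rule approximate_adjoint_solution[OF S C1(2) d adj res that])
    define c where "c = sqrt (2 * pi) * \<eta> + T * C1 * \<epsilon>"
    have c0: "c \<ge> 0" using \<eta> eps T C1 by (simp add: c_def)
    have pw: "\<bar>inner (S (T - s) (forcing M \<omega> u s)) (l2_of (\<Phi> T))\<bar> \<le> c * b s" if s: "s \<in> {0..T} - N" for s
    proof -
      have "\<bar>inner (forcing M \<omega> u s) (l2_of (\<Phi> s))\<bar> \<le> norm (forcing M \<omega> u s) * (sqrt (2 * pi) * \<eta>)"
        unfolding forcing_def using s by (intro inner_localized_le[OF \<omega> cont small \<eta>]) auto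
      then have "\<bar>inner (S (T - s) (forcing M \<omega> u s)) (l2_of (\<Phi> T))\<bar> \<le> c * norm (forcing M \<omega> u s)"
        using approx[of s "forcing M \<omega> u s"] s by (simp add: c_def algebra_simps)
      also have "\<dots> \<le> c * b s" by (intro mult_left_mono b(4) s c0)
      finally show ?thesis .
    qed
    have "((\<lambda>s. inner (S (T - s) (forcing M \<omega> u s)) (l2_of (\<Phi> T))) has_integral inner (0 - S T f0) (l2_of (\<Phi> T))) {0..T}"
      using has_integral_linear[OF duhamel bounded_linear_inner_left[of "l2_of (\<Phi> T)"]] by (simp add: o_def)
    from has_integral_bound_off_negligible[OF this b(1,2) pw c0 b(3)]
    have "\<bar>inner (S T f0) (l2_of (\<Phi> T))\<bar> \<le> c * I" by (simp add: I_def)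
    then have "\<bar>inner f0 (l2_of (\<Phi> 0))\<bar> \<le> T * C1 * \<epsilon> * norm f0 + c * I"
      using approx[of 0 f0] T by simp
    also have "\<dots> \<le> C * (\<epsilon> + \<eta>)"
    proof -
      have "C * (\<epsilon> + \<eta>) - (T * C1 * \<epsilon> * norm f0 + c * I) = (T * C1 * norm f0 + T * C1 * I) * \<eta> + sqrt (2 * pi) * I * \<epsilon>"
        by (simp add: C_def c_def algebra_simps)
      also have "\<dots> \<ge> 0" using T C1 I0 eps \<eta> by simp
      finally show ?thesis by simp
    qed
    finally show "\<bar>inner f0 (l2_of (\<Phi> 0))\<bar> \<le> C * (\<epsilon> + \<eta>)" .
  qed
qed

section \<open>Travelling waves and the lower bound on the time\<close>

text \<open>
  As \<open>n ^ P * x ^ n\<close> is the \<open>P\<close>-th power of \<open>n * y ^ n\<close> for a \<open>P\<close>-th root \<open>y\<close> of \<open>x\<close>.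
\<close>

lemma power_times_geometric_bounded:
  fixes x :: real
  assumes "0 < x" "x < 1"
  obtains K where "\<And>n. real n ^ P * x ^ n \<le> K"
proof (cases "P = 0")
  case True
  then show ?thesis using that[of 1] assms by (simp add: power_le_one)
next
  case False
  define y where "y = root P x"
  have y: "0 < y" "y < 1" "y ^ P = x" using False assms by (auto simp: y_def)
  have "(\<lambda>n. real n * y ^ n) \<longlonglongrightarrow> 0" using powser_times_n_limit_0[of y] y by simp
  then have "Bseq (\<lambda>n. real n * y ^ n)" by (intro convergent_imp_Bseq convergentI)
  then obtain B where B: "\<And>n. norm (real n * y ^ n) \<le> B" unfolding Bseq_def by blast
  show ?thesis
  proof (rule that[of "B ^ P"])
    fix n
    have "real n ^ P * x ^ n = (real n * y ^ n) ^ P"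
      unfolding y(3)[symmetric] by (simp add: power_mult_distrib mult.commute flip: power_mult)
    also have "\<dots> \<le> B ^ P" using B[of n] y by (intro power_mono) auto
    finally show "real n ^ P * x ^ n \<le> B ^ P" .
  qed
qed

lemma cos_large_imp_near_period:
  assumes \<delta>: "0 \<le> \<delta>" "\<delta> \<le> pi" and y: "cos \<delta> < cos y"
  obtains m :: int where "\<bar>y - 2 * pi * m\<bar> < \<delta>"
proof -
  define m where "m = round (y / (2 * pi))"
  define r where "r = y - 2 * pi * m"
  have "\<bar>y / (2 * pi) - m\<bar> \<le> 1 / 2" unfolding m_def using of_int_round_abs_le[of "y / (2 * pi)"] by (simp add: abs_minus_commute)
  then have "2 * pi * \<bar>y / (2 * pi) - m\<bar> \<le> 2 * pi * (1 / 2)" by (intro mult_left_mono) auto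
  moreover have "2 * pi * \<bar>y / (2 * pi) - m\<bar> = \<bar>r\<bar>"
  proof -
    have "r = 2 * pi * (y / (2 * pi) - m)" by (simp add: r_def algebra_simps)
    then show ?thesis by (simp add: abs_mult)
  qed
  ultimately have r: "\<bar>r\<bar> \<le> pi" by simp
  have "cos \<bar>r\<bar> = cos y"
  proof -
    have "y = r + 2 * pi * m" by (simp add: r_def)
    then have "cos y = cos r" by (simp add: cos_add)
    then show ?thesis by (simp add: cos_abs_real)
  qed
  then have "\<bar>r\<bar> < \<delta>" using y cos_monotone_0_pi_le[of \<delta> "\<bar>r\<bar>"] r \<delta> by force
  then show ?thesis using that[of m] by (simp add: r_def)
qed

lemma l2_of_sum:
  assumes "finite I" "\<And>i. i \<in> I \<Longrightarrow> square_integrable (f i)"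
  shows "square_integrable (\<lambda>x. \<Sum>i\<in>I. f i x)" "l2_of (\<lambda>x. \<Sum>i\<in>I. f i x) = (\<Sum>i\<in>I. l2_of (f i))"
proof -
  have "square_integrable (\<lambda>x. \<Sum>i\<in>I. f i x) \<and> l2_of (\<lambda>x. \<Sum>i\<in>I. f i x) = (\<Sum>i\<in>I. l2_of (f i))"
    using assms
  proof (induction rule: finite_induct)
    case empty
    have "l2_of (\<lambda>x. 0 :: 'b) = 0" unfolding l2_of_def by (simp add: zero_L2_def)
    then show ?case by simp
  next
    case (insert i I)
    then show ?case by (simp add: square_integrable_add l2_of_add)
  qed
  then show "square_integrable (\<lambda>x. \<Sum>i\<in>I. f i x)" "l2_of (\<lambda>x. \<Sum>i\<in>I. f i x) = (\<Sum>i\<in>I. l2_of (f i))"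
    by auto
qed

definition travelling_wave ::
  "nat \<Rightarrow> nat \<Rightarrow> real \<Rightarrow> nat \<Rightarrow> real \<Rightarrow> (nat \<Rightarrow> real \<Rightarrow> 'b::euclidean_space) \<Rightarrow> real \<Rightarrow> real \<Rightarrow> 'b" where
  "travelling_wave n R x0 P \<mu> c s x = (\<Sum>p\<le>P. packet n R x0 (P - p) (x - \<mu> * s) *\<^sub>R c p s)"

lemma continuous_packet: "continuous_on X (packet n R x0 j)"
  by (rule DERIV_continuous_on[OF has_field_derivative_at_within[OF packet_derivative]])

lemma continuous_moving_packet: "continuous_on UNIV (\<lambda>x. packet n R x0 j (x - \<mu> * s))"
  by (rule continuous_on_compose2[OF continuous_packet[of UNIV]]) (auto intro!: continuous_intros)

lemma moving_packet_tower:
  fixes n R x0 \<mu> s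
  defines "F \<equiv> \<lambda>i x. packet n R x0 i (x - \<mu> * s)"
  shows "test_function (F i)" "deriv (F i) = F (Suc i)"
proof -
  have d: "(F i has_real_derivative F (Suc i) x) (at x)" for i x
    unfolding F_def using DERIV_shift[of "packet n R x0 i" _ x "- (\<mu> * s)"]
      packet_derivative[of n R x0 i "x - \<mu> * s"] by simp
  have p: "F i (x + 2 * pi) = F i x" for i x
    unfolding F_def using packet_periodic[of n R x0 i "x - \<mu> * s"] by (simp add: algebra_simps)
  show "test_function (F i)" "deriv (F i) = F (Suc i)"
    by (rule test_function_tower[of F, OF d p])+
qed

lemma continuous_travelling_wave: "continuous_on UNIV (travelling_wave n R x0 P \<mu> c s)"
  unfolding travelling_wave_def
  by (intro continuous_on_sum continuous_on_scaleR continuous_moving_packet continuous_on_const)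

lemma l2_of_travelling_wave:
  "l2_of (travelling_wave n R x0 P \<mu> c s) = (\<Sum>p\<le>P. tens (l2_of (\<lambda>x. packet n R x0 (P - p) (x - \<mu> * s))) (c p s))"
proof -
  have sq: "square_integrable (\<lambda>x. packet n R x0 j (x - \<mu> * s) *\<^sub>R w)" for j and w :: 'a
    by (intro square_integrable_continuous continuous_on_scaleR continuous_moving_packet continuous_on_const)
  show ?thesis
    unfolding travelling_wave_def
    by (subst l2_of_sum(2)) (simp_all add: sq tens_l2_of square_integrable_continuous[OF continuous_moving_packet])
qed

text \<open>
  A wave built from packets and from a formal solution of the adjoint symbol.
\<close>

locale travelling_adjoint_wave =
  fixes D :: "real ^ 'p::finite ^ 'p" and A B K :: "real ^ ('h::finite + 'p) ^ ('h + 'p)"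
    and c c' :: "nat \<Rightarrow> real \<Rightarrow> real ^ ('h + 'p)" and \<mu> :: real and S
    and n R :: nat and x0 :: real and P :: nat
  assumes S: "semigroup_generated B A K S" and B: "B = block_matrix 0 0 0 D"
    and R: "R \<le> n"
    and dc: "\<And>q s. (c q has_vector_derivative c' q s) (at s)"
    and eq0: "\<And>s. transpose B *v c 0 s = 0"
    and eq1: "\<And>s. transpose B *v c 1 s + (transpose A *v c 0 s - \<mu> *\<^sub>R c 0 s) = 0"
    and eq2: "\<And>q s. transpose B *v c (Suc (Suc q)) s + (transpose A *v c (Suc q) s - \<mu> *\<^sub>R c (Suc q) s)
       + c' q s - transpose K *v c q s = 0"
begin

definition "packet_L2 j s = l2_of (\<lambda>x. packet n R x0 j (x - \<mu> * s))"

definition "wave_dt s = (\<Sum>p\<le>P. tens (packet_L2 (P - p) s) (c' p s) + tens ((- \<mu>) *\<^sub>R packet_L2 (Suc (P - p)) s) (c p s))"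

text \<open>
  The adjoint of the generator applied to the wave (see \<open>wave_adjoint\<close>).
\<close>

definition "wave_adj s = (\<Sum>p\<le>P. tens (packet_L2 (Suc (Suc (P - p))) s) (transpose B *v c p s)
   + tens (packet_L2 (Suc (P - p)) s) (transpose A *v c p s) - tens (packet_L2 (P - p) s) (transpose K *v c p s))"

lemma wave_derivative:
  "((\<lambda>s. l2_of (travelling_wave n R x0 P \<mu> c s)) has_vector_derivative wave_dt s) (at s within X)"
  unfolding l2_of_travelling_wave wave_dt_def packet_L2_def[symmetric]
proof (intro has_vector_derivative_sum)
  fix p
  have "((\<lambda>s. packet_L2 (P - p) s) has_vector_derivative (- \<mu>) *\<^sub>R packet_L2 (Suc (P - p)) s) (at s within X)"
    unfolding packet_L2_def
    by (rule translated_profile_has_vector_derivative[of "packet n R x0", OF packet_derivative packet_bound[OF R]])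
  from tens.has_vector_derivative[OF this has_vector_derivative_at_within[OF dc]]
  show "((\<lambda>s. tens (packet_L2 (P - p) s) (c p s)) has_vector_derivative
      tens (packet_L2 (P - p) s) (c' p s) + tens ((- \<mu>) *\<^sub>R packet_L2 (Suc (P - p)) s) (c p s)) (at s within X)" .
qed

lemma wave_adjoint:
  assumes "(h, k) \<in> generator_graph S"
  shows "inner k (l2_of (travelling_wave n R x0 P \<mu> c s)) = inner h (wave_adj s)"
  unfolding l2_of_travelling_wave wave_adj_def packet_L2_def inner_sum_right
proof (rule sum.cong[OF refl])
  fix p
  note t = moving_packet_tower[of n R x0 _ \<mu> s]
  show "inner k (tens (l2_of (\<lambda>x. packet n R x0 (P - p) (x - \<mu> * s))) (c p s)) =
    inner h (tens (l2_of (\<lambda>x. packet n R x0 (Suc (Suc (P - p))) (x - \<mu> * s))) (transpose B *v c p s)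
      + tens (l2_of (\<lambda>x. packet n R x0 (Suc (P - p)) (x - \<mu> * s))) (transpose A *v c p s)
      - tens (l2_of (\<lambda>x. packet n R x0 (P - p) (x - \<mu> * s))) (transpose K *v c p s))"
    using generator_adjoint[OF S B assms t(1)[of "P - p"], of "c p s", unfolded t(2)] .
qed

lemma wave_residual:
  "wave_dt s + wave_adj s = - tens (packet_L2 1 s) (transpose B *v c (Suc P) s)
    - tens (packet_L2 0 s) (transpose B *v c (Suc (Suc P)) s + (transpose A *v c (Suc P) s - \<mu> *\<^sub>R c (Suc P) s))"
proof -
  have "wave_dt s + wave_adj s = (\<Sum>p\<le>P. tens (packet_L2 (Suc (Suc (P - p))) s) (transpose B *v c p s)
      + tens (packet_L2 (Suc (P - p)) s) (transpose A *v c p s - \<mu> *\<^sub>R c p s)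
      + tens (packet_L2 (P - p) s) (c' p s - transpose K *v c p s))"
    unfolding wave_dt_def wave_adj_def sum.distrib[symmetric]
    by (rule sum.cong[OF refl])
      (simp only: tens.diff_right tens.scaleR_left tens.scaleR_right, simp add: algebra_simps)
  also have "\<dots> = - tens (packet_L2 1 s) (transpose B *v c (Suc P) s)
    - tens (packet_L2 0 s) (transpose B *v c (Suc (Suc P)) s + (transpose A *v c (Suc P) s - \<mu> *\<^sub>R c (Suc P) s))"
  proof (rule residual_telescopes[where X = "\<lambda>j. tens (packet_L2 j s)" and b = "\<lambda>v. transpose B *v v"
        and a = "\<lambda>v. transpose A *v v - \<mu> *\<^sub>R v" and k = "\<lambda>v. transpose K *v v"
        and c = "\<lambda>p. c p s" and c' = "\<lambda>p. c' p s"])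
    show "linear (tens (packet_L2 j s) :: real ^ ('h + 'p) \<Rightarrow> _)" for j
      by (rule bounded_linear.linear[OF tens.bounded_linear_right])
  qed (rule eq0 eq1 eq2)+
  finally show ?thesis .
qed

text \<open>
  No derivative of the packet above the first one survives in the residual: it grows only linearly in
  the frequency, whatever the order \<open>P\<close>.
\<close>

lemma wave_residual_bound:
  assumes "norm (transpose B *v c (Suc P) s) \<le> N1"
    "norm (transpose B *v c (Suc (Suc P)) s + (transpose A *v c (Suc P) s - \<mu> *\<^sub>R c (Suc P) s)) \<le> N0"
  shows "norm (wave_dt s + wave_adj s) \<le> sqrt (2 * pi) * ((real n + real R) * N1 + N0)"
proof -
  have b: "norm (packet_L2 j s) \<le> sqrt (2 * pi) * (real n + real R) ^ j" for j
    unfolding packet_L2_def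
    by (rule norm_l2_of_le) (auto intro!: continuous_measurable_torus continuous_moving_packet packet_bound[OF R])
  have "norm (wave_dt s + wave_adj s) \<le> norm (tens (packet_L2 1 s) (transpose B *v c (Suc P) s))
    + norm (tens (packet_L2 0 s) (transpose B *v c (Suc (Suc P)) s + (transpose A *v c (Suc P) s - \<mu> *\<^sub>R c (Suc P) s)))"
    unfolding wave_residual by (rule order_trans[OF norm_triangle_ineq4]) (simp only: norm_minus_cancel order_refl)
  also have "\<dots> \<le> (sqrt (2 * pi) * (real n + real R) ^ 1) * N1 + (sqrt (2 * pi) * (real n + real R) ^ 0) * N0"
    unfolding norm_tens by (intro add_mono mult_mono b assms) auto
  finally show ?thesis by (simp add: algebra_simps)
qed

end


lemma bounded_on_time_interval:
  fixes g :: "real \<Rightarrow> 'b::real_normed_vector"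
  assumes "continuous_on {0..T} g"
  obtains C where "0 \<le> C" "\<And>s. s \<in> {0..T} \<Longrightarrow> norm (g s) \<le> C"
proof -
  have "bounded (g ` {0..T})" by (intro compact_imp_bounded compact_continuous_image assms) simp
  then obtain C where "C > 0" "\<forall>y\<in>g ` {0..T}. norm y \<le> C" using bounded_pos by blast
  then show ?thesis using that[of C] by auto
qed

lemma travelling_wave_small_off_support:
  assumes small: "\<And>n R x0 j x. n \<ge> n0 \<Longrightarrow> R \<le> n \<Longrightarrow> cos (x - x0) \<le> cos \<delta> \<Longrightarrow>
       \<bar>packet n R x0 j x\<bar> \<le> fact j * exp 2 * real n ^ j * q ^ (2*R)"
    and n: "n \<ge> n0" "R \<le> n" "1 \<le> n" and q: "0 \<le> q" and off: "cos (x - \<mu> * s - x0) \<le> cos \<delta>"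
    and c: "\<And>p. p \<le> P \<Longrightarrow> norm (c p s) \<le> b p"
  shows "norm (travelling_wave n R x0 P \<mu> c s x) \<le> (\<Sum>p\<le>P. fact P * exp 2 * b p) * (real n ^ P * q ^ (2*R))"
  unfolding travelling_wave_def sum_distrib_right
proof (rule sum_norm_le)
  fix p assume p: "p \<in> {..P}"
  have "\<bar>packet n R x0 (P - p) (x - \<mu> * s)\<bar> \<le> fact (P - p) * exp 2 * real n ^ (P - p) * q ^ (2*R)"
    by (rule small[OF n(1,2) off])
  also have "\<dots> \<le> fact P * exp 2 * real n ^ P * q ^ (2*R)"
  proof -
    have "fact (P - p) * exp 2 * real n ^ (P - p) \<le> fact P * exp 2 * real n ^ P"
      using n by (intro mult_mono power_increasing fact_mono) auto
    then show ?thesis using q by (intro mult_right_mono) auto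
  qed
  finally have "\<bar>packet n R x0 (P - p) (x - \<mu> * s)\<bar> * norm (c p s) \<le> (fact P * exp 2 * real n ^ P * q ^ (2*R)) * b p"
    using c[of p] p q by (intro mult_mono) auto
  then show "norm (packet n R x0 (P - p) (x - \<mu> * s) *\<^sub>R c p s) \<le> fact P * exp 2 * b p * (real n ^ P * q ^ (2*R))"
    by (simp add: mult_ac)
qed

theorem proposition18:
  fixes D :: "real ^ 'p ^ 'p"
    and A' :: "real ^ 'h ^ 'h"
    and A12 :: "real ^ 'p ^ 'h"
    and A21 :: "real ^ 'h ^ 'p"
    and A22 :: "real ^ 'p ^ 'p"
    and A B K :: "real ^ ('h::finite + 'p::finite) ^ ('h + 'p)"
    and M :: "real ^ 'm::finite ^ ('h + 'p)"
    and \<omega> :: "complex set"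
    and T :: real
  assumes "CARD('m) \<le> CARD('h + 'p)"
    and "\<forall>l\<in>Sp D. Re l > 0"
    and "B = block_matrix 0 0 0 D"
    and "A = block_matrix A' A12 A21 A22"
    and "diagonalizable A'"
    and "Sp A' \<subseteq> \<real>"
    and "openin (top_of_set (sphere 0 1)) \<omega>"
    and "\<omega> \<noteq> {}"
    and nondegenerate: "min_speed A' = 0 \<Longrightarrow> gap_length \<omega> > 0"
    and "T > 0"
    and "\<exists>N\<ge>1. \<exists>k. \<forall>f0\<in>sobolev k.
           (\<forall>n. \<bar>n\<bar> \<le> int N \<longrightarrow> fourier_coeff f0 n = 0) \<longrightarrow> steerable_to_zero B A K M \<omega> T f0"
  shows "ereal T \<ge> minimal_time A' \<omega>"
proof (rule ccontr)
  assume neg: "\<not> ereal T \<ge> minimal_time A' \<omega>"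
  note B = assms(3) and \<omega> = assms(7) and T = assms(10)
  obtain \<mu> and e and c c' :: "nat \<Rightarrow> real \<Rightarrow> real ^ ('h + 'p)" where
    \<mu>: "\<bar>\<mu>\<bar> = min_speed A'" and e: "e \<noteq> 0"
    and dc: "\<And>q s. (c q has_vector_derivative c' q s) (at s)"
    and c0: "c 0 0 = e" "\<And>q. e \<bullet> c (Suc q) 0 = 0"
    and eqs: "\<And>s. transpose B *v c 0 s = 0"
      "\<And>s. transpose B *v c 1 s + (transpose A *v c 0 s - \<mu> *\<^sub>R c 0 s) = 0"
      "\<And>q s. transpose B *v c (Suc (Suc q)) s + (transpose A *v c (Suc q) s - \<mu> *\<^sub>R c (Suc q) s)
       + c' q s - transpose K *v c q s = 0"
    by (rule adjoint_profiles[OF assms(2-5), where K = K]) (rule that)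
  have gap: "\<bar>\<mu>\<bar> * T < gap_length \<omega>"
  proof (cases "min_speed A' = 0")
    case True
    then show ?thesis using nondegenerate \<mu> by simp
  next
    case False
    then have pos: "min_speed A' > 0" using \<mu> by linarith
    then have "T < gap_length \<omega> / min_speed A'" using neg by (simp add: minimal_time_def not_le)
    then show ?thesis using pos \<mu> by (simp add: field_simps)
  qed
  obtain a b where ab: "\<bar>\<mu>\<bar> * T < b - a" "b - a < 2 * pi" "\<And>x. a \<le> x \<Longrightarrow> x \<le> b \<Longrightarrow> cis x \<notin> \<omega>"
    using long_gap_contains_long_interval[OF \<omega> assms(8) _ gap] T by (metis abs_ge_zero mult_nonneg_nonneg less_imp_le)
  \<comment> \<open>During \<open>[0, T]\<close> a packet of half width \<open>\<delta>\<close> started at \<open>x0\<close> sweeps \<open>[a, b]\<close>, whatever the sign of \<open>\<mu>\<close>.\<close>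
  define \<delta> where "\<delta> = (b - a - \<bar>\<mu>\<bar> * T) / 2"
  define x0 where "x0 = (if \<mu> \<ge> 0 then a + \<delta> else b - \<delta>)"
  have "\<bar>\<mu>\<bar> * T \<ge> 0" using T by simp
  then have \<delta>: "0 < \<delta>" "\<delta> \<le> pi" using ab(1,2) by (auto simp: \<delta>_def)
  have off: "cos (x - \<mu> * s - x0) \<le> cos \<delta>" if s: "s \<in> {0..T}" and x: "cis x \<in> \<omega>" for s x
  proof (rule ccontr)
    assume "\<not> ?thesis"
    then have "cos \<delta> < cos (x - \<mu> * s - x0)" by simp
    then obtain m :: int where m: "\<bar>x - \<mu> * s - x0 - 2 * pi * m\<bar> < \<delta>"
      using cos_large_imp_near_period[of \<delta> "x - \<mu> * s - x0"] \<delta> by auto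
    have "\<bar>\<mu> * s\<bar> \<le> \<bar>\<mu>\<bar> * T" using s by (simp add: abs_mult mult_left_mono)
    moreover have "\<mu> \<ge> 0 \<Longrightarrow> \<mu> * s \<ge> 0" "\<mu> < 0 \<Longrightarrow> \<mu> * s \<le> 0"
      using s by (auto simp: mult_nonpos_nonneg)
    moreover have "2 * \<delta> = b - a - \<bar>\<mu>\<bar> * T" by (simp add: \<delta>_def)
    ultimately have "a \<le> x - 2 * pi * m" "x - 2 * pi * m \<le> b"
      using m unfolding x0_def by (smt (verit))+
    then have "cis (x - 2 * pi * m) \<notin> \<omega>" by (rule ab(3))
    moreover have "cis (x - 2 * pi * m) = cis x" by (simp flip: cis_divide)
    ultimately show False using x by simp
  qed
  obtain q n0 where q: "0 < q" "q < 1"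
    and small: "\<And>n R x0 j x. n \<ge> n0 \<Longrightarrow> R \<le> n \<Longrightarrow> cos (x - x0) \<le> cos \<delta> \<Longrightarrow>
       \<bar>packet n R x0 j x\<bar> \<le> fact j * exp 2 * real n ^ j * q ^ (2*R)"
    using packet_small_off_support[OF \<delta>] by metis
  obtain N k where steer: "\<And>f0. f0 \<in> sobolev k \<Longrightarrow> (\<And>n. \<bar>n\<bar> \<le> int N \<Longrightarrow> fourier_coeff f0 n = 0)
      \<Longrightarrow> steerable_to_zero B A K M \<omega> T f0"
    using assms(11) by metis
  \<comment> \<open>The pairing with \<open>f0\<close> will grow like \<open>n ^ (P - Suc k)\<close> up to the normalisation of the packet, of
    order at most \<open>n\<close>; the residual only like \<open>n\<close>. So \<open>P\<close> must exceed \<open>k\<close> by a margin; being a multiple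
    of 4 it spares a phase factor \<open>\<i> ^ P\<close>.\<close>
  define P where "P = 4 * Suc k"
  define f0 where "f0 = tens (lacunary k N 0) e"
  have "f0 \<in> sobolev k" using lacunary_sobolev[of k k N e] by (simp add: f0_def)
  moreover have "fourier_coeff f0 n = 0" if "\<bar>n\<bar> \<le> int N" for n
  proof -
    have "int N < 2 ^ N" using of_nat_less_two_power[of N, where 'a = int] by simp
    then have "\<bar>n\<bar> < 4 * 2 ^ N" using that by linarith
    then show ?thesis unfolding f0_def by (rule lacunary_fourier_coeff_zero)
  qed
  ultimately obtain u f where u: "admissible_control T \<omega> u" and f: "mild_solution B A K M \<omega> T f0 u f" "f T = 0"
    using steer unfolding steerable_to_zero_def by blast
  obtain S where S: "semigroup_generated B A K S"
    and duh: "\<forall>t\<in>{0..T}. ((\<lambda>s. S (t - s) (forcing M \<omega> u s)) has_integral (f t - S t f0)) {0..t}"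
    using f(1) unfolding mild_solution_def by blast
  have C0: "C0_semigroup S" using S by (simp add: semigroup_generated_def)
  have "((\<lambda>s. S (T - s) (forcing M \<omega> u s)) has_integral (0 - S T f0)) {0..T}"
    using bspec[OF duh, of T] T f(2) by simp
  then obtain C where C: "C \<ge> 0"
    and ineq: "\<And>\<Phi> \<epsilon> \<eta>. approximate_adjoint_wave S T \<omega> \<Phi> \<epsilon> \<eta> \<Longrightarrow>
      \<bar>inner f0 (l2_of (\<Phi> 0))\<bar> \<le> C * (\<epsilon> + \<eta>)"
    by (rule steering_inequality[OF C0 T u \<omega>]) (rule that)
  have cc: "continuous_on X (c p)" for X p
    using dc by (intro continuous_at_imp_continuous_on ballI has_vector_derivative_continuous) blast
  have cmat: "continuous_on X (\<lambda>s. Z *v c p s)" for X p and Z :: "real ^ ('h + 'p) ^ ('h + 'p)"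
    using linear_continuous_on_compose[OF cc matrix_vector_mul_linear] .
  obtain N1 where N1: "0 \<le> N1" "\<And>s. s \<in> {0..T} \<Longrightarrow> norm (transpose B *v c (Suc P) s) \<le> N1"
    by (rule bounded_on_time_interval[OF cmat[of "{0..T}" "transpose B" "Suc P"]]) (rule that)
  obtain N0 where N0: "0 \<le> N0" "\<And>s. s \<in> {0..T} \<Longrightarrow>
      norm (transpose B *v c (Suc (Suc P)) s + (transpose A *v c (Suc P) s - \<mu> *\<^sub>R c (Suc P) s)) \<le> N0"
    by (rule bounded_on_time_interval[of T "\<lambda>s. transpose B *v c (Suc (Suc P)) s
        + (transpose A *v c (Suc P) s - \<mu> *\<^sub>R c (Suc P) s)"])
      (intro continuous_intros cmat cc, rule that)
  have "\<exists>b. \<forall>s\<in>{0..T}. norm (c p s) \<le> b" for p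
    using bounded_on_time_interval[OF cc[of "{0..T}" p]] by metis
  then obtain bc where bc: "\<And>p s. s \<in> {0..T} \<Longrightarrow> norm (c p s) \<le> bc p" by metis
  define E where "E = (\<Sum>p\<le>P. fact P * exp 2 * bc p)"
  have "bc p \<ge> 0" for p using bc[of 0 p] T by (auto intro: order_trans[OF norm_ge_zero])
  then have E: "E \<ge> 0" unfolding E_def by (intro sum_nonneg mult_nonneg_nonneg) auto
  have "0 < q\<^sup>2" "q\<^sup>2 < 1" using q by (auto simp: power_less_one_iff abs_square_less_1)
  then obtain K0 where K0: "\<And>n. real n ^ P * (q\<^sup>2) ^ n \<le> K0"
    using power_times_geometric_bounded[of "q\<^sup>2" P] by metis
  define C2 where "C2 = C * (sqrt (2 * pi) * (5 * N1 + N0) + E * 4 ^ P * K0)"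
  \<comment> \<open>The two sides of the steering inequality, of order \<open>R\<^sup>2\<close> and \<open>R\<close>, divided by \<open>R\<close>.\<close>
  have key: "(norm e)\<^sup>2 * real R \<le> C2" if R: "R = 2 ^ (i + N)" and n0: "n0 \<le> 4 * R" for R i
  proof -
    have R1: "1 \<le> R" by (simp add: R)
    define \<Phi> where "\<Phi> = travelling_wave (4 * R) R x0 P \<mu> c"
    define \<eta> where "\<eta> = E * (real (4 * R) ^ P * q ^ (2 * R))"
    define \<epsilon> where "\<epsilon> = sqrt (2 * pi) * ((real (4 * R) + real R) * N1 + N0)"
    have R4: "R \<le> 4 * R" by simp
    interpret w: travelling_adjoint_wave D A B K c c' \<mu> S "4 * R" R x0 P
      by (rule travelling_adjoint_wave.intro) (rule S B R4 dc eqs)+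
    have "approximate_adjoint_wave S T \<omega> \<Phi> \<epsilon> \<eta>"
      unfolding approximate_adjoint_wave_def
    proof (intro conjI exI ballI allI impI)
      show "((\<lambda>s. l2_of (\<Phi> s)) has_vector_derivative w.wave_dt s) (at s within {0..T})" for s
        unfolding \<Phi>_def by (rule w.wave_derivative)
      show "inner k (l2_of (\<Phi> s)) = inner h (w.wave_adj s)"
        if "(h, k) \<in> generator_graph S" for h k s
        unfolding \<Phi>_def by (rule w.wave_adjoint[OF that])
      show "norm (w.wave_dt s + w.wave_adj s) \<le> \<epsilon>" if "s \<in> {0..T}" for s
        unfolding \<epsilon>_def by (rule w.wave_residual_bound[OF N1(2)[OF that] N0(2)[OF that]])
      show "continuous_on UNIV (\<Phi> s)" for s unfolding \<Phi>_def by (rule continuous_travelling_wave)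
      show "norm (\<Phi> s x) \<le> \<eta>" if "s \<in> {0..T}" "cis x \<in> \<omega>" for s x
        unfolding \<Phi>_def \<eta>_def E_def
      proof (rule travelling_wave_small_off_support[of n0 \<delta> q "4 * R" R x \<mu> s x0 P c bc])
        show "norm (c p s) \<le> bc p" for p by (rule bc[OF that(1)])
        show "cos (x - \<mu> * s - x0) \<le> cos \<delta>" by (rule off[OF that])
      qed (use R1 q n0 in \<open>auto intro: small\<close>)
      show "\<eta> \<ge> 0" using E q by (simp add: \<eta>_def)
    qed
    then have "\<bar>inner f0 (l2_of (\<Phi> 0))\<bar> \<le> C * (\<epsilon> + \<eta>)" by (rule ineq)
    moreover have "inner f0 (l2_of (\<Phi> 0)) = inner (lacunary k N 0) (l2_of (packet (4 * R) R x0 P)) * (norm e)\<^sup>2"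
    proof -
      have "inner f0 (l2_of (\<Phi> 0)) = (\<Sum>p\<le>P. inner (lacunary k N 0) (l2_of (packet (4 * R) R x0 (P - p))) * (e \<bullet> c p 0))"
        unfolding f0_def \<Phi>_def l2_of_travelling_wave inner_sum_right inner_tens_tens by simp
      also have "\<dots> = (\<Sum>p\<le>P. if p = 0 then inner (lacunary k N 0) (l2_of (packet (4 * R) R x0 P)) * (norm e)\<^sup>2 else 0)"
      proof (rule sum.cong[OF refl])
        fix p
        show "inner (lacunary k N 0) (l2_of (packet (4 * R) R x0 (P - p))) * (e \<bullet> c p 0)
          = (if p = 0 then inner (lacunary k N 0) (l2_of (packet (4 * R) R x0 P)) * (norm e)\<^sup>2 else 0)"
          by (cases p) (simp_all add: c0 power2_norm_eq_inner)
      qed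
      finally show ?thesis by simp
    qed
    moreover have "inner (lacunary k N 0) (l2_of (packet (4 * R) R x0 P)) \<ge> (real R)\<^sup>2"
    proof -
      have "inner (lacunary k N 0) (l2_of (packet (4 * R) R x0 P))
        = pi * real (4 * R) ^ P / real (4 * R) ^ Suc k * (real ((2*R) choose R) / 4^R)"
        by (rule lacunary_packet_pairing[OF _ R]) (simp add: P_def)
      also have "real (4 * R) ^ P / real (4 * R) ^ Suc k = real (4 * R) ^ (3 * Suc k)"
      proof -
        have "P = 3 * Suc k + Suc k" by (simp add: P_def)
        then have "real (4 * R) ^ P = real (4 * R) ^ (3 * Suc k) * real (4 * R) ^ Suc k"
          by (simp only: power_add)
        then show ?thesis using R1 by simp
      qed
      then have "pi * real (4 * R) ^ P / real (4 * R) ^ Suc k * (real ((2*R) choose R) / 4^R)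
         = pi * real (4 * R) ^ (3 * Suc k) * (real ((2*R) choose R) / 4^R)"
        by (metis times_divide_eq_right)
      also have "\<dots> \<ge> 1 * real (4 * R) ^ 3 * (1 / (2 * real R))"
      proof (intro mult_mono)
        show "1 \<le> pi" using pi_gt3 by simp
        show "real (4 * R) ^ 3 \<le> real (4 * R) ^ (3 * Suc k)" using R1 by (intro power_increasing) auto
        show "1 / (2 * real R) \<le> real ((2*R) choose R) / 4^R"
          using central_binomial_lower_bound[of R] R1 by (simp add: field_simps)
      qed auto
      also have "1 * real (4 * R) ^ 3 * (1 / (2 * real R)) = 32 * (real R)\<^sup>2"
        using R1 by (simp add: power2_eq_square power3_eq_cube)
      finally have "32 * (real R)\<^sup>2 \<le> inner (lacunary k N 0) (l2_of (packet (4 * R) R x0 P))" .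
      then show ?thesis using zero_le_power2[of "real R"] by linarith
    qed
    ultimately have "(norm e)\<^sup>2 * (real R)\<^sup>2 \<le> C * (\<epsilon> + \<eta>)"
      by (smt (verit, ccfv_SIG) mult.commute mult_right_mono zero_le_power2)
    also have "\<dots> \<le> C2 * real R"
    proof -
      have "\<epsilon> \<le> sqrt (2 * pi) * (5 * N1 + N0) * real R"
      proof -
        have "N0 * 1 \<le> N0 * real R" using N0(1) R1 by (intro mult_left_mono) auto
        then have "(real (4 * R) + real R) * N1 + N0 \<le> (5 * N1 + N0) * real R" by (simp add: algebra_simps)
        then show ?thesis unfolding \<epsilon>_def mult.assoc by (intro mult_left_mono) auto
      qed
      moreover have "\<eta> \<le> E * 4 ^ P * K0 * real R"
      proof -
        have "\<eta> = E * 4 ^ P * (real R ^ P * (q\<^sup>2) ^ R)"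
          by (simp add: \<eta>_def power_mult_distrib mult_ac flip: power_mult)
        also have "\<dots> \<le> E * 4 ^ P * K0" using E by (intro mult_left_mono K0) auto
        also have "\<dots> \<le> E * 4 ^ P * K0 * real R"
        proof -
          have "K0 \<ge> 0" using K0[of 0] K0[of 1] q by (auto intro: order_trans[of 0 "(q\<^sup>2)"])
          then have "E * 4 ^ P * K0 * 1 \<le> E * 4 ^ P * K0 * real R" using E R1 by (intro mult_left_mono) auto
          then show ?thesis by simp
        qed
        finally show ?thesis .
      qed
      ultimately have "\<epsilon> + \<eta> \<le> (sqrt (2 * pi) * (5 * N1 + N0) + E * 4 ^ P * K0) * real R"
        by (simp add: algebra_simps)
      then show ?thesis unfolding C2_def mult.assoc[of C] by (rule mult_left_mono[OF _ C])
    qed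
    finally have "((norm e)\<^sup>2 * real R) * real R \<le> C2 * real R" by (simp add: power2_eq_square mult.assoc)
    then show ?thesis using R1 by (simp add: mult_le_cancel_right)
  qed
  obtain i :: nat where i: "max (real n0) (C2 / (norm e)\<^sup>2) < real i" using reals_Archimedean2 by blast
  define R :: nat where "R = 2 ^ (i + N)"
  have "i < 2 ^ i" by (rule less_exp)
  also have "(2::nat) ^ i \<le> R" unfolding R_def by (intro power_increasing) auto
  finally have iR: "i < R" .
  then have "n0 \<le> 4 * R" using i by auto
  then have "(norm e)\<^sup>2 * real R \<le> C2" by (rule key[OF R_def])
  moreover have "C2 < (norm e)\<^sup>2 * real R"
  proof -
    have "C2 / (norm e)\<^sup>2 < real R" using i iR by simp
    then show ?thesis using e by (simp add: field_simps)
  qed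
  ultimately show False by simp
qed

end
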